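(* Let $\mathcal A$ be a toric arrangement in $T=(\mathbb C^* )^d$. The algebras $\operatorname{A}(\mathcal A)$ and $\operatorname{B}(\mathcal A)$ defined in the context are isomorphic.
   Context: A toric arrangement in $T=(\mathbb C^* )^d$ is a finite set $\mathcal A=\{Y_1,\dots,Y_n\}$ with $Y_i=\chi_i^{-1}(a_i)$, where $\chi_i\in\operatorname{Hom}(T,\mathbb C^* )$ is a nontrivial character and $a_i\in\mathbb C^*$. A layer of $\mathcal A$ is a connected component of a non-empty intersection of elements of $\mathcal A$ (the empty intersection being $T$). $\mathcal C$ denotes the set of layers, ordered by reverse inclusion: $L\le L'$ iff $L'\subseteq L$. The rank $\operatorname{rk}(L)$ is the complex codimension of $L$ in $T$. Let $Y_i^{\upharpoonright}\subset\mathbb C^d$ be the linear hyperplane through the origin that is a translate of any hyperplane lifting (a component of) $Y_i$ to the universal cover $\mathbb C^d$ of $T$, and $\mathcal A_0=\{Y_1^{\upharpoonright},\dots,Y_n^{\upharpoonright}\}$. For a layer $L$, let $\mathcal A[L]=\{Y_j^{\upharpoonright}\in\mathcal A_0\mid L\subseteq Y_j\}$, with complement $M(\mathcal A[L])=\mathbb C^d\setminus\bigcup\mathcal A[L]$. For $L\in\mathcal C$ put $\mathscr L_L=H^*(L;\mathbb Z)\otimes H^*(M(\mathcal A[L]);\mathbb Z)$ (tensor product of graded rings) and $\mathscr L_L^q=H^*(L;\mathbb Z)\otimes H^q(M(\mathcal A[L]);\mathbb Z)$. For $L'\le L$ let $\mathscr L_{L'\le L}=i^*\otimes b:\mathscr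 L_{L'}\to\mathscr L_L$, where $i:L\hookrightarrow L'$ is the inclusion and $b:H^*(M(\mathcal A[L']);\mathbb Z)\to H^*(M(\mathcal A[L]);\mathbb Z)$ is induced by the inclusion $M(\mathcal A[L])\subseteq M(\mathcal A[L'])$. The algebra $\operatorname{A}(\mathcal A)$ is the group $\bigoplus_{L\in\mathcal C}\mathscr L_L^{\operatorname{rk}(L)}$ with the bilinear product determined as follows: for $\alpha\in\mathscr L_L^{\operatorname{rk}(L)}$ and $\alpha'\in\mathscr L_{L'}^{\operatorname{rk}(L')}$, the $L''$-component of the product is $\mathscr L_{L\le L''}(\alpha)\cup\mathscr L_{L'\le L''}(\alpha')$ (product in $\mathscr L_{L''}$) if $L''\subseteq L\cap L'$ and $\operatorname{rk}(L'')=\operatorname{rk}(L)+\operatorname{rk}(L')$, and $0$ otherwise. An element $\alpha=(\alpha_L)_L\in\bigoplus_{L\in\mathcal C}\mathscr L_L$ is coherent if for every integer $q$ and every layer $L$ with $\operatorname{rk}(L)>q$ one has $\sum_{L'}\mathscr L_{L'\le L}(\alpha_{L'}^q)=\alpha_L^q$, the sum being over all layers $L'\le L$ with $\operatorname{rk}(L')=q$, where $\alpha_L^q$ is the component of $\alpha_L$ in $\mathscr L_L^q$. The algebra $\operatorname{B}(\mathcal A)$ is the set of coherent elements, which is a subring of the direct sum of rings $\bigoplus_{L\in\mathcal C}\mathscr L_L$ (componentwise product). *)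

theory Defs
  imports "HOL-Analysis.Analysis" "HOL-Homology.Homology" "HOL-Algebra.QuotRing"
    "HOL-Algebra.Generated_Groups" "HOL-Algebra.Free_Abelian_Groups"
begin

section \<open>Graded rings and their tensor products\<close>

text \<open>
  A graded ring is given by its homogeneous parts, the products between them and its unit
  (an element of degree 0). As in the library, abelian groups are written multiplicatively.
\<close>

record 'a graded_ring =
  gpart :: "nat \<Rightarrow> 'a monoid"
  gmult :: "nat \<Rightarrow> nat \<Rightarrow> 'a \<Rightarrow> 'a \<Rightarrow> 'a"
  gone :: 'a

definition ring_on :: "'a monoid \<Rightarrow> ('a \<Rightarrow> 'a \<Rightarrow> 'a) \<Rightarrow> 'a \<Rightarrow> 'a ring" where
  "ring_on G m e = \<lparr>carrier = carrier G, mult = m, one = e, zero = \<one>\<^bsub>G\<^esub>, add = mult G\<rparr>"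

definition tensor_relations ::
    "'a monoid \<Rightarrow> 'b monoid \<Rightarrow> ('a \<times> 'b \<Rightarrow>\<^sub>0 int) set" where
  "tensor_relations G H = generate (free_Abelian_group (carrier G \<times> carrier H))
     ({frag_of (a \<otimes>\<^bsub>G\<^esub> a', b) - frag_of (a, b) - frag_of (a', b) | a a' b.
         a \<in> carrier G \<and> a' \<in> carrier G \<and> b \<in> carrier H} \<union>
      {frag_of (a, b \<otimes>\<^bsub>H\<^esub> b') - frag_of (a, b) - frag_of (a, b') | a b b'.
         a \<in> carrier G \<and> b \<in> carrier H \<and> b' \<in> carrier H})"

definition tensor_group ::
    "'a monoid \<Rightarrow> 'b monoid \<Rightarrow> ('a \<times> 'b \<Rightarrow>\<^sub>0 int) set monoid" where
  "tensor_group G H =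
     free_Abelian_group (carrier G \<times> carrier H) Mod tensor_relations G H"

definition pure_tensor ::
    "'a monoid \<Rightarrow> 'b monoid \<Rightarrow> 'a \<Rightarrow> 'b \<Rightarrow> ('a \<times> 'b \<Rightarrow>\<^sub>0 int) set" where
  "pure_tensor G H a b =
     tensor_relations G H #>\<^bsub>free_Abelian_group (carrier G \<times> carrier H)\<^esub> frag_of (a, b)"

text \<open>
  Maps out of a quotient group are defined on a coset by applying the map to all of its
  representatives and multiplying by the target subgroup. When the map respects the subgroups,
  the result is the coset of the image of any representative.

  The next map is \<open>f \<otimes> g\<close>, with values in \<open>tensor_group G H\<close>.
\<close>

definition tensor_map ::
    "'c monoid \<Rightarrow> 'd monoid \<Rightarrow> ('a \<Rightarrow> 'c) \<Rightarrow> ('b \<Rightarrow> 'd) \<Rightarrow>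
     ('a \<times> 'b \<Rightarrow>\<^sub>0 int) set \<Rightarrow> ('c \<times> 'd \<Rightarrow>\<^sub>0 int) set" where
  "tensor_map G H f g C =
     tensor_relations G H <#>\<^bsub>free_Abelian_group (carrier G \<times> carrier H)\<^esub>
       (frag_extend (\<lambda>(a, b). frag_of (f a, g b)) ` C)"

text \<open>
  The bilinear product of the bidegree \<open>(p, q)\<close> and \<open>(p', q')\<close> parts of the tensor product of
  graded rings, \<open>(a \<otimes> b) (a' \<otimes> b') = (-1)^(q p') (a a') \<otimes> (b b')\<close>.
\<close>

definition tensor_mult ::
    "'a graded_ring \<Rightarrow> 'b graded_ring \<Rightarrow> nat \<Rightarrow> nat \<Rightarrow> nat \<Rightarrow> nat \<Rightarrow>
     ('a \<times> 'b \<Rightarrow>\<^sub>0 int) set \<Rightarrow> ('a \<times> 'b \<Rightarrow>\<^sub>0 int) set \<Rightarrow> ('a \<times> 'b \<Rightarrow>\<^sub>0 int) set" where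
  "tensor_mult R S p q p' q' C D =
     tensor_relations (gpart R (p + p')) (gpart S (q + q'))
       <#>\<^bsub>free_Abelian_group (carrier (gpart R (p + p')) \<times> carrier (gpart S (q + q')))\<^esub>
       {frag_extend (\<lambda>(a, b). frag_extend (\<lambda>(a', b').
          frag_cmul ((-1) ^ (q * p')) (frag_of (gmult R p p' a a', gmult S q q' b b'))) y) x
        | x y. x \<in> C \<and> y \<in> D}"

type_synonym ('a, 'b) tensor = "nat \<times> nat \<Rightarrow> ('a \<times> 'b \<Rightarrow>\<^sub>0 int) set"

definition tensor_ring :: "'a graded_ring \<Rightarrow> 'b graded_ring \<Rightarrow> ('a, 'b) tensor ring" where
  "tensor_ring R S = ring_on
     (sum_group UNIV (\<lambda>(p, q). tensor_group (gpart R p) (gpart S q)))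
     (\<lambda>x y (r, s). finprod (tensor_group (gpart R r) (gpart S s))
        (\<lambda>(p, q). tensor_mult R S p q (r - p) (s - q) (x (p, q)) (y (r - p, s - q)))
        ({..r} \<times> {..s}))
     (\<lambda>(p, q). if p = 0 \<and> q = 0 then pure_tensor (gpart R 0) (gpart S 0) (gone R) (gone S)
        else \<one>\<^bsub>tensor_group (gpart R p) (gpart S q)\<^esub>)"

definition tensor_ring_map ::
    "'c graded_ring \<Rightarrow> 'd graded_ring \<Rightarrow> (nat \<Rightarrow> 'a \<Rightarrow> 'c) \<Rightarrow> (nat \<Rightarrow> 'b \<Rightarrow> 'd) \<Rightarrow>
     ('a, 'b) tensor \<Rightarrow> ('c, 'd) tensor" where
  "tensor_ring_map R S f g x =
     (\<lambda>(p, q). tensor_map (gpart R p) (gpart S q) (f p) (g q) (x (p, q)))"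

definition second_degree_part :: "('a, 'b) tensor ring \<Rightarrow> nat \<Rightarrow> ('a, 'b) tensor set" where
  "second_degree_part R q = {x \<in> carrier R. \<forall>p s. s \<noteq> q \<longrightarrow> x (p, s) = \<zero>\<^bsub>R\<^esub> (p, s)}"

definition second_degree_component ::
    "('a, 'b) tensor ring \<Rightarrow> nat \<Rightarrow> ('a, 'b) tensor \<Rightarrow> ('a, 'b) tensor" where
  "second_degree_component R q x = (\<lambda>(p, s). if s = q then x (p, s) else \<zero>\<^bsub>R\<^esub> (p, s))"

definition direct_sum_ring :: "'i set \<Rightarrow> ('i \<Rightarrow> 'a ring) \<Rightarrow> ('i \<Rightarrow> 'a) ring" where
  "direct_sum_ring I R = ring_on (sum_group I (\<lambda>i. add_monoid (R i)))
     (\<lambda>x y. \<lambda>i\<in>I. x i \<otimes>\<^bsub>R i\<^esub> y i) (\<lambda>i\<in>I. \<one>\<^bsub>R i\<^esub>)"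


section \<open>Singular cohomology rings with integer coefficients\<close>

type_synonym 'a cochain = "((nat \<Rightarrow> real) \<Rightarrow> 'a) \<Rightarrow> int"

definition cochain_group :: "nat \<Rightarrow> 'a topology \<Rightarrow> 'a cochain monoid" where
  "cochain_group p X = product_group (singular_simplex_set p X) (\<lambda>_. integer_group)"

definition coboundary :: "nat \<Rightarrow> 'a topology \<Rightarrow> 'a cochain \<Rightarrow> 'a cochain" where
  "coboundary p X \<phi> = (\<lambda>\<sigma>\<in>singular_simplex_set (Suc p) X.
     \<Sum>k\<le>Suc p. (-1) ^ k * \<phi> (singular_face (Suc p) k \<sigma>))"

definition cocycles :: "nat \<Rightarrow> 'a topology \<Rightarrow> 'a cochain set" where
  "cocycles p X = kernel (cochain_group p X) (cochain_group (Suc p) X) (coboundary p X)"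

definition coboundaries :: "nat \<Rightarrow> 'a topology \<Rightarrow> 'a cochain set" where
  "coboundaries p X = (case p of 0 \<Rightarrow> {\<one>\<^bsub>cochain_group 0 X\<^esub>}
     | Suc n \<Rightarrow> coboundary n X ` carrier (cochain_group n X))"

definition cohomology_group :: "nat \<Rightarrow> 'a topology \<Rightarrow> 'a cochain set monoid" where
  "cohomology_group p X =
     subgroup_generated (cochain_group p X) (cocycles p X) Mod coboundaries p X"

text \<open>
  The Alexander--Whitney product: the first factor is evaluated on the front face
  \<open>[v_0, \<dots>, v_p]\<close> and the second one on the back face \<open>[v_p, \<dots>, v_{p+q}]\<close>.
\<close>

definition front_face :: "nat \<Rightarrow> ((nat \<Rightarrow> real) \<Rightarrow> 'a) \<Rightarrow> (nat \<Rightarrow> real) \<Rightarrow> 'a" where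
  "front_face p \<sigma> = restrict \<sigma> (standard_simplex p)"

definition back_face :: "nat \<Rightarrow> nat \<Rightarrow> ((nat \<Rightarrow> real) \<Rightarrow> 'a) \<Rightarrow> (nat \<Rightarrow> real) \<Rightarrow> 'a" where
  "back_face p q \<sigma> =
     restrict (\<lambda>x. \<sigma> (\<lambda>i. if i < p then 0 else x (i - p))) (standard_simplex q)"

definition cochain_cup ::
    "'a topology \<Rightarrow> nat \<Rightarrow> nat \<Rightarrow> 'a cochain \<Rightarrow> 'a cochain \<Rightarrow> 'a cochain" where
  "cochain_cup X p q \<phi> \<psi> = (\<lambda>\<sigma>\<in>singular_simplex_set (p + q) X.
     \<phi> (front_face p \<sigma>) * \<psi> (back_face p q \<sigma>))"

definition cup ::
    "'a topology \<Rightarrow> nat \<Rightarrow> nat \<Rightarrow> 'a cochain set \<Rightarrow> 'a cochain set \<Rightarrow> 'a cochain set" where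
  "cup X p q C D = coboundaries (p + q) X <#>\<^bsub>cochain_group (p + q) X\<^esub>
     {cochain_cup X p q \<phi> \<psi> | \<phi> \<psi>. \<phi> \<in> C \<and> \<psi> \<in> D}"

definition cohomology_ring :: "'a topology \<Rightarrow> 'a cochain set graded_ring" where
  "cohomology_ring X =
     \<lparr>gpart = (\<lambda>p. cohomology_group p X),
      gmult = cup X,
      gone = coboundaries 0 X #>\<^bsub>cochain_group 0 X\<^esub> (\<lambda>\<sigma>\<in>singular_simplex_set 0 X. 1)\<rparr>"

text \<open>The map induced by a continuous map \<open>f\<close> from \<open>X\<close> to another space:\<close>

definition cohomology_map ::
    "'a topology \<Rightarrow> ('a \<Rightarrow> 'b) \<Rightarrow> nat \<Rightarrow> 'b cochain set \<Rightarrow> 'a cochain set" where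
  "cohomology_map X f p C = coboundaries p X <#>\<^bsub>cochain_group p X\<^esub>
     ((\<lambda>\<phi>. \<lambda>\<sigma>\<in>singular_simplex_set p X. \<phi> (simplex_map p f \<sigma>)) ` C)"


section \<open>Toric arrangements\<close>

definition torus :: "(complex ^ 'd) set" where
  "torus = {z. \<forall>i. z $ i \<noteq> 0}"

text \<open>Regular functions on the torus are given by Laurent polynomials.\<close>

definition regular_on_torus :: "(complex ^ 'd \<Rightarrow> complex) \<Rightarrow> bool" where
  "regular_on_torus f \<longleftrightarrow> (\<exists>(S :: ('d \<Rightarrow> int) set) c. finite S \<and>
     (\<forall>z\<in>torus. f z = (\<Sum>m\<in>S. c m * (\<Prod>i\<in>UNIV. (z $ i) powi m i))))"

text \<open>Multiplication on \<^typ>\<open>complex ^ 'd\<close> is componentwise.\<close>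

definition torus_character :: "(complex ^ 'd \<Rightarrow> complex) \<Rightarrow> bool" where
  "torus_character f \<longleftrightarrow> regular_on_torus f \<and> (\<forall>z\<in>torus. f z \<noteq> 0) \<and>
     (\<forall>z\<in>torus. \<forall>w\<in>torus. f (z * w) = f z * f w)"

definition toric_arrangement :: "(complex ^ 'd) set set \<Rightarrow> bool" where
  "toric_arrangement \<A> \<longleftrightarrow> finite \<A> \<and>
     (\<forall>Y\<in>\<A>. \<exists>f a. torus_character f \<and> (\<exists>z\<in>torus. f z \<noteq> 1) \<and> a \<noteq> 0 \<and>
        Y = {z \<in> torus. f z = a})"

definition layers :: "(complex ^ 'd) set set \<Rightarrow> (complex ^ 'd) set set" where
  "layers \<A> = (\<Union>\<S>\<in>Pow \<A>. components (torus \<inter> \<Inter>\<S>))"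

definition tangent_space :: "(complex ^ 'd) set \<Rightarrow> complex ^ 'd \<Rightarrow> (complex ^ 'd) set" where
  "tangent_space L x = {v. \<exists>\<gamma> :: real \<Rightarrow> complex ^ 'd.
     range \<gamma> \<subseteq> L \<and> \<gamma> 0 = x \<and> (\<gamma> has_vector_derivative v) (at 0)}"

text \<open>
  The complex codimension of a complex submanifold; \<^term>\<open>vec.dim\<close> is the dimension over the
  field of scalars, here the complex numbers.
\<close>

definition rk :: "(complex ^ 'd) set \<Rightarrow> nat" where
  "rk L = (THE r. \<forall>x\<in>L. vec.dim (tangent_space L x) + r = CARD('d))"

definition exp_cover :: "complex ^ 'd \<Rightarrow> complex ^ 'd" where
  "exp_cover w = (\<chi> i. exp (w $ i))"

definition lifted_hyperplane :: "(complex ^ 'd) set \<Rightarrow> (complex ^ 'd) set" where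
  "lifted_hyperplane Y = (THE H. vec.subspace H \<and> vec.dim H + 1 = CARD('d) \<and>
     (\<forall>K\<in>components (exp_cover -` Y). \<exists>w. K = (\<lambda>h. w + h) ` H))"

definition local_arrangement ::
    "(complex ^ 'd) set set \<Rightarrow> (complex ^ 'd) set \<Rightarrow> (complex ^ 'd) set set" where
  "local_arrangement \<A> L = lifted_hyperplane ` {Y \<in> \<A>. L \<subseteq> Y}"

definition local_complement ::
    "(complex ^ 'd) set set \<Rightarrow> (complex ^ 'd) set \<Rightarrow> (complex ^ 'd) set" where
  "local_complement \<A> L = UNIV - \<Union>(local_arrangement \<A> L)"


section \<open>The two algebras of a toric arrangement\<close>

type_synonym 'd local_elem =
  "((complex ^ 'd) cochain set, (complex ^ 'd) cochain set) tensor"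

definition local_ring ::
    "(complex ^ 'd) set set \<Rightarrow> (complex ^ 'd) set \<Rightarrow> 'd local_elem ring" where
  "local_ring \<A> L = tensor_ring (cohomology_ring (top_of_set L))
     (cohomology_ring (top_of_set (local_complement \<A> L)))"

text \<open>
  For layers \<open>L \<subseteq> L'\<close>, \<open>local_map \<A> L' L\<close> goes from the ring of \<open>L'\<close> to that of \<open>L\<close>; both tensor
  factors are induced by inclusions of subspaces.
\<close>

definition local_map ::
    "(complex ^ 'd) set set \<Rightarrow> (complex ^ 'd) set \<Rightarrow> (complex ^ 'd) set \<Rightarrow>
     'd local_elem \<Rightarrow> 'd local_elem" where
  "local_map \<A> L' L = tensor_ring_map
     (cohomology_ring (top_of_set L)) (cohomology_ring (top_of_set (local_complement \<A> L)))
     (cohomology_map (top_of_set L) (\<lambda>x. x))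
     (cohomology_map (top_of_set (local_complement \<A> L)) (\<lambda>x. x))"

definition algebra_A ::
    "(complex ^ 'd) set set \<Rightarrow> ((complex ^ 'd) set \<Rightarrow> 'd local_elem) ring" where
  "algebra_A \<A> = ring_on
     (sum_group (layers \<A>) (\<lambda>L. subgroup_generated (add_monoid (local_ring \<A> L))
        (second_degree_part (local_ring \<A> L) (rk L))))
     (\<lambda>\<alpha> \<alpha>'. \<lambda>L''\<in>layers \<A>. finsum (local_ring \<A> L'')
        (\<lambda>(L, L'). local_map \<A> L L'' (\<alpha> L) \<otimes>\<^bsub>local_ring \<A> L''\<^esub> local_map \<A> L' L'' (\<alpha>' L'))
        {(L, L'). L \<in> layers \<A> \<and> L' \<in> layers \<A> \<and> L'' \<subseteq> L \<inter> L' \<and> rk L'' = rk L + rk L'})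
     (\<lambda>L\<in>layers \<A>. if L = torus then \<one>\<^bsub>local_ring \<A> L\<^esub> else \<zero>\<^bsub>local_ring \<A> L\<^esub>)"

definition coherent ::
    "(complex ^ 'd) set set \<Rightarrow> ((complex ^ 'd) set \<Rightarrow> 'd local_elem) \<Rightarrow> bool" where
  "coherent \<A> \<alpha> \<longleftrightarrow> (\<forall>q. \<forall>L\<in>layers \<A>. rk L > q \<longrightarrow>
     finsum (local_ring \<A> L)
       (\<lambda>L'. local_map \<A> L' L (second_degree_component (local_ring \<A> L') q (\<alpha> L')))
       {L' \<in> layers \<A>. L \<subseteq> L' \<and> rk L' = q} =
     second_degree_component (local_ring \<A> L) q (\<alpha> L))"

definition algebra_B ::
    "(complex ^ 'd) set set \<Rightarrow> ((complex ^ 'd) set \<Rightarrow> 'd local_elem) ring" where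
  "algebra_B \<A> = (let R = direct_sum_ring (layers \<A>) (local_ring \<A>)
     in R\<lparr>carrier := {\<alpha> \<in> carrier R. coherent \<A> \<alpha>}\<rparr>)"

end

theory Submission imports Defs begin

text \<open>
  Multiplying the two tensor factors of \<open>\<L>\<^sub>L\<close> componentwise, an element of A is sent to the family whose
  component at \<open>L\<close> is the sum of the images of the components at all layers containing \<open>L\<close>.
  The local arrangement at \<open>L\<close> is a central arrangement of rank \<open>rk L\<close>, so the cohomology of its
  complement vanishes in degrees above \<open>rk L\<close>; hence a coherent element is determined by its
  parts of degree \<open>q = rk L\<close>, and the map above is a bijection onto B. A product of two such sums
  involves, for each pair of layers containing \<open>L\<close>, the connected component around \<open>L\<close> of their
  intersection; when the ranks do not add up, that term vanishes already there, by the degree bound.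
  Vanishing is proved by removing one hyperplane at a time with Mayer-Vietoris.
\<close>

section \<open>Quotients of abelian groups\<close>

text \<open>Integral cohomology need not vanish where homology does: torsion one degree lower
  contributes through Ext. Hence Mayer-Vietoris and homotopy invariance are carried out on cochains,
  with explicit primitives built from subdivision and a prism operator on chains. The vanishing
  theorem concerns a linear subspace \<open>W\<close> and finitely many functionals, with bound dim
  \<open>W\<close> minus the dimension of their common kernel in \<open>W\<close>; the restriction
  of an arrangement to one of its hyperplanes is then an instance of the same statement, which makes
  the induction possible. On the torus side characters are Laurent monomials, so on the universal
  cover a hypersurface reads exp(c.w) = a. A layer through z is z exp(V) for a complex linear
  subspace V, and inclusions, ranks and meets become linear algebra. For the component L0 of an
  intersection, rk L0 <= rk L1 + rk L2 is dim(V1 + V2) <= d. Maps between quotients are defined by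
  images of whole cosets, so each must be shown to collapse to a single coset.\<close>

lemma coset_collapse:
  assumes "group G" "subgroup N G" "y \<in> carrier G" "B \<noteq> {}" "B \<subseteq> N #>\<^bsub>G\<^esub> y"
  shows "N <#>\<^bsub>G\<^esub> B = N #>\<^bsub>G\<^esub> y"
proof -
  have "N <#>\<^bsub>G\<^esub> B = (\<Union>b\<in>B. N #>\<^bsub>G\<^esub> b)"
    by (auto simp: set_mult_def r_coset_def)
  also have "\<dots> = (\<Union>b\<in>B. N #>\<^bsub>G\<^esub> y)"
    using group.repr_independence[OF assms(1) _ assms(3,2)] assms(5) by (intro SUP_cong) auto
  finally show ?thesis using assms(4) by simp
qed

text \<open>A homomorphism that respects the subgroups sends a whole coset into one coset, so the
  saturation in the definitions of induced maps picks out that coset. Tensor maps and cohomology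
  maps are both evaluated this way.\<close>

lemma induced_coset:
  assumes "group G" "group H" "subgroup N G" "subgroup N' H" "f \<in> hom G H" "f ` N \<subseteq> N'"
    and "x \<in> carrier G"
  shows "N' <#>\<^bsub>H\<^esub> (f ` (N #>\<^bsub>G\<^esub> x)) = N' #>\<^bsub>H\<^esub> f x"
proof (rule coset_collapse)
  show "f ` (N #>\<^bsub>G\<^esub> x) \<noteq> {}" using group.rcos_self[OF assms(1,7,3)] by auto
  show "f ` (N #>\<^bsub>G\<^esub> x) \<subseteq> N' #>\<^bsub>H\<^esub> f x"
  proof clarify
    fix a assume "a \<in> N #>\<^bsub>G\<^esub> x"
    then obtain n where n: "n \<in> N" "a = n \<otimes>\<^bsub>G\<^esub> x" by (auto simp: r_coset_def)
    then have "f a = f n \<otimes>\<^bsub>H\<^esub> f x"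
      using hom_mult[OF assms(5)] subgroup.mem_carrier[OF assms(3)] assms(7) by simp
    then show "f a \<in> N' #>\<^bsub>H\<^esub> f x"
      using n(1) assms(6) by (auto simp: r_coset_def)
  qed
  show "f x \<in> carrier H" using assms hom_in_carrier by metis
qed (use assms in auto)

text \<open>Expand the product of \<open>m x\<close> and \<open>n y\<close> by biadditivity: the
  factors involving \<open>m\<close> or \<open>n\<close> lie in \<open>P\<close>, so modulo
  \<open>P\<close> only the product of \<open>x\<close> and \<open>y\<close> survives. It serves
  both the tensor product and the cup product.\<close>

lemma induced_coset_bilinear:
  assumes "comm_group G" "group H" "comm_group K" "subgroup M G" "subgroup N H" "subgroup P K"
    and l: "\<And>y. y \<in> carrier H \<Longrightarrow> (\<lambda>x. \<beta> x y) \<in> hom G K"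
    and r: "\<And>x. x \<in> carrier G \<Longrightarrow> \<beta> x \<in> hom H K"
    and M: "\<And>x y. x \<in> M \<Longrightarrow> y \<in> carrier H \<Longrightarrow> \<beta> x y \<in> P"
    and N: "\<And>x y. x \<in> carrier G \<Longrightarrow> y \<in> N \<Longrightarrow> \<beta> x y \<in> P"
    and xy: "x \<in> carrier G" "y \<in> carrier H"
  shows "P <#>\<^bsub>K\<^esub> {\<beta> a b | a b. a \<in> M #>\<^bsub>G\<^esub> x \<and> b \<in> N #>\<^bsub>H\<^esub> y} = P #>\<^bsub>K\<^esub> \<beta> x y"
proof -
  interpret G: comm_group G by fact
  interpret H: group H by fact
  interpret K: comm_group K by fact
  show ?thesis
  proof (rule coset_collapse)
    show "\<beta> x y \<in> carrier K" using r[OF xy(1)] xy(2) by (simp add: hom_in_carrier)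
    show "{\<beta> a b | a b. a \<in> M #>\<^bsub>G\<^esub> x \<and> b \<in> N #>\<^bsub>H\<^esub> y} \<noteq> {}"
      using G.rcos_self[OF xy(1) assms(4)] H.rcos_self[OF xy(2) assms(5)] by blast
    show "{\<beta> a b | a b. a \<in> M #>\<^bsub>G\<^esub> x \<and> b \<in> N #>\<^bsub>H\<^esub> y} \<subseteq> P #>\<^bsub>K\<^esub> \<beta> x y"
    proof clarify
      fix a b assume "a \<in> M #>\<^bsub>G\<^esub> x" "b \<in> N #>\<^bsub>H\<^esub> y"
      then obtain m n where mn: "m \<in> M" "n \<in> N" "a = m \<otimes>\<^bsub>G\<^esub> x" "b = n \<otimes>\<^bsub>H\<^esub> y"
        by (auto simp: r_coset_def)
      then have c: "m \<in> carrier G" "n \<in> carrier H"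
        using assms(4,5) subgroup.mem_carrier by fastforce+
      then have bc: "b \<in> carrier H" using xy mn by simp
      have "\<beta> a b = \<beta> m b \<otimes>\<^bsub>K\<^esub> \<beta> x b"
        using l[OF bc] c xy mn hom_mult by fastforce
      also have "\<beta> x b = \<beta> x n \<otimes>\<^bsub>K\<^esub> \<beta> x y"
        using r[OF xy(1)] c xy mn hom_mult by fastforce
      also have "\<beta> m b \<otimes>\<^bsub>K\<^esub> (\<beta> x n \<otimes>\<^bsub>K\<^esub> \<beta> x y) = (\<beta> m b \<otimes>\<^bsub>K\<^esub> \<beta> x n) \<otimes>\<^bsub>K\<^esub> \<beta> x y"
        using r[OF xy(1)] r[OF c(1)] c xy bc by (intro K.m_assoc[symmetric]) (auto simp: hom_in_carrier)
      finally show "\<beta> a b \<in> P #>\<^bsub>K\<^esub> \<beta> x y"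
        using M[OF mn(1) bc] N[OF xy(1) mn(2)] subgroup.m_closed[OF assms(6)]
        by (auto simp: r_coset_def)
    qed
  qed (use assms in auto)
qed

lemma coset_mult:
  assumes "comm_group G" "subgroup N G" "x \<in> carrier G" "y \<in> carrier G"
  shows "(N #>\<^bsub>G\<^esub> x) \<otimes>\<^bsub>G Mod N\<^esub> (N #>\<^bsub>G\<^esub> y) = N #>\<^bsub>G\<^esub> (x \<otimes>\<^bsub>G\<^esub> y)"
  using assms by (simp add: normal.rcos_sum comm_group.subgroup_imp_normal)

section \<open>Tensor products of abelian groups\<close>

abbreviation free_on :: "'a monoid \<Rightarrow> 'b monoid \<Rightarrow> ('a \<times> 'b \<Rightarrow>\<^sub>0 int) monoid" where
  "free_on G H \<equiv> free_Abelian_group (carrier G \<times> carrier H)"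

text \<open>The bilinearity relators get a name of their own so that statements about
  \<open>tensor_relations\<close> can be tested on generators.\<close>

definition tensor_generators :: "'a monoid \<Rightarrow> 'b monoid \<Rightarrow> ('a \<times> 'b \<Rightarrow>\<^sub>0 int) set" where
  "tensor_generators G H = {frag_of (a \<otimes>\<^bsub>G\<^esub> a', b) - frag_of (a, b) - frag_of (a', b) | a a' b.
         a \<in> carrier G \<and> a' \<in> carrier G \<and> b \<in> carrier H} \<union>
      {frag_of (a, b \<otimes>\<^bsub>H\<^esub> b') - frag_of (a, b) - frag_of (a, b') | a b b'.
         a \<in> carrier G \<and> b \<in> carrier H \<and> b' \<in> carrier H}"

lemma tensor_relations_eq: "tensor_relations G H = generate (free_on G H) (tensor_generators G H)"
  by (simp add: tensor_relations_def tensor_generators_def)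

lemma free_on_diff_closed:
  "x \<in> carrier (free_on G H) \<Longrightarrow> y \<in> carrier (free_on G H) \<Longrightarrow> x - y \<in> carrier (free_on G H)"
  using keys_diff[of x y] by (simp only: carrier_free_Abelian_group_iff) blast

lemma tensor_generators_carrier:
  assumes "monoid G" "monoid H"
  shows "tensor_generators G H \<subseteq> carrier (free_on G H)"
proof
  fix x assume "x \<in> tensor_generators G H"
  moreover have "frag_of (a, b) \<in> carrier (free_on G H)" if "a \<in> carrier G" "b \<in> carrier H" for a b
    using that by simp
  ultimately show "x \<in> carrier (free_on G H)"
    using assms by (auto simp: tensor_generators_def monoid.m_closed
        simp del: carrier_free_Abelian_group_iff intro!: free_on_diff_closed)
qed

lemma subgroup_tensor_relations:
  assumes "monoid G" "monoid H"
  shows "subgroup (tensor_relations G H) (free_on G H)"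
  unfolding tensor_relations_eq
  by (intro group.generate_is_subgroup group_free_Abelian_group tensor_generators_carrier assms)

lemma tensor_relations_closed:
  assumes "monoid G" "monoid H"
  shows "0 \<in> tensor_relations G H"
    and "x \<in> tensor_relations G H \<Longrightarrow> y \<in> tensor_relations G H \<Longrightarrow> x + y \<in> tensor_relations G H"
    and "x \<in> tensor_relations G H \<Longrightarrow> - x \<in> tensor_relations G H"
    and "x \<in> tensor_relations G H \<Longrightarrow> y \<in> tensor_relations G H \<Longrightarrow> x - y \<in> tensor_relations G H"
proof -
  note S = subgroup_tensor_relations[OF assms]
  show "0 \<in> tensor_relations G H" using subgroup.one_closed[OF S] by simp
  show add: "x + y \<in> tensor_relations G H"
    if "x \<in> tensor_relations G H" "y \<in> tensor_relations G H" for x y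
    using subgroup.m_closed[OF S that] by simp
  show minus: "- x \<in> tensor_relations G H" if "x \<in> tensor_relations G H" for x
    using subgroup.m_inv_closed[OF S that] subgroup.mem_carrier[OF S that] by simp
  show "x - y \<in> tensor_relations G H" if "x \<in> tensor_relations G H" "y \<in> tensor_relations G H"
    using add[OF that(1) minus[OF that(2)]] by simp
qed

lemma tensor_relations_cmul:
  assumes "monoid G" "monoid H" "x \<in> tensor_relations G H"
  shows "frag_cmul k x \<in> tensor_relations G H"
  by (rule frag_closure_minus_cmul[where P = "\<lambda>x. x \<in> tensor_relations G H"])
     (use tensor_relations_closed[OF assms(1,2)] assms(3) in auto)

text \<open>The preimage of a subgroup under a homomorphism is a subgroup, hence contains the
  relations once it contains the relators. Every well-definedness claim for tensor products goes
  through this.\<close>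

lemma hom_tensor_relations_subset:
  assumes "monoid G" "monoid H" "group K" "subgroup N K" "f \<in> hom (free_on G H) K"
    and gen: "\<And>x. x \<in> tensor_generators G H \<Longrightarrow> f x \<in> N"
  shows "f ` tensor_relations G H \<subseteq> N"
proof
  interpret h: group_hom "free_on G H" K f
    using assms by (intro group_hom.intro) (auto simp: group_hom_axioms_def)
  fix y assume "y \<in> f ` tensor_relations G H"
  then obtain x where x: "x \<in> tensor_relations G H" "y = f x" by blast
  from x(1) have "f x \<in> N" unfolding tensor_relations_eq
  proof (induction rule: generate.induct)
    case one
    show ?case using subgroup.one_closed[OF assms(4)] by (simp only: h.hom_one)
  next
    case (inv h)
    then have "h \<in> carrier (free_on G H)"
      using tensor_generators_carrier[OF assms(1,2)] by blast
    then show ?case using gen[OF inv] subgroup.m_inv_closed[OF assms(4)] by (simp only: h.hom_inv)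
  next
    case (eng x y)
    then have "x \<in> carrier (free_on G H)" "y \<in> carrier (free_on G H)"
      using group.generate_incl[OF group_free_Abelian_group tensor_generators_carrier[OF assms(1,2)]]
      by blast+
    then show ?case using eng subgroup.m_closed[OF assms(4)] by (simp only: h.hom_mult)
  qed (use gen in auto)
  then show "y \<in> N" by (simp add: x)
qed

definition tcoset :: "'a monoid \<Rightarrow> 'b monoid \<Rightarrow> ('a \<times> 'b \<Rightarrow>\<^sub>0 int) \<Rightarrow> ('a \<times> 'b \<Rightarrow>\<^sub>0 int) set" where
  "tcoset G H x = tensor_relations G H #>\<^bsub>free_on G H\<^esub> x"

lemma comm_group_tensor_group:
  assumes "monoid G" "monoid H"
  shows "comm_group (tensor_group G H)"
  unfolding tensor_group_def
  by (intro comm_group.abelian_FactGroup abelian_free_Abelian_group subgroup_tensor_relations assms)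

lemma carrier_tensor_group: "carrier (tensor_group G H) = tcoset G H ` carrier (free_on G H)"
  unfolding tensor_group_def tcoset_def carrier_FactGroup by blast

lemma tcoset_in_carrier: "x \<in> carrier (free_on G H) \<Longrightarrow> tcoset G H x \<in> carrier (tensor_group G H)"
  unfolding carrier_tensor_group by blast

lemma tensor_groupE:
  assumes "C \<in> carrier (tensor_group G H)"
  obtains x where "x \<in> carrier (free_on G H)" "C = tcoset G H x"
  using assms unfolding carrier_tensor_group by blast

lemma mult_tcoset:
  assumes "monoid G" "monoid H" "x \<in> carrier (free_on G H)" "y \<in> carrier (free_on G H)"
  shows "tcoset G H x \<otimes>\<^bsub>tensor_group G H\<^esub> tcoset G H y = tcoset G H (x + y)"
  using coset_mult[OF abelian_free_Abelian_group subgroup_tensor_relations[OF assms(1,2)] assms(3,4)]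
  unfolding tcoset_def tensor_group_def by simp

lemma tcoset_eq_one:
  assumes "monoid G" "monoid H" "x \<in> tensor_relations G H"
  shows "tcoset G H x = \<one>\<^bsub>tensor_group G H\<^esub>"
proof -
  have "tensor_relations G H #>\<^bsub>free_on G H\<^esub> x = tensor_relations G H"
    using assms(3) subgroup_tensor_relations[OF assms(1,2)]
    by (intro subgroup.rcos_const) auto
  then show ?thesis by (simp add: tcoset_def tensor_group_def)
qed

text \<open>With both second entries equal to the unit, the relator in the second variable reads
  -(a, 1), because 1 * 1 = 1. Thus every generator of the free group is itself a relation.\<close>

lemma trivial_tensor_group:
  assumes "group G" "group H" "carrier H = {\<one>\<^bsub>H\<^esub>}"
  shows "carrier (tensor_group G H) = {\<one>\<^bsub>tensor_group G H\<^esub>}"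
proof -
  have m: "monoid G" "monoid H" using assms by (auto simp: group.is_monoid)
  have "x \<in> tensor_relations G H" if "x \<in> carrier (free_on G H)" for x
    using that unfolding carrier_free_Abelian_group_iff
  proof (induction rule: frag_induction)
    case (one p)
    then obtain a where a: "p = (a, \<one>\<^bsub>H\<^esub>)" "a \<in> carrier G" using assms(3) by auto
    have "\<one>\<^bsub>H\<^esub> \<otimes>\<^bsub>H\<^esub> \<one>\<^bsub>H\<^esub> = \<one>\<^bsub>H\<^esub>" using m by simp
    then have "frag_of (a, \<one>\<^bsub>H\<^esub>) - frag_of (a, \<one>\<^bsub>H\<^esub>) - frag_of (a, \<one>\<^bsub>H\<^esub>) \<in> tensor_generators G H"
      using a(2) monoid.one_closed[OF m(2)] unfolding tensor_generators_def
      by (intro UnI2 CollectI exI[of _ a] exI[of _ "\<one>\<^bsub>H\<^esub>"]) simp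
    then have "- frag_of p \<in> tensor_relations G H"
      unfolding tensor_relations_eq a(1) by (intro generate.incl) simp
    then show ?case using tensor_relations_closed(3)[OF m] by fastforce
  qed (use tensor_relations_closed[OF m] in auto)
  then have "carrier (tensor_group G H) \<subseteq> {\<one>\<^bsub>tensor_group G H\<^esub>}"
    using tcoset_eq_one[OF m] by (auto elim!: tensor_groupE simp del: carrier_free_Abelian_group_iff)
  then show ?thesis
    using monoid.one_closed[OF group.is_monoid[OF comm_group.axioms(2)[OF comm_group_tensor_group[OF m]]]]
    by blast
qed

lemma frag_extend_hom:
  assumes "\<And>p. p \<in> S \<Longrightarrow> f p \<in> carrier (free_Abelian_group T)"
  shows "frag_extend f \<in> hom (free_Abelian_group S) (free_Abelian_group T)"
proof (rule homI)
  fix x assume "x \<in> carrier (free_Abelian_group S)"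
  then show "frag_extend f x \<in> carrier (free_Abelian_group T)"
    using keys_frag_extend[of f x] assms by (simp only: carrier_free_Abelian_group_iff) blast
qed (simp add: frag_extend_add)

text \<open>\<open>f\<close> and \<open>g\<close> carry relators to relators, so the map descends.
  Afterwards identities between tensor maps are proved by comparing linear extensions on the free
  groups.\<close>

lemma tensor_map_tcoset:
  assumes G: "group G" "group H" "group G'" "group H'" and f: "f \<in> hom G G'" and g: "g \<in> hom H H'"
    and x: "x \<in> carrier (free_on G H)"
  shows "tensor_map G' H' f g (tcoset G H x) = tcoset G' H' (frag_extend (\<lambda>(a, b). frag_of (f a, g b)) x)"
proof -
  have m: "monoid G" "monoid H" "monoid G'" "monoid H'" using G by (auto simp: group.is_monoid)
  let ?\<phi> = "frag_extend (\<lambda>(a, b). frag_of (f a, g b))"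
  have hom: "?\<phi> \<in> hom (free_on G H) (free_on G' H')"
    by (rule frag_extend_hom) (use hom_in_carrier[OF f] hom_in_carrier[OF g] in auto)
  have "?\<phi> ` tensor_relations G H \<subseteq> tensor_relations G' H'"
  proof (rule hom_tensor_relations_subset[OF m(1,2) group_free_Abelian_group subgroup_tensor_relations[OF m(3,4)] hom])
    fix x assume "x \<in> tensor_generators G H"
    then have "?\<phi> x \<in> tensor_generators G' H'"
      unfolding tensor_generators_def
    proof (elim UnE CollectE exE conjE)
      fix a a' b assume x: "x = frag_of (a \<otimes>\<^bsub>G\<^esub> a', b) - frag_of (a, b) - frag_of (a', b)"
        "a \<in> carrier G" "a' \<in> carrier G" "b \<in> carrier H"
      have "?\<phi> x = frag_of (f a \<otimes>\<^bsub>G'\<^esub> f a', g b) - frag_of (f a, g b) - frag_of (f a', g b)"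
        using x hom_mult[OF f] by (simp add: frag_extend_diff)
      then show "?\<phi> x \<in> {frag_of (a \<otimes>\<^bsub>G'\<^esub> a', b) - frag_of (a, b) - frag_of (a', b) | a a' b.
         a \<in> carrier G' \<and> a' \<in> carrier G' \<and> b \<in> carrier H'} \<union>
      {frag_of (a, b \<otimes>\<^bsub>H'\<^esub> b') - frag_of (a, b) - frag_of (a, b') | a b b'.
         a \<in> carrier G' \<and> b \<in> carrier H' \<and> b' \<in> carrier H'}"
        using x hom_in_carrier[OF f] hom_in_carrier[OF g] by blast
    next
      fix a b b' assume x: "x = frag_of (a, b \<otimes>\<^bsub>H\<^esub> b') - frag_of (a, b) - frag_of (a, b')"
        "a \<in> carrier G" "b \<in> carrier H" "b' \<in> carrier H"
      have "?\<phi> x = frag_of (f a, g b \<otimes>\<^bsub>H'\<^esub> g b') - frag_of (f a, g b) - frag_of (f a, g b')"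
        using x hom_mult[OF g] by (simp add: frag_extend_diff)
      then show "?\<phi> x \<in> {frag_of (a \<otimes>\<^bsub>G'\<^esub> a', b) - frag_of (a, b) - frag_of (a', b) | a a' b.
         a \<in> carrier G' \<and> a' \<in> carrier G' \<and> b \<in> carrier H'} \<union>
      {frag_of (a, b \<otimes>\<^bsub>H'\<^esub> b') - frag_of (a, b) - frag_of (a, b') | a b b'.
         a \<in> carrier G' \<and> b \<in> carrier H' \<and> b' \<in> carrier H'}"
        using x hom_in_carrier[OF f] hom_in_carrier[OF g] by blast
    qed
    then show "?\<phi> x \<in> tensor_relations G' H'"
      unfolding tensor_relations_eq by (rule generate.incl)
  qed
  then show ?thesis
    unfolding tensor_map_def tcoset_def
    by (intro induced_coset group_free_Abelian_group subgroup_tensor_relations m hom x)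
qed

lemma tensor_map_hom:
  assumes G: "group G" "group H" "group G'" "group H'" and f: "f \<in> hom G G'" and g: "g \<in> hom H H'"
  shows "tensor_map G' H' f g \<in> hom (tensor_group G H) (tensor_group G' H')"
proof (rule homI)
  have m: "monoid G" "monoid H" "monoid G'" "monoid H'" using G by (auto simp: group.is_monoid)
  let ?\<phi> = "frag_extend (\<lambda>(a, b). frag_of (f a, g b))"
  have "?\<phi> \<in> hom (free_on G H) (free_on G' H')"
    by (rule frag_extend_hom) (use hom_in_carrier[OF f] hom_in_carrier[OF g] in auto)
  then have c: "?\<phi> x \<in> carrier (free_on G' H')" if "x \<in> carrier (free_on G H)" for x
    using that by (rule hom_in_carrier)
  note T = tensor_map_tcoset[OF assms]
  show "tensor_map G' H' f g C \<in> carrier (tensor_group G' H')" if "C \<in> carrier (tensor_group G H)" for C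
    using that by (elim tensor_groupE) (simp only: T c tcoset_in_carrier)
  show "tensor_map G' H' f g (C \<otimes>\<^bsub>tensor_group G H\<^esub> D) =
      tensor_map G' H' f g C \<otimes>\<^bsub>tensor_group G' H'\<^esub> tensor_map G' H' f g D"
    if C: "C \<in> carrier (tensor_group G H)" and D: "D \<in> carrier (tensor_group G H)" for C D
  proof -
    obtain x where x: "x \<in> carrier (free_on G H)" "C = tcoset G H x" using C by (elim tensor_groupE)
    obtain y where y: "y \<in> carrier (free_on G H)" "D = tcoset G H y" using D by (elim tensor_groupE)
    have "x + y \<in> carrier (free_on G H)"
      using monoid.m_closed[OF group.is_monoid[OF group_free_Abelian_group] x(1) y(1)] by simp
    then show ?thesis
      by (simp only: x(2) y(2) mult_tcoset[OF m(1,2) x(1) y(1)] T x(1) y(1) frag_extend_add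
          mult_tcoset[OF m(3,4) c[OF x(1)] c[OF y(1)]])
  qed
qed

lemma tensor_map_comp:
  assumes G: "group G" "group H" "group G'" "group H'" "group G''" "group H''"
    and f: "f \<in> hom G G'" "f' \<in> hom G' G''" "f'' \<in> hom G G''" "\<And>a. a \<in> carrier G \<Longrightarrow> f'' a = f' (f a)"
    and g: "g \<in> hom H H'" "g' \<in> hom H' H''" "g'' \<in> hom H H''" "\<And>b. b \<in> carrier H \<Longrightarrow> g'' b = g' (g b)"
    and C: "C \<in> carrier (tensor_group G H)"
  shows "tensor_map G'' H'' f' g' (tensor_map G' H' f g C) = tensor_map G'' H'' f'' g'' C"
proof -
  obtain x where x: "x \<in> carrier (free_on G H)" "C = tcoset G H x" using C by (elim tensor_groupE)
  let ?\<phi> = "frag_extend (\<lambda>(a, b). frag_of (f a, g b))"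
  have "?\<phi> \<in> hom (free_on G H) (free_on G' H')"
    by (rule frag_extend_hom) (use hom_in_carrier[OF f(1)] hom_in_carrier[OF g(1)] in auto)
  then have c: "?\<phi> x \<in> carrier (free_on G' H')"
    using x(1) by (rule hom_in_carrier)
  have "frag_extend (\<lambda>(a, b). frag_of (f' a, g' b)) (?\<phi> x) = frag_extend (\<lambda>(a, b). frag_of (f'' a, g'' b)) x"
    using x(1) unfolding carrier_free_Abelian_group_iff
    by (induction rule: frag_induction) (auto simp: frag_extend_diff f(4) g(4))
  then show ?thesis
    by (simp only: x(2) tensor_map_tcoset[OF G(1-4) f(1) g(1) x(1)] tensor_map_tcoset[OF G(3-6) f(2) g(2) c]
        tensor_map_tcoset[OF G(1,2,5,6) f(3) g(3) x(1)])
qed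

lemma tensor_map_ident:
  assumes G: "group G" "group H" and f: "f \<in> hom G G" "\<And>a. a \<in> carrier G \<Longrightarrow> f a = a"
    and g: "g \<in> hom H H" "\<And>b. b \<in> carrier H \<Longrightarrow> g b = b"
    and C: "C \<in> carrier (tensor_group G H)"
  shows "tensor_map G H f g C = C"
proof -
  obtain x where x: "x \<in> carrier (free_on G H)" "C = tcoset G H x" using C by (elim tensor_groupE)
  have "frag_extend (\<lambda>(a, b). frag_of (f a, g b)) x = x"
    using x(1) unfolding carrier_free_Abelian_group_iff
    by (induction rule: frag_induction) (auto simp: frag_extend_diff f(2) g(2))
  then show ?thesis
    by (simp only: x(2) tensor_map_tcoset[OF G G f(1) g(1) x(1)])
qed

section \<open>Tensor products of graded rings\<close>

text \<open>These conditions make the product of cosets in \<open>tensor_mult\<close> well defined,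
  closed and distributive.\<close>

locale graded_pieces =
  fixes R :: "'a graded_ring"
  assumes part_comm_group: "comm_group (gpart R p)"
    and gmult_closed: "a \<in> carrier (gpart R p) \<Longrightarrow> b \<in> carrier (gpart R q) \<Longrightarrow>
      gmult R p q a b \<in> carrier (gpart R (p + q))"
    and gmult_left: "a \<in> carrier (gpart R p) \<Longrightarrow> a' \<in> carrier (gpart R p) \<Longrightarrow> b \<in> carrier (gpart R q) \<Longrightarrow>
      gmult R p q (a \<otimes>\<^bsub>gpart R p\<^esub> a') b = gmult R p q a b \<otimes>\<^bsub>gpart R (p + q)\<^esub> gmult R p q a' b"
    and gmult_right: "a \<in> carrier (gpart R p) \<Longrightarrow> b \<in> carrier (gpart R q) \<Longrightarrow> b' \<in> carrier (gpart R q) \<Longrightarrow>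
      gmult R p q a (b \<otimes>\<^bsub>gpart R q\<^esub> b') = gmult R p q a b \<otimes>\<^bsub>gpart R (p + q)\<^esub> gmult R p q a b'"
    and gone_closed: "gone R \<in> carrier (gpart R 0)"
begin

lemma part_group: "group (gpart R p)"
  using part_comm_group by (rule comm_group.axioms(2))

lemma part_monoid: "monoid (gpart R p)"
  using part_group by (rule group.is_monoid)

end

definition graded_hom :: "'a graded_ring \<Rightarrow> 'b graded_ring \<Rightarrow> (nat \<Rightarrow> 'a \<Rightarrow> 'b) \<Rightarrow> bool" where
  "graded_hom R S f \<longleftrightarrow> (\<forall>p. f p \<in> hom (gpart R p) (gpart S p)) \<and>
     (\<forall>p q. \<forall>a\<in>carrier (gpart R p). \<forall>b\<in>carrier (gpart R q).
        f (p + q) (gmult R p q a b) = gmult S p q (f p a) (f q b)) \<and> f 0 (gone R) = gone S"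

lemma frag_extend_add_fun: "frag_extend (\<lambda>p. f p + g p) x = frag_extend f x + frag_extend g x"
  using subset_UNIV by (induction x rule: frag_induction) (auto simp: frag_extend_diff)

lemma frag_extend_diff_fun: "frag_extend (\<lambda>p. f p - g p) x = frag_extend f x - frag_extend g x"
  using subset_UNIV by (induction x rule: frag_induction) (auto simp: frag_extend_diff)

lemma frag_cmul_diff2: "frag_cmul k (a - b) = frag_cmul k a - frag_cmul k b"
  by (rule poly_mapping_eqI) (simp add: lookup_minus algebra_simps)

text \<open>The product before passing to the quotients; \<open>tensor_mult\<close> collects its
  values on two cosets. The Koszul sign depends only on the bidegrees, so it acts as a scalar and
  does not disturb biadditivity.\<close>

definition rep_mult ::
    "'a graded_ring \<Rightarrow> 'b graded_ring \<Rightarrow> nat \<Rightarrow> nat \<Rightarrow> nat \<Rightarrow> nat \<Rightarrow>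
     ('a \<times> 'b \<Rightarrow>\<^sub>0 int) \<Rightarrow> ('a \<times> 'b \<Rightarrow>\<^sub>0 int) \<Rightarrow> ('a \<times> 'b \<Rightarrow>\<^sub>0 int)" where
  "rep_mult R S p q p' q' x y = frag_extend (\<lambda>(a, b). frag_extend (\<lambda>(a', b').
     frag_cmul ((-1) ^ (q * p')) (frag_of (gmult R p p' a a', gmult S q q' b b'))) y) x"

lemma rep_mult_0 [simp]: "rep_mult R S p q p' q' 0 y = 0" "rep_mult R S p q p' q' x 0 = 0"
  by (simp_all add: rep_mult_def case_prod_unfold frag_extend_eq_0)

lemma rep_mult_of [simp]: "rep_mult R S p q p' q' (frag_of (a, b)) (frag_of (a', b')) =
    frag_cmul ((-1) ^ (q * p')) (frag_of (gmult R p p' a a', gmult S q q' b b'))"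
  by (simp add: rep_mult_def)

lemma rep_mult_diff:
  "rep_mult R S p q p' q' (x - x') y = rep_mult R S p q p' q' x y - rep_mult R S p q p' q' x' y"
  "rep_mult R S p q p' q' x (y - y') = rep_mult R S p q p' q' x y - rep_mult R S p q p' q' x y'"
  by (simp_all add: rep_mult_def case_prod_unfold frag_extend_diff frag_extend_diff_fun)

lemma rep_mult_add:
  "rep_mult R S p q p' q' (x + x') y = rep_mult R S p q p' q' x y + rep_mult R S p q p' q' x' y"
  "rep_mult R S p q p' q' x (y + y') = rep_mult R S p q p' q' x y + rep_mult R S p q p' q' x y'"
  by (simp_all add: rep_mult_def case_prod_unfold frag_extend_add frag_extend_add_fun)

text \<open>An infinite index set is covered as well, since both products are then the unit by
  convention.\<close>

lemma hom_finprod: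
  assumes "comm_group G" "comm_group H" "h \<in> hom G H" "f \<in> A \<rightarrow> carrier G"
  shows "h (finprod G f A) = finprod H (\<lambda>i. h (f i)) A"
proof -
  interpret G: comm_group G by fact
  interpret H: comm_group H by fact
  have one: "h \<one>\<^bsub>G\<^esub> = \<one>\<^bsub>H\<^esub>" by (rule hom_one[OF assms(3)]) auto
  show ?thesis using assms(4)
  proof (induction A rule: infinite_finite_induct)
    case (insert x F)
    then have "h (f x \<otimes>\<^bsub>G\<^esub> finprod G f F) = h (f x) \<otimes>\<^bsub>H\<^esub> h (finprod G f F)"
      by (intro hom_mult[OF assms(3)]) auto
    then show ?case
      using insert hom_in_carrier[OF assms(3)] by (simp add: Pi_iff)
  qed (simp_all add: one)
qed

lemma add_monoid_ring_on [simp]: "add_monoid (ring_on G m e) = G"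
  by (cases G) (simp add: ring_on_def)

section \<open>Products of cosets and ring operations on a tensor product\<close>

locale tensor_pair = R: graded_pieces R + S: graded_pieces S
  for R :: "'a graded_ring" and S :: "'b graded_ring"
begin

abbreviation "tpart p q \<equiv> tensor_group (gpart R p) (gpart S q)"

lemma part_comm: "comm_group (tpart p q)"
  by (intro comm_group_tensor_group R.part_monoid S.part_monoid)

lemma part_grp: "group (tpart p q)"
  using part_comm by (rule comm_group.axioms(2))

lemma part_one_closed [simp]: "\<one>\<^bsub>tpart p q\<^esub> \<in> carrier (tpart p q)"
  using part_grp by (simp add: group.is_monoid monoid.one_closed)

lemma part_mult_closed [simp]:
  "x \<in> carrier (tpart p q) \<Longrightarrow> y \<in> carrier (tpart p q) \<Longrightarrow> x \<otimes>\<^bsub>tpart p q\<^esub> y \<in> carrier (tpart p q)"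
  using part_grp by (simp add: group.is_monoid monoid.m_closed)

abbreviation "reps p q \<equiv> free_on (gpart R p) (gpart S q)"

lemma rep_mult_hom:
  shows "y \<in> carrier (reps p' q') \<Longrightarrow> (\<lambda>x. rep_mult R S p q p' q' x y) \<in> hom (reps p q) (reps (p + p') (q + q'))"
    and "x \<in> carrier (reps p q) \<Longrightarrow> rep_mult R S p q p' q' x \<in> hom (reps p' q') (reps (p + p') (q + q'))"
proof -
  have gen: "frag_cmul k (frag_of (gmult R p p' a a', gmult S q q' b b')) \<in> carrier (reps (p + p') (q + q'))"
    if "a \<in> carrier (gpart R p)" "a' \<in> carrier (gpart R p')"
      "b \<in> carrier (gpart S q)" "b' \<in> carrier (gpart S q')" for a a' b b' k
    using that by (auto simp: R.gmult_closed S.gmult_closed)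
  have inner: "frag_extend (\<lambda>(a', b'). frag_cmul ((-1) ^ (q * p')) (frag_of (gmult R p p' a a', gmult S q q' b b'))) y
      \<in> carrier (reps (p + p') (q + q'))"
    if "a \<in> carrier (gpart R p)" "b \<in> carrier (gpart S q)" "y \<in> carrier (reps p' q')" for a b y
    by (rule hom_in_carrier[OF frag_extend_hom that(3)])
       (use gen that in \<open>auto simp del: carrier_free_Abelian_group_iff\<close>)
  have 1: "(\<lambda>x. rep_mult R S p q p' q' x y) \<in> hom (reps p q) (reps (p + p') (q + q'))"
    if "y \<in> carrier (reps p' q')" for y
    unfolding rep_mult_def
    by (rule frag_extend_hom) (use inner that in \<open>auto simp del: carrier_free_Abelian_group_iff\<close>)
  then show "y \<in> carrier (reps p' q') \<Longrightarrow> (\<lambda>x. rep_mult R S p q p' q' x y) \<in> hom (reps p q) (reps (p + p') (q + q'))" .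
  show "rep_mult R S p q p' q' x \<in> hom (reps p' q') (reps (p + p') (q + q'))" if x: "x \<in> carrier (reps p q)"
  proof (rule homI)
    show "rep_mult R S p q p' q' x y \<in> carrier (reps (p + p') (q + q'))" if "y \<in> carrier (reps p' q')" for y
      using hom_in_carrier[OF 1[OF that] x] .
  qed (simp add: rep_mult_add)
qed

text \<open>A relator times a pure tensor is, up to sign, again a relator in the product degrees.
  Additivity extends this to arbitrary second factors, and then to the whole subgroup generated by
  the relators.\<close>

lemma rep_mult_relations:
  shows "x \<in> tensor_relations (gpart R p) (gpart S q) \<Longrightarrow> y \<in> carrier (reps p' q') \<Longrightarrow>
      rep_mult R S p q p' q' x y \<in> tensor_relations (gpart R (p + p')) (gpart S (q + q'))" (is "_ \<Longrightarrow> _ \<Longrightarrow> _ \<in> ?P")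
    and "x \<in> carrier (reps p q) \<Longrightarrow> y \<in> tensor_relations (gpart R p') (gpart S q') \<Longrightarrow>
      rep_mult R S p q p' q' x y \<in> tensor_relations (gpart R (p + p')) (gpart S (q + q'))"
proof -
  note m = R.part_monoid S.part_monoid
  note cl = tensor_relations_closed[OF m]
  have gens: "g \<in> tensor_generators (gpart R (p + p')) (gpart S (q + q')) \<Longrightarrow> frag_cmul k g \<in> ?P" for g k
    by (intro tensor_relations_cmul m) (simp add: tensor_relations_eq generate.incl)
  have 1: "rep_mult R S p q p' q' g y \<in> ?P"
    if g: "g \<in> tensor_generators (gpart R p) (gpart S q)" and y: "y \<in> carrier (reps p' q')" for g y
    using y unfolding carrier_free_Abelian_group_iff
  proof (induction rule: frag_induction)
    case (one z)
    then obtain c d where z: "z = (c, d)" "c \<in> carrier (gpart R p')" "d \<in> carrier (gpart S q')" by auto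
    from g show ?case unfolding tensor_generators_def
    proof (elim UnE CollectE exE conjE)
      fix a a' b assume g: "g = frag_of (a \<otimes>\<^bsub>gpart R p\<^esub> a', b) - frag_of (a, b) - frag_of (a', b)"
        and c: "a \<in> carrier (gpart R p)" "a' \<in> carrier (gpart R p)" "b \<in> carrier (gpart S q)"
      let ?a = "gmult R p p' a c" and ?a' = "gmult R p p' a' c" and ?b = "gmult S q q' b d"
      have "frag_of (?a \<otimes>\<^bsub>gpart R (p + p')\<^esub> ?a', ?b) - frag_of (?a, ?b) - frag_of (?a', ?b)
          \<in> tensor_generators (gpart R (p + p')) (gpart S (q + q'))"
        unfolding tensor_generators_def using c z R.gmult_closed S.gmult_closed by blast
      from gens[OF this] show ?thesis
        using c z by (simp add: g rep_mult_diff R.gmult_left frag_cmul_diff2)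
    next
      fix a b b' assume g: "g = frag_of (a, b \<otimes>\<^bsub>gpart S q\<^esub> b') - frag_of (a, b) - frag_of (a, b')"
        and c: "a \<in> carrier (gpart R p)" "b \<in> carrier (gpart S q)" "b' \<in> carrier (gpart S q)"
      let ?a = "gmult R p p' a c" and ?b = "gmult S q q' b d" and ?b' = "gmult S q q' b' d"
      have "frag_of (?a, ?b \<otimes>\<^bsub>gpart S (q + q')\<^esub> ?b') - frag_of (?a, ?b) - frag_of (?a, ?b')
          \<in> tensor_generators (gpart R (p + p')) (gpart S (q + q'))"
        unfolding tensor_generators_def using c z R.gmult_closed S.gmult_closed by blast
      from gens[OF this] show ?thesis
        using c z by (simp add: g rep_mult_diff S.gmult_left frag_cmul_diff2)
    qed
  qed (auto simp: rep_mult_diff cl)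
  have 2: "rep_mult R S p q p' q' x g \<in> ?P"
    if g: "g \<in> tensor_generators (gpart R p') (gpart S q')" and x: "x \<in> carrier (reps p q)" for g x
    using x unfolding carrier_free_Abelian_group_iff
  proof (induction rule: frag_induction)
    case (one z)
    then obtain c d where z: "z = (c, d)" "c \<in> carrier (gpart R p)" "d \<in> carrier (gpart S q)" by auto
    from g show ?case unfolding tensor_generators_def
    proof (elim UnE CollectE exE conjE)
      fix a a' b assume g: "g = frag_of (a \<otimes>\<^bsub>gpart R p'\<^esub> a', b) - frag_of (a, b) - frag_of (a', b)"
        and c: "a \<in> carrier (gpart R p')" "a' \<in> carrier (gpart R p')" "b \<in> carrier (gpart S q')"
      let ?a = "gmult R p p' c a" and ?a' = "gmult R p p' c a'" and ?b = "gmult S q q' d b"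
      have "frag_of (?a \<otimes>\<^bsub>gpart R (p + p')\<^esub> ?a', ?b) - frag_of (?a, ?b) - frag_of (?a', ?b)
          \<in> tensor_generators (gpart R (p + p')) (gpart S (q + q'))"
        unfolding tensor_generators_def using c z R.gmult_closed S.gmult_closed by blast
      from gens[OF this] show ?thesis
        using c z by (simp add: g rep_mult_diff R.gmult_right frag_cmul_diff2)
    next
      fix a b b' assume g: "g = frag_of (a, b \<otimes>\<^bsub>gpart S q'\<^esub> b') - frag_of (a, b) - frag_of (a, b')"
        and c: "a \<in> carrier (gpart R p')" "b \<in> carrier (gpart S q')" "b' \<in> carrier (gpart S q')"
      let ?a = "gmult R p p' c a" and ?b = "gmult S q q' d b" and ?b' = "gmult S q q' d b'"
      have "frag_of (?a, ?b \<otimes>\<^bsub>gpart S (q + q')\<^esub> ?b') - frag_of (?a, ?b) - frag_of (?a, ?b')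
          \<in> tensor_generators (gpart R (p + p')) (gpart S (q + q'))"
        unfolding tensor_generators_def using c z R.gmult_closed S.gmult_closed by blast
      from gens[OF this] show ?thesis
        using c z by (simp add: g rep_mult_diff S.gmult_right frag_cmul_diff2)
    qed
  qed (auto simp: rep_mult_diff cl)
  show "rep_mult R S p q p' q' x y \<in> ?P"
    if x: "x \<in> tensor_relations (gpart R p) (gpart S q)" and y: "y \<in> carrier (reps p' q')"
    using hom_tensor_relations_subset[OF m group_free_Abelian_group subgroup_tensor_relations[OF m]
        rep_mult_hom(1)[OF y, of p q]] 1[OF _ y] x by blast
  show "rep_mult R S p q p' q' x y \<in> ?P"
    if x: "x \<in> carrier (reps p q)" and y: "y \<in> tensor_relations (gpart R p') (gpart S q')"
    using hom_tensor_relations_subset[OF m group_free_Abelian_group subgroup_tensor_relations[OF m]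
        rep_mult_hom(2)[OF x, of p' q']] 2[OF _ x] y by blast
qed

lemma tensor_mult_tcoset:
  assumes "x \<in> carrier (reps p q)" "y \<in> carrier (reps p' q')"
  shows "tensor_mult R S p q p' q' (tcoset (gpart R p) (gpart S q) x) (tcoset (gpart R p') (gpart S q') y)
    = tcoset (gpart R (p + p')) (gpart S (q + q')) (rep_mult R S p q p' q' x y)"
  using induced_coset_bilinear[OF abelian_free_Abelian_group group_free_Abelian_group abelian_free_Abelian_group
      subgroup_tensor_relations[OF R.part_monoid S.part_monoid]
      subgroup_tensor_relations[OF R.part_monoid S.part_monoid]
      subgroup_tensor_relations[OF R.part_monoid S.part_monoid]
      rep_mult_hom rep_mult_relations assms]
  unfolding tensor_mult_def tcoset_def rep_mult_def .

lemma rep_mult_closed: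
  "x \<in> carrier (reps p q) \<Longrightarrow> y \<in> carrier (reps p' q') \<Longrightarrow>
    rep_mult R S p q p' q' x y \<in> carrier (reps (p + p') (q + q'))"
  using hom_in_carrier[OF rep_mult_hom(2)] by blast

lemma reps_add_closed:
  "x \<in> carrier (reps p q) \<Longrightarrow> y \<in> carrier (reps p q) \<Longrightarrow> x + y \<in> carrier (reps p q)"
  using keys_add[of x y] by (simp only: carrier_free_Abelian_group_iff) blast

lemma tensor_mult_hom:
  shows "D \<in> carrier (tpart p' q') \<Longrightarrow>
      (\<lambda>C. tensor_mult R S p q p' q' C D) \<in> hom (tpart p q) (tpart (p + p') (q + q'))"
    and "C \<in> carrier (tpart p q) \<Longrightarrow>
      tensor_mult R S p q p' q' C \<in> hom (tpart p' q') (tpart (p + p') (q + q'))"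
proof -
  have cl: "tensor_mult R S p q p' q' C D \<in> carrier (tpart (p + p') (q + q'))"
    if C: "C \<in> carrier (tpart p q)" and D: "D \<in> carrier (tpart p' q')" for C D
  proof -
    obtain x where x: "x \<in> carrier (reps p q)" "C = tcoset (gpart R p) (gpart S q) x"
      using C by (elim tensor_groupE)
    obtain y where y: "y \<in> carrier (reps p' q')" "D = tcoset (gpart R p') (gpart S q') y"
      using D by (elim tensor_groupE)
    show ?thesis
      unfolding x(2) y(2) tensor_mult_tcoset[OF x(1) y(1)]
      by (rule tcoset_in_carrier[OF rep_mult_closed[OF x(1) y(1)]])
  qed
  note mt = mult_tcoset[OF R.part_monoid S.part_monoid]
  show "(\<lambda>C. tensor_mult R S p q p' q' C D) \<in> hom (tpart p q) (tpart (p + p') (q + q'))"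
    if D: "D \<in> carrier (tpart p' q')"
  proof (rule homI)
    fix C C' assume "C \<in> carrier (tpart p q)" "C' \<in> carrier (tpart p q)"
    then show "tensor_mult R S p q p' q' (C \<otimes>\<^bsub>tpart p q\<^esub> C') D =
        tensor_mult R S p q p' q' C D \<otimes>\<^bsub>tpart (p + p') (q + q')\<^esub> tensor_mult R S p q p' q' C' D"
      using D by (elim tensor_groupE)
        (simp only: mt tensor_mult_tcoset rep_mult_closed reps_add_closed rep_mult_add)
  qed (use cl D in auto)
  show "tensor_mult R S p q p' q' C \<in> hom (tpart p' q') (tpart (p + p') (q + q'))"
    if C: "C \<in> carrier (tpart p q)"
  proof (rule homI)
    fix D D' assume "D \<in> carrier (tpart p' q')" "D' \<in> carrier (tpart p' q')"
    then show "tensor_mult R S p q p' q' C (D \<otimes>\<^bsub>tpart p' q'\<^esub> D') =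
        tensor_mult R S p q p' q' C D \<otimes>\<^bsub>tpart (p + p') (q + q')\<^esub> tensor_mult R S p q p' q' C D'"
      using C by (elim tensor_groupE)
        (simp only: mt tensor_mult_tcoset rep_mult_closed reps_add_closed rep_mult_add)
  qed (use cl C in auto)
qed

lemma tensor_mult_closed:
  "C \<in> carrier (tpart p q) \<Longrightarrow> D \<in> carrier (tpart p' q') \<Longrightarrow>
    tensor_mult R S p q p' q' C D \<in> carrier (tpart (p + p') (q + q'))"
  using hom_in_carrier[OF tensor_mult_hom(2)] by blast

lemma tensor_mult_one:
  shows "D \<in> carrier (tpart p' q') \<Longrightarrow> tensor_mult R S p q p' q' \<one>\<^bsub>tpart p q\<^esub> D = \<one>\<^bsub>tpart (p + p') (q + q')\<^esub>"
    and "C \<in> carrier (tpart p q) \<Longrightarrow> tensor_mult R S p q p' q' C \<one>\<^bsub>tpart p' q'\<^esub> = \<one>\<^bsub>tpart (p + p') (q + q')\<^esub>"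
  using hom_one[OF tensor_mult_hom(1) part_grp part_grp] hom_one[OF tensor_mult_hom(2) part_grp part_grp]
  by auto

lemma carrier_tensor_ring: "x \<in> carrier (tensor_ring R S) \<longleftrightarrow>
    (\<forall>p q. x (p, q) \<in> carrier (tpart p q)) \<and> finite {(p, q). x (p, q) \<noteq> \<one>\<^bsub>tpart p q\<^esub>}"
proof -
  have "carrier (tensor_ring R S) = carrier (sum_group UNIV (\<lambda>(p, q). tpart p q))"
    by (simp add: tensor_ring_def ring_on_def)
  also have "\<dots> = {x \<in> \<Pi>\<^sub>E i\<in>UNIV. carrier (case i of (p, q) \<Rightarrow> tpart p q).
      finite {i \<in> UNIV. x i \<noteq> \<one>\<^bsub>(case i of (p, q) \<Rightarrow> tpart p q)\<^esub>}}"
    by (rule carrier_sum_group) (auto simp: part_grp)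
  finally show ?thesis
    by (auto simp: PiE_iff case_prod_unfold)
qed

lemma tensor_ring_simps:
  "\<zero>\<^bsub>tensor_ring R S\<^esub> = (\<lambda>(p, q). \<one>\<^bsub>tpart p q\<^esub>)"
  "x \<oplus>\<^bsub>tensor_ring R S\<^esub> y = (\<lambda>(p, q). x (p, q) \<otimes>\<^bsub>tpart p q\<^esub> y (p, q))"
  "(x \<otimes>\<^bsub>tensor_ring R S\<^esub> y) (r, s) = finprod (tpart r s)
        (\<lambda>(p, q). tensor_mult R S p q (r - p) (s - q) (x (p, q)) (y (r - p, s - q))) ({..r} \<times> {..s})"
  "\<one>\<^bsub>tensor_ring R S\<^esub> (p, q) = (if p = 0 \<and> q = 0 then pure_tensor (gpart R 0) (gpart S 0) (gone R) (gone S)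
        else \<one>\<^bsub>tpart p q\<^esub>)"
  by (auto simp: tensor_ring_def ring_on_def fun_eq_iff case_prod_unfold)

lemma tensor_ring_abelian_group: "abelian_group (tensor_ring R S)"
proof -
  have add: "add_monoid (tensor_ring R S) = sum_group UNIV (\<lambda>(p, q). tpart p q)"
    unfolding tensor_ring_def by (rule add_monoid_ring_on)
  have "comm_group (sum_group UNIV (\<lambda>(p, q). tpart p q))"
  proof (rule group.group_comm_groupI)
    show "group (sum_group UNIV (\<lambda>(p, q). tpart p q))"
      by (rule sum_group) (auto simp: part_grp)
    fix x y assume "x \<in> carrier (sum_group UNIV (\<lambda>(p, q). tpart p q))" "y \<in> carrier (sum_group UNIV (\<lambda>(p, q). tpart p q))"
    then have "x \<in> carrier (tensor_ring R S)" "y \<in> carrier (tensor_ring R S)"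
      by (simp_all add: tensor_ring_def ring_on_def)
    then show "x \<otimes>\<^bsub>sum_group UNIV (\<lambda>(p, q). tpart p q)\<^esub> y = y \<otimes>\<^bsub>sum_group UNIV (\<lambda>(p, q). tpart p q)\<^esub> x"
      using comm_monoid.m_comm[OF comm_group.axioms(1)[OF part_comm]]
      by (auto simp: fun_eq_iff carrier_tensor_ring)
  qed
  then have "comm_group (add_monoid (tensor_ring R S))" unfolding add .
  then show ?thesis
    by (intro abelian_group.intro abelian_monoid.intro abelian_group_axioms.intro)
       (auto dest: comm_group.axioms(1))
qed

lemma carrierD: "x \<in> carrier (tensor_ring R S) \<Longrightarrow> x (p, q) \<in> carrier (tpart p q)"
  by (simp add: carrier_tensor_ring)

lemma term_closed:
  assumes "x \<in> carrier (tensor_ring R S)" "y \<in> carrier (tensor_ring R S)" "p \<le> r" "q \<le> s"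
  shows "tensor_mult R S p q (r - p) (s - q) (x (p, q)) (y (r - p, s - q)) \<in> carrier (tpart r s)"
  using tensor_mult_closed[OF carrierD[OF assms(1)] carrierD[OF assms(2)], of p q "r - p" "s - q"] assms(3,4)
  by simp

lemma term_one:
  assumes "x \<in> carrier (tensor_ring R S)" "y \<in> carrier (tensor_ring R S)" "p \<le> r" "q \<le> s"
    and "x (p, q) = \<one>\<^bsub>tpart p q\<^esub> \<or> y (r - p, s - q) = \<one>\<^bsub>tpart (r - p) (s - q)\<^esub>"
  shows "tensor_mult R S p q (r - p) (s - q) (x (p, q)) (y (r - p, s - q)) = \<one>\<^bsub>tpart r s\<^esub>"
  using assms(5)
proof
  assume "x (p, q) = \<one>\<^bsub>tpart p q\<^esub>"
  then show ?thesis
    using tensor_mult_one(1)[where p = p and q = q, OF carrierD[OF assms(2), of "r - p" "s - q"]] assms(3,4)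
    by simp
next
  assume "y (r - p, s - q) = \<one>\<^bsub>tpart (r - p) (s - q)\<^esub>"
  then show ?thesis
    using tensor_mult_one(2)[where p' = "r - p" and q' = "s - q", OF carrierD[OF assms(1), of p q]] assms(3,4)
    by simp
qed

text \<open>Finiteness of the support is the point: a bidegree where the product is nontrivial is a
  sum of bidegrees from the two finite supports.\<close>

lemma tensor_ring_mult_closed:
  assumes x: "x \<in> carrier (tensor_ring R S)" and y: "y \<in> carrier (tensor_ring R S)"
  shows "x \<otimes>\<^bsub>tensor_ring R S\<^esub> y \<in> carrier (tensor_ring R S)"
proof -
  let ?X = "{(p, q). x (p, q) \<noteq> \<one>\<^bsub>tpart p q\<^esub>}" and ?Y = "{(p, q). y (p, q) \<noteq> \<one>\<^bsub>tpart p q\<^esub>}"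
  have "{(r, s). (x \<otimes>\<^bsub>tensor_ring R S\<^esub> y) (r, s) \<noteq> \<one>\<^bsub>tpart r s\<^esub>} \<subseteq>
      (\<lambda>((p, q), (p', q')). (p + p', q + q')) ` (?X \<times> ?Y)"
  proof clarify
    fix r s assume ne: "(x \<otimes>\<^bsub>tensor_ring R S\<^esub> y) (r, s) \<noteq> \<one>\<^bsub>tpart r s\<^esub>"
    have "\<exists>p\<le>r. \<exists>q\<le>s. x (p, q) \<noteq> \<one>\<^bsub>tpart p q\<^esub> \<and> y (r - p, s - q) \<noteq> \<one>\<^bsub>tpart (r - p) (s - q)\<^esub>"
    proof (rule ccontr)
      assume *: "\<not> ?thesis"
      have "(x \<otimes>\<^bsub>tensor_ring R S\<^esub> y) (r, s) = \<one>\<^bsub>tpart r s\<^esub>"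
        unfolding tensor_ring_simps
      proof (rule comm_monoid.finprod_one_eqI[OF comm_group.axioms(1)[OF part_comm]], clarsimp)
        fix p q assume "p \<le> r" "q \<le> s"
        then show "tensor_mult R S p q (r - p) (s - q) (x (p, q)) (y (r - p, s - q)) = \<one>\<^bsub>tpart r s\<^esub>"
          using * by (intro term_one[OF x y]) blast+
      qed
      with ne show False by blast
    qed
    then obtain p q where "p \<le> r" "q \<le> s" "(p, q) \<in> ?X" "(r - p, s - q) \<in> ?Y" by blast
    then show "(r, s) \<in> (\<lambda>((p, q), (p', q')). (p + p', q + q')) ` (?X \<times> ?Y)"
      by (intro image_eqI[of _ _ "((p, q), (r - p, s - q))"]) auto
  qed
  moreover have "finite ((\<lambda>((p, q), (p', q')). (p + p', q + q')) ` (?X \<times> ?Y))"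
    using x y by (intro finite_imageI finite_cartesian_product) (simp_all add: carrier_tensor_ring)
  ultimately have "finite {(r, s). (x \<otimes>\<^bsub>tensor_ring R S\<^esub> y) (r, s) \<noteq> \<one>\<^bsub>tpart r s\<^esub>}"
    by (rule finite_subset)
  moreover have "(x \<otimes>\<^bsub>tensor_ring R S\<^esub> y) (r, s) \<in> carrier (tpart r s)" for r s
    unfolding tensor_ring_simps
    by (intro comm_monoid.finprod_closed[OF comm_group.axioms(1)[OF part_comm]])
       (auto intro!: term_closed[OF x y])
  ultimately show ?thesis by (simp add: carrier_tensor_ring)
qed

lemma tensor_ring_one_closed: "\<one>\<^bsub>tensor_ring R S\<^esub> \<in> carrier (tensor_ring R S)"
proof -
  have "pure_tensor (gpart R 0) (gpart S 0) (gone R) (gone S) \<in> carrier (tpart 0 0)"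
    using tcoset_in_carrier[of "frag_of (gone R, gone S)" "gpart R 0" "gpart S 0"] R.gone_closed S.gone_closed
    by (simp add: pure_tensor_def tcoset_def)
  moreover have "finite {(p, q). \<one>\<^bsub>tensor_ring R S\<^esub> (p, q) \<noteq> \<one>\<^bsub>tpart p q\<^esub>}"
    by (rule finite_subset[of _ "{(0, 0)}"]) (auto simp: tensor_ring_simps split: if_splits)
  ultimately show ?thesis by (simp add: carrier_tensor_ring) (simp add: tensor_ring_simps)
qed

lemma tensor_ring_distrib:
  assumes x: "x \<in> carrier (tensor_ring R S)" and y: "y \<in> carrier (tensor_ring R S)"
    and z: "z \<in> carrier (tensor_ring R S)"
  shows "(x \<oplus>\<^bsub>tensor_ring R S\<^esub> y) \<otimes>\<^bsub>tensor_ring R S\<^esub> z =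
      x \<otimes>\<^bsub>tensor_ring R S\<^esub> z \<oplus>\<^bsub>tensor_ring R S\<^esub> y \<otimes>\<^bsub>tensor_ring R S\<^esub> z" (is ?l)
    and "z \<otimes>\<^bsub>tensor_ring R S\<^esub> (x \<oplus>\<^bsub>tensor_ring R S\<^esub> y) =
      z \<otimes>\<^bsub>tensor_ring R S\<^esub> x \<oplus>\<^bsub>tensor_ring R S\<^esub> z \<otimes>\<^bsub>tensor_ring R S\<^esub> y" (is ?r)
proof -
  let ?t = "\<lambda>x y r s (p, q). tensor_mult R S p q (r - p) (s - q) (x (p, q)) (y (r - p, s - q))"
  let ?xy = "x \<oplus>\<^bsub>tensor_ring R S\<^esub> y"
  have xy: "?xy \<in> carrier (tensor_ring R S)"
    using tensor_ring_abelian_group x y by (simp add: abelian_group.axioms(1) abelian_monoid.a_closed)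
  note cm = comm_group.axioms(1)[OF part_comm]
  have fd: "finprod (tpart r s) f ({..r} \<times> {..s}) =
      finprod (tpart r s) g ({..r} \<times> {..s}) \<otimes>\<^bsub>tpart r s\<^esub> finprod (tpart r s) h ({..r} \<times> {..s})"
    if "\<And>i. i \<in> {..r} \<times> {..s} \<Longrightarrow> f i = g i \<otimes>\<^bsub>tpart r s\<^esub> h i"
      "g \<in> {..r} \<times> {..s} \<rightarrow> carrier (tpart r s)" "h \<in> {..r} \<times> {..s} \<rightarrow> carrier (tpart r s)" for r s f g h
    unfolding comm_monoid.finprod_multf[OF cm that(2,3), symmetric]
    by (rule comm_monoid.finprod_cong'[OF cm]) (use that in \<open>auto simp: Pi_iff\<close>)
  have cl: "?t a b r s \<in> {..r} \<times> {..s} \<rightarrow> carrier (tpart r s)"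
    if "a \<in> carrier (tensor_ring R S)" "b \<in> carrier (tensor_ring R S)" for a b r s
    using term_closed[OF that] by auto
  show ?l
  proof (rule ext, clarify)
    fix r s
    have "(?xy \<otimes>\<^bsub>tensor_ring R S\<^esub> z) (r, s) =
        (x \<otimes>\<^bsub>tensor_ring R S\<^esub> z) (r, s) \<otimes>\<^bsub>tpart r s\<^esub> (y \<otimes>\<^bsub>tensor_ring R S\<^esub> z) (r, s)"
      unfolding tensor_ring_simps(3)
    proof (rule fd[OF _ cl[OF x z] cl[OF y z]])
      fix i assume "i \<in> {..r} \<times> {..s}"
      then obtain p q where i: "i = (p, q)" "p \<le> r" "q \<le> s" by auto
      show "?t ?xy z r s i = ?t x z r s i \<otimes>\<^bsub>tpart r s\<^esub> ?t y z r s i"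
        using hom_mult[OF tensor_mult_hom(1)[OF carrierD[OF z, of "r - p" "s - q"], of p q] carrierD[OF x] carrierD[OF y]] i
        by (simp add: tensor_ring_simps(2))
    qed
    then show "(?xy \<otimes>\<^bsub>tensor_ring R S\<^esub> z) (r, s) =
        (x \<otimes>\<^bsub>tensor_ring R S\<^esub> z \<oplus>\<^bsub>tensor_ring R S\<^esub> y \<otimes>\<^bsub>tensor_ring R S\<^esub> z) (r, s)"
      by (simp add: tensor_ring_simps(2))
  qed
  show ?r
  proof (rule ext, clarify)
    fix r s
    have "(z \<otimes>\<^bsub>tensor_ring R S\<^esub> ?xy) (r, s) =
        (z \<otimes>\<^bsub>tensor_ring R S\<^esub> x) (r, s) \<otimes>\<^bsub>tpart r s\<^esub> (z \<otimes>\<^bsub>tensor_ring R S\<^esub> y) (r, s)"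
      unfolding tensor_ring_simps(3)
    proof (rule fd[OF _ cl[OF z x] cl[OF z y]])
      fix i assume "i \<in> {..r} \<times> {..s}"
      then obtain p q where i: "i = (p, q)" "p \<le> r" "q \<le> s" by auto
      show "?t z ?xy r s i = ?t z x r s i \<otimes>\<^bsub>tpart r s\<^esub> ?t z y r s i"
        using hom_mult[OF tensor_mult_hom(2)[OF carrierD[OF z, of p q], of "r - p" "s - q"] carrierD[OF x] carrierD[OF y]] i
        by (simp add: tensor_ring_simps(2))
    qed
    then show "(z \<otimes>\<^bsub>tensor_ring R S\<^esub> ?xy) (r, s) =
        (z \<otimes>\<^bsub>tensor_ring R S\<^esub> x \<oplus>\<^bsub>tensor_ring R S\<^esub> z \<otimes>\<^bsub>tensor_ring R S\<^esub> y) (r, s)"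
      by (simp add: tensor_ring_simps(2))
  qed
qed

subsection \<open>The grading by the second degree\<close>

lemma mem_second_degree_part: "x \<in> second_degree_part (tensor_ring R S) q \<longleftrightarrow>
    x \<in> carrier (tensor_ring R S) \<and> (\<forall>p s. s \<noteq> q \<longrightarrow> x (p, s) = \<one>\<^bsub>tpart p s\<^esub>)"
  by (simp add: second_degree_part_def tensor_ring_simps)

lemma second_degree_component_apply: "second_degree_component (tensor_ring R S) q x (p, s) =
    (if s = q then x (p, s) else \<one>\<^bsub>tpart p s\<^esub>)"
  by (simp add: second_degree_component_def tensor_ring_simps)

lemma second_degree_component_in:
  assumes "x \<in> carrier (tensor_ring R S)"
  shows "second_degree_component (tensor_ring R S) q x \<in> second_degree_part (tensor_ring R S) q"
proof -
  have "{(p, s). second_degree_component (tensor_ring R S) q x (p, s) \<noteq> \<one>\<^bsub>tpart p s\<^esub>} \<subseteq>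
      {(p, q). x (p, q) \<noteq> \<one>\<^bsub>tpart p q\<^esub>}"
    by (auto simp: second_degree_component_apply)
  from finite_subset[OF this] show ?thesis
    using assms by (simp add: mem_second_degree_part carrier_tensor_ring) (simp add: second_degree_component_apply)
qed

lemma second_degree_component_add:
  "second_degree_component (tensor_ring R S) q (x \<oplus>\<^bsub>tensor_ring R S\<^esub> y) =
    second_degree_component (tensor_ring R S) q x \<oplus>\<^bsub>tensor_ring R S\<^esub> second_degree_component (tensor_ring R S) q y"
proof (rule ext, clarify)
  fix p s
  have "\<one>\<^bsub>tpart p s\<^esub> \<otimes>\<^bsub>tpart p s\<^esub> \<one>\<^bsub>tpart p s\<^esub> = \<one>\<^bsub>tpart p s\<^esub>"
    using part_grp by (simp add: group.is_monoid monoid.l_one)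
  then show "second_degree_component (tensor_ring R S) q (x \<oplus>\<^bsub>tensor_ring R S\<^esub> y) (p, s) =
    (second_degree_component (tensor_ring R S) q x \<oplus>\<^bsub>tensor_ring R S\<^esub> second_degree_component (tensor_ring R S) q y) (p, s)"
    by (simp add: second_degree_component_apply tensor_ring_simps(2))
qed

lemma second_degree_component_same:
  "x \<in> second_degree_part (tensor_ring R S) q \<Longrightarrow> second_degree_component (tensor_ring R S) q x = x"
  by (auto simp: mem_second_degree_part second_degree_component_apply fun_eq_iff)

lemma second_degree_component_other:
  "x \<in> second_degree_part (tensor_ring R S) q \<Longrightarrow> q \<noteq> q' \<Longrightarrow>
    second_degree_component (tensor_ring R S) q' x = \<zero>\<^bsub>tensor_ring R S\<^esub>"
  by (auto simp: mem_second_degree_part second_degree_component_apply fun_eq_iff tensor_ring_simps)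

lemma second_degree_component_eqI:
  assumes "\<And>q. second_degree_component (tensor_ring R S) q x = second_degree_component (tensor_ring R S) q y"
  shows "x = y"
proof (rule ext, clarify)
  fix p q
  show "x (p, q) = y (p, q)"
    using fun_cong[OF assms[of q], of "(p, q)"] by (simp add: second_degree_component_apply)
qed

lemma second_degree_part_mult:
  assumes x: "x \<in> second_degree_part (tensor_ring R S) a" and y: "y \<in> second_degree_part (tensor_ring R S) b"
  shows "x \<otimes>\<^bsub>tensor_ring R S\<^esub> y \<in> second_degree_part (tensor_ring R S) (a + b)"
proof -
  have c: "x \<in> carrier (tensor_ring R S)" "y \<in> carrier (tensor_ring R S)"
    using x y by (auto simp: mem_second_degree_part)
  have "(x \<otimes>\<^bsub>tensor_ring R S\<^esub> y) (r, s) = \<one>\<^bsub>tpart r s\<^esub>" if "s \<noteq> a + b" for r s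
    unfolding tensor_ring_simps(3)
  proof (intro comm_monoid.finprod_one_eqI[OF comm_group.axioms(1)[OF part_comm]], clarsimp)
    fix p q assume pq: "p \<le> r" "q \<le> s"
    then have "q \<noteq> a \<or> s - q \<noteq> b" using that by auto
    then have "x (p, q) = \<one>\<^bsub>tpart p q\<^esub> \<or> y (r - p, s - q) = \<one>\<^bsub>tpart (r - p) (s - q)\<^esub>"
      using x y unfolding mem_second_degree_part by blast
    then show "tensor_mult R S p q (r - p) (s - q) (x (p, q)) (y (r - p, s - q)) = \<one>\<^bsub>tpart r s\<^esub>"
      by (rule term_one[OF c pq])
  qed
  then show ?thesis using c by (simp add: mem_second_degree_part tensor_ring_mult_closed)
qed

text \<open>This is how vanishing cohomology enters: a trivial graded piece of the second factor
  kills every tensor group built on it, whatever the first degree.\<close>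

lemma second_degree_part_trivial:
  assumes "carrier (gpart S q) = {\<one>\<^bsub>gpart S q\<^esub>}"
  shows "second_degree_part (tensor_ring R S) q = {\<zero>\<^bsub>tensor_ring R S\<^esub>}"
proof -
  have t: "carrier (tpart p q) = {\<one>\<^bsub>tpart p q\<^esub>}" for p
    by (intro trivial_tensor_group R.part_group S.part_group assms)
  have "x = \<zero>\<^bsub>tensor_ring R S\<^esub>" if "x \<in> second_degree_part (tensor_ring R S) q" for x
  proof (rule ext, clarify)
    fix p s
    show "x (p, s) = \<zero>\<^bsub>tensor_ring R S\<^esub> (p, s)"
      using that t[of p] carrierD[of x p q]
      by (cases "s = q") (auto simp: mem_second_degree_part tensor_ring_simps(1))
  qed
  moreover have "\<zero>\<^bsub>tensor_ring R S\<^esub> \<in> carrier (tensor_ring R S)"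
    using tensor_ring_abelian_group by (simp add: abelian_group.axioms(1) abelian_monoid.zero_closed)
  then have "\<zero>\<^bsub>tensor_ring R S\<^esub> \<in> second_degree_part (tensor_ring R S) q"
    by (simp add: mem_second_degree_part tensor_ring_simps(1))
  ultimately show ?thesis by blast
qed

end

subsection \<open>Induced maps\<close>

locale tensor_pair_map = A: tensor_pair R S + B: tensor_pair R' S'
  for R :: "'a graded_ring" and S :: "'b graded_ring" and R' :: "'c graded_ring" and S' :: "'d graded_ring" +
  fixes f g
  assumes f: "graded_hom R R' f" and g: "graded_hom S S' g"
begin

lemma f_hom: "f p \<in> hom (gpart R p) (gpart R' p)" and g_hom: "g p \<in> hom (gpart S p) (gpart S' p)"
  using f g by (auto simp: graded_hom_def)

abbreviation "tm p q \<equiv> tensor_map (gpart R' p) (gpart S' q) (f p) (g q)"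

lemma tm_hom: "tm p q \<in> hom (A.tpart p q) (B.tpart p q)"
  by (intro tensor_map_hom A.R.part_group A.S.part_group B.R.part_group B.S.part_group f_hom g_hom)

lemma tm_one: "tm p q \<one>\<^bsub>A.tpart p q\<^esub> = \<one>\<^bsub>B.tpart p q\<^esub>"
  by (rule hom_one[OF tm_hom A.part_grp B.part_grp])

lemma tensor_ring_map_apply: "tensor_ring_map R' S' f g x (p, q) = tm p q (x (p, q))"
  by (simp add: tensor_ring_map_def)

lemma tensor_ring_map_closed:
  assumes "x \<in> carrier (tensor_ring R S)"
  shows "tensor_ring_map R' S' f g x \<in> carrier (tensor_ring R' S')"
proof -
  have "{(p, q). tm p q (x (p, q)) \<noteq> \<one>\<^bsub>B.tpart p q\<^esub>} \<subseteq> {(p, q). x (p, q) \<noteq> \<one>\<^bsub>A.tpart p q\<^esub>}"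
    by (auto simp: tm_one)
  moreover have "tm p q (x (p, q)) \<in> carrier (B.tpart p q)" for p q
    using hom_in_carrier[OF tm_hom A.carrierD[OF assms]] .
  ultimately show ?thesis
    using assms finite_subset unfolding B.carrier_tensor_ring A.carrier_tensor_ring tensor_ring_map_apply
    by blast
qed

lemma tensor_ring_map_add:
  assumes "x \<in> carrier (tensor_ring R S)" "y \<in> carrier (tensor_ring R S)"
  shows "tensor_ring_map R' S' f g (x \<oplus>\<^bsub>tensor_ring R S\<^esub> y) =
    tensor_ring_map R' S' f g x \<oplus>\<^bsub>tensor_ring R' S'\<^esub> tensor_ring_map R' S' f g y"
  using hom_mult[OF tm_hom A.carrierD[OF assms(1)] A.carrierD[OF assms(2)]]
  by (auto simp: fun_eq_iff tensor_ring_map_apply A.tensor_ring_simps(2) B.tensor_ring_simps(2))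

text \<open>Induction over the representatives of both factors reduces the claim to pure tensors,
  where it is multiplicativity of \<open>f\<close> and \<open>g\<close>. The signs agree because
  bidegrees are preserved.\<close>

lemma tm_tensor_mult:
  assumes C: "C \<in> carrier (A.tpart p q)" and D: "D \<in> carrier (A.tpart p' q')"
  shows "tm (p + p') (q + q') (tensor_mult R S p q p' q' C D) = tensor_mult R' S' p q p' q' (tm p q C) (tm p' q' D)"
proof -
  obtain x where x: "x \<in> carrier (A.reps p q)" "C = tcoset (gpart R p) (gpart S q) x"
    using C by (elim tensor_groupE)
  obtain y where y: "y \<in> carrier (A.reps p' q')" "D = tcoset (gpart R p') (gpart S q') y"
    using D by (elim tensor_groupE)
  let ?\<phi> = "\<lambda>p q. frag_extend (\<lambda>(a, b). frag_of (f p a, g q b))"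
  have \<phi>: "?\<phi> p q z \<in> carrier (B.reps p q)" if "z \<in> carrier (A.reps p q)" for p q z
    by (rule hom_in_carrier[OF frag_extend_hom that])
       (use hom_in_carrier[OF f_hom] hom_in_carrier[OF g_hom] in auto)
  note T = tensor_map_tcoset[OF A.R.part_group A.S.part_group B.R.part_group B.S.part_group f_hom g_hom]
  have "?\<phi> (p + p') (q + q') (rep_mult R S p q p' q' x y) = rep_mult R' S' p q p' q' (?\<phi> p q x) (?\<phi> p' q' y)"
    using x(1) unfolding carrier_free_Abelian_group_iff
  proof (induction rule: frag_induction)
    case (one z)
    then obtain a b where z: "z = (a, b)" "a \<in> carrier (gpart R p)" "b \<in> carrier (gpart S q)" by auto
    show ?case using y(1) unfolding carrier_free_Abelian_group_iff z(1)
      by (induction rule: frag_induction)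
         (use z f g in \<open>auto simp: rep_mult_diff frag_extend_diff frag_extend_cmul graded_hom_def\<close>)
  qed (auto simp: rep_mult_diff frag_extend_diff)
  then show ?thesis
    by (simp only: x(2) y(2) A.tensor_mult_tcoset[OF x(1) y(1)] T A.rep_mult_closed[OF x(1) y(1)] x(1) y(1)
        B.tensor_mult_tcoset[OF \<phi>[OF x(1)] \<phi>[OF y(1)]])
qed

lemma tensor_ring_map_mult:
  assumes x: "x \<in> carrier (tensor_ring R S)" and y: "y \<in> carrier (tensor_ring R S)"
  shows "tensor_ring_map R' S' f g (x \<otimes>\<^bsub>tensor_ring R S\<^esub> y) =
    tensor_ring_map R' S' f g x \<otimes>\<^bsub>tensor_ring R' S'\<^esub> tensor_ring_map R' S' f g y"
proof (rule ext, clarify)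
  fix r s
  let ?t = "\<lambda>(p, q). tensor_mult R S p q (r - p) (s - q) (x (p, q)) (y (r - p, s - q))"
  let ?I = "{..r} \<times> {..s}"
  have t: "?t \<in> ?I \<rightarrow> carrier (A.tpart r s)" using A.term_closed[OF x y] by auto
  have "tm r s (finprod (A.tpart r s) ?t ?I) = finprod (B.tpart r s) (\<lambda>i. tm r s (?t i)) ?I"
    by (rule hom_finprod[OF A.part_comm B.part_comm tm_hom t])
  also have "\<dots> = finprod (B.tpart r s) (\<lambda>(p, q). tensor_mult R' S' p q (r - p) (s - q)
      (tm p q (x (p, q))) (tm (r - p) (s - q) (y (r - p, s - q)))) ?I"
  proof (rule comm_monoid.finprod_cong'[OF comm_group.axioms(1)[OF B.part_comm] refl])
    show "(\<lambda>(p, q). tensor_mult R' S' p q (r - p) (s - q)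
      (tm p q (x (p, q))) (tm (r - p) (s - q) (y (r - p, s - q)))) \<in> ?I \<rightarrow> carrier (B.tpart r s)"
      using B.term_closed[OF tensor_ring_map_closed[OF x] tensor_ring_map_closed[OF y]]
      by (auto simp: tensor_ring_map_apply)
    fix i assume "i \<in> ?I"
    then obtain p q where i: "i = (p, q)" "p \<le> r" "q \<le> s" by auto
    show "tm r s (?t i) = (case i of (p, q) \<Rightarrow> tensor_mult R' S' p q (r - p) (s - q)
      (tm p q (x (p, q))) (tm (r - p) (s - q) (y (r - p, s - q))))"
      using tm_tensor_mult[OF A.carrierD[OF x, of p q] A.carrierD[OF y, of "r - p" "s - q"]] i by simp
  qed
  finally show "tensor_ring_map R' S' f g (x \<otimes>\<^bsub>tensor_ring R S\<^esub> y) (r, s) =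
    (tensor_ring_map R' S' f g x \<otimes>\<^bsub>tensor_ring R' S'\<^esub> tensor_ring_map R' S' f g y) (r, s)"
    by (simp only: tensor_ring_map_apply A.tensor_ring_simps(3) B.tensor_ring_simps(3))
qed

lemma tensor_ring_map_one:
  "tensor_ring_map R' S' f g \<one>\<^bsub>tensor_ring R S\<^esub> = \<one>\<^bsub>tensor_ring R' S'\<^esub>"
proof (rule ext, clarify)
  fix p q
  have "tm 0 0 (tcoset (gpart R 0) (gpart S 0) (frag_of (gone R, gone S))) =
      tcoset (gpart R' 0) (gpart S' 0) (frag_of (gone R', gone S'))"
    using tensor_map_tcoset[OF A.R.part_group A.S.part_group B.R.part_group B.S.part_group f_hom g_hom,
        of "frag_of (gone R, gone S)" 0 0] A.R.gone_closed A.S.gone_closed f g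
    by (simp add: graded_hom_def)
  then show "tensor_ring_map R' S' f g \<one>\<^bsub>tensor_ring R S\<^esub> (p, q) = \<one>\<^bsub>tensor_ring R' S'\<^esub> (p, q)"
    by (simp add: tensor_ring_map_apply A.tensor_ring_simps(4) B.tensor_ring_simps(4) tm_one
        pure_tensor_def tcoset_def)
qed

lemma tensor_ring_map_second_degree_part:
  "x \<in> second_degree_part (tensor_ring R S) q \<Longrightarrow>
    tensor_ring_map R' S' f g x \<in> second_degree_part (tensor_ring R' S') q"
  by (auto simp: A.mem_second_degree_part B.mem_second_degree_part tensor_ring_map_closed
      tensor_ring_map_apply tm_one)

end

lemma tensor_ring_map_comp:
  assumes "tensor_pair R S" "tensor_pair R' S'" "tensor_pair R'' S''"
    and "graded_hom R R' f" "graded_hom R' R'' f'" "graded_hom R R'' f''"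
    and "graded_hom S S' g" "graded_hom S' S'' g'" "graded_hom S S'' g''"
    and "\<And>p a. a \<in> carrier (gpart R p) \<Longrightarrow> f'' p a = f' p (f p a)"
    and "\<And>p a. a \<in> carrier (gpart S p) \<Longrightarrow> g'' p a = g' p (g p a)"
    and "x \<in> carrier (tensor_ring R S)"
  shows "tensor_ring_map R'' S'' f' g' (tensor_ring_map R' S' f g x) = tensor_ring_map R'' S'' f'' g'' x"
proof -
  interpret A: tensor_pair R S by fact
  interpret B: tensor_pair R' S' by fact
  interpret C: tensor_pair R'' S'' by fact
  show ?thesis
  proof (rule ext, clarify)
    fix p q
    have "tensor_map (gpart R'' p) (gpart S'' q) (f' p) (g' q)
        (tensor_map (gpart R' p) (gpart S' q) (f p) (g q) (x (p, q))) =
      tensor_map (gpart R'' p) (gpart S'' q) (f'' p) (g'' q) (x (p, q))"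
      by (rule tensor_map_comp[where G = "gpart R p" and H = "gpart S q"])
         (use assms(4-11) A.carrierD[OF assms(12)] in \<open>simp_all add: graded_hom_def A.R.part_group
           A.S.part_group B.R.part_group B.S.part_group C.R.part_group C.S.part_group\<close>)
    then show "tensor_ring_map R'' S'' f' g' (tensor_ring_map R' S' f g x) (p, q) =
        tensor_ring_map R'' S'' f'' g'' x (p, q)"
      by (simp add: tensor_ring_map_def)
  qed
qed

lemma tensor_ring_map_ident:
  assumes "tensor_pair R S" "graded_hom R R f" "graded_hom S S g"
    and "\<And>p a. a \<in> carrier (gpart R p) \<Longrightarrow> f p a = a"
    and "\<And>p a. a \<in> carrier (gpart S p) \<Longrightarrow> g p a = a"
    and "x \<in> carrier (tensor_ring R S)"
  shows "tensor_ring_map R S f g x = x"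
proof -
  interpret A: tensor_pair R S by fact
  show ?thesis
  proof (rule ext, clarify)
    fix p q
    have "tensor_map (gpart R p) (gpart S q) (f p) (g q) (x (p, q)) = x (p, q)"
      by (rule tensor_map_ident)
         (use assms(2-5) A.carrierD[OF assms(6)] in \<open>simp_all add: graded_hom_def A.R.part_group A.S.part_group\<close>)
    then show "tensor_ring_map R S f g x (p, q) = x (p, q)"
      by (simp add: tensor_ring_map_def)
  qed
qed

section \<open>The comparison map\<close>

context comm_monoid begin

lemma finprod_swap:
  assumes "finite A" "finite B" "\<And>a b. a \<in> A \<Longrightarrow> b \<in> B \<Longrightarrow> h a b \<in> carrier G"
  shows "finprod G (\<lambda>a. finprod G (h a) B) A = finprod G (\<lambda>b. finprod G (\<lambda>a. h a b) A) B"
  using assms(1,3)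
proof (induction A rule: finite_induct)
  case (insert a A)
  then have "finprod G (\<lambda>b. finprod G (\<lambda>a. h a b) (insert a A)) B =
      finprod G (\<lambda>b. h a b \<otimes> finprod G (\<lambda>a. h a b) A) B"
    by (intro finprod_cong') (auto simp: Pi_iff)
  with insert show ?case by (simp add: Pi_iff)
qed simp

lemma finprod_cartesian_product:
  assumes "finite A" "finite B" "\<And>a b. a \<in> A \<Longrightarrow> b \<in> B \<Longrightarrow> h a b \<in> carrier G"
  shows "finprod G (\<lambda>(a, b). h a b) (A \<times> B) = finprod G (\<lambda>a. finprod G (h a) B) A"
  using assms(1,3)
proof (induction A rule: finite_induct)
  case (insert a A)
  have "insert a A \<times> B = Pair a ` B \<union> A \<times> B" by auto
  moreover have "finprod G (\<lambda>(a, b). h a b) (Pair a ` B) = finprod G (h a) B"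
    using insert.prems by (subst finprod_reindex) (auto simp: inj_on_def)
  moreover have "finprod G (\<lambda>(a, b). h a b) (Pair a ` B \<union> A \<times> B) =
      finprod G (\<lambda>(a, b). h a b) (Pair a ` B) \<otimes> finprod G (\<lambda>(a, b). h a b) (A \<times> B)"
    using insert assms(2) by (intro finprod_Un_disjoint) auto
  ultimately show ?case using insert by (simp add: Pi_iff)
qed simp

end

text \<open>Separates the algebra from the geometry of the torus. In \<open>meet\<close>, the layer
  \<open>L0\<close> plays the role of the connected component around \<open>L\<close> of the
  intersection of two layers: that intersection may be disconnected, so a meet exists only relative
  to a layer contained in both.\<close>

locale layer_system =
  fixes Ls :: "'p set set" and rank :: "'p set \<Rightarrow> nat" and T :: "'p set"
    and R :: "'p set \<Rightarrow> 'a graded_ring" and S :: "'p set \<Rightarrow> 'b graded_ring"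
    and f :: "'p set \<Rightarrow> 'p set \<Rightarrow> nat \<Rightarrow> 'a \<Rightarrow> 'a" and g :: "'p set \<Rightarrow> 'p set \<Rightarrow> nat \<Rightarrow> 'b \<Rightarrow> 'b"
  assumes fin: "finite Ls"
    and top: "T \<in> Ls" "rank T = 0" "L \<in> Ls \<Longrightarrow> L \<subseteq> T"
    and rank_eq: "L \<in> Ls \<Longrightarrow> L' \<in> Ls \<Longrightarrow> L \<subseteq> L' \<Longrightarrow> rank L = rank L' \<Longrightarrow> L = L'"
    and meet: "L \<in> Ls \<Longrightarrow> L1 \<in> Ls \<Longrightarrow> L2 \<in> Ls \<Longrightarrow> L \<subseteq> L1 \<Longrightarrow> L \<subseteq> L2 \<Longrightarrow>
      \<exists>L0\<in>Ls. L \<subseteq> L0 \<and> L0 \<subseteq> L1 \<inter> L2 \<and> rank L0 \<le> rank L1 + rank L2 \<and>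
        (\<forall>M\<in>Ls. L \<subseteq> M \<longrightarrow> M \<subseteq> L1 \<inter> L2 \<longrightarrow> M \<subseteq> L0)"
    and pair: "L \<in> Ls \<Longrightarrow> tensor_pair (R L) (S L)"
    and f_hom: "L \<in> Ls \<Longrightarrow> L' \<in> Ls \<Longrightarrow> L \<subseteq> L' \<Longrightarrow> graded_hom (R L') (R L) (f L' L)"
    and g_hom: "L \<in> Ls \<Longrightarrow> L' \<in> Ls \<Longrightarrow> L \<subseteq> L' \<Longrightarrow> graded_hom (S L') (S L) (g L' L)"
    and f_comp: "L \<in> Ls \<Longrightarrow> L' \<in> Ls \<Longrightarrow> L'' \<in> Ls \<Longrightarrow> L \<subseteq> L' \<Longrightarrow> L' \<subseteq> L'' \<Longrightarrow>
      a \<in> carrier (gpart (R L'') p) \<Longrightarrow> f L'' L p a = f L' L p (f L'' L' p a)"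
    and g_comp: "L \<in> Ls \<Longrightarrow> L' \<in> Ls \<Longrightarrow> L'' \<in> Ls \<Longrightarrow> L \<subseteq> L' \<Longrightarrow> L' \<subseteq> L'' \<Longrightarrow>
      b \<in> carrier (gpart (S L'') p) \<Longrightarrow> g L'' L p b = g L' L p (g L'' L' p b)"
    and f_ident: "L \<in> Ls \<Longrightarrow> a \<in> carrier (gpart (R L) p) \<Longrightarrow> f L L p a = a"
    and g_ident: "L \<in> Ls \<Longrightarrow> b \<in> carrier (gpart (S L) p) \<Longrightarrow> g L L p b = b"
    and vanishing: "L \<in> Ls \<Longrightarrow> rank L < q \<Longrightarrow> carrier (gpart (S L) q) = {\<one>\<^bsub>gpart (S L) q\<^esub>}"
begin

abbreviation "rg L \<equiv> tensor_ring (R L) (S L)"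
abbreviation "mp L' L \<equiv> tensor_ring_map (R L) (S L) (f L' L) (g L' L)"
abbreviation "gr L q \<equiv> second_degree_part (rg L) q"
abbreviation "cp L q \<equiv> second_degree_component (rg L) q"
abbreviation "add_grp L \<equiv> add_monoid (rg L)"
abbreviation "larger L \<equiv> {L' \<in> Ls. L \<subseteq> L'}"

text \<open>\<open>alg_A\<close>, \<open>is_coherent\<close> and \<open>alg_B\<close> copy the shape
  of the concrete definitions, so that the abstract isomorphism turns into the concrete one by mere
  unfolding.\<close>

definition "alg_A = ring_on
     (sum_group Ls (\<lambda>L. subgroup_generated (add_grp L) (gr L (rank L))))
     (\<lambda>\<alpha> \<alpha>'. \<lambda>L''\<in>Ls. finsum (rg L'')
        (\<lambda>(L, L'). mp L L'' (\<alpha> L) \<otimes>\<^bsub>rg L''\<^esub> mp L' L'' (\<alpha>' L'))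
        {(L, L'). L \<in> Ls \<and> L' \<in> Ls \<and> L'' \<subseteq> L \<inter> L' \<and> rank L'' = rank L + rank L'})
     (\<lambda>L\<in>Ls. if L = T then \<one>\<^bsub>rg L\<^esub> else \<zero>\<^bsub>rg L\<^esub>)"

definition "is_coherent \<alpha> \<longleftrightarrow> (\<forall>q. \<forall>L\<in>Ls. rank L > q \<longrightarrow>
     finsum (rg L) (\<lambda>L'. mp L' L (cp L' q (\<alpha> L'))) {L' \<in> Ls. L \<subseteq> L' \<and> rank L' = q} = cp L q (\<alpha> L))"

definition "alg_B = (let D = direct_sum_ring Ls rg in D\<lparr>carrier := {\<alpha> \<in> carrier D. is_coherent \<alpha>}\<rparr>)"

section \<open>Maps, degrees and products in an abstract layer system\<close>

lemma pair_map: "L \<in> Ls \<Longrightarrow> L' \<in> Ls \<Longrightarrow> L \<subseteq> L' \<Longrightarrow> tensor_pair_map (R L') (S L') (R L) (S L) (f L' L) (g L' L)"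
  by (intro tensor_pair_map.intro tensor_pair_map_axioms.intro pair f_hom g_hom)

lemma comm_add: "L \<in> Ls \<Longrightarrow> comm_group (add_grp L)"
  using tensor_pair.tensor_ring_abelian_group[OF pair] by (rule abelian_group.a_comm_group)

lemma cmon: "L \<in> Ls \<Longrightarrow> comm_monoid (add_grp L)"
  using comm_add by (rule comm_group.axioms(1))

lemma grp: "L \<in> Ls \<Longrightarrow> group (add_grp L)"
  using comm_add by (rule comm_group.axioms(2))

lemma gr_carrier: "L \<in> Ls \<Longrightarrow> x \<in> gr L q \<Longrightarrow> x \<in> carrier (rg L)"
  by (simp add: second_degree_part_def)

lemma cp_gr: "L \<in> Ls \<Longrightarrow> x \<in> carrier (rg L) \<Longrightarrow> cp L q x \<in> gr L q"
  by (rule tensor_pair.second_degree_component_in[OF pair])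

lemma cp_hom: "L \<in> Ls \<Longrightarrow> cp L q \<in> hom (add_grp L) (add_grp L)"
  by (rule homI) (simp_all add: tensor_pair.second_degree_component_add[OF pair] gr_carrier[OF _ cp_gr])

lemma cp_same: "L \<in> Ls \<Longrightarrow> x \<in> gr L q \<Longrightarrow> cp L q x = x"
  and cp_other: "L \<in> Ls \<Longrightarrow> x \<in> gr L q \<Longrightarrow> q \<noteq> q' \<Longrightarrow> cp L q' x = \<zero>\<^bsub>rg L\<^esub>"
  using tensor_pair.second_degree_component_same[OF pair] tensor_pair.second_degree_component_other[OF pair]
  by auto

text \<open>The graded part is the fixed set of the endomorphism \<open>cp L q\<close>, and closure
  under the group operations follows from that description.\<close>

lemma subgroup_gr:
  assumes "L \<in> Ls"
  shows "subgroup (gr L q) (add_grp L)"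
proof -
  interpret G: comm_group "add_grp L" by (rule comm_add[OF assms])
  interpret c: group_hom "add_grp L" "add_grp L" "cp L q"
    by unfold_locales (rule cp_hom[OF assms])
  have eq: "x \<in> gr L q \<longleftrightarrow> x \<in> carrier (rg L) \<and> cp L q x = x" for x
    using assms cp_gr cp_same gr_carrier by metis
  show ?thesis
  proof (rule G.subgroupI)
    have "cp L q \<zero>\<^bsub>rg L\<^esub> = \<zero>\<^bsub>rg L\<^esub>" using c.hom_one by simp
    then show "gr L q \<noteq> {}" using eq G.one_closed by auto
    show "inv\<^bsub>add_grp L\<^esub> a \<in> gr L q" if "a \<in> gr L q" for a
      using that c.hom_inv[of a] G.inv_closed[of a] unfolding eq by simp
    show "a \<otimes>\<^bsub>add_grp L\<^esub> b \<in> gr L q" if "a \<in> gr L q" "b \<in> gr L q" for a b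
      using that c.hom_mult[of a b] G.m_closed[of a b] unfolding eq by simp
  qed (simp add: eq subset_iff)
qed

lemma gr_vanish: "L \<in> Ls \<Longrightarrow> rank L < q \<Longrightarrow> x \<in> gr L q \<Longrightarrow> x = \<zero>\<^bsub>rg L\<^esub>"
  using tensor_pair.second_degree_part_trivial[OF pair vanishing] by fastforce

lemma mp_hom: "L \<in> Ls \<Longrightarrow> L' \<in> Ls \<Longrightarrow> L \<subseteq> L' \<Longrightarrow> mp L' L \<in> hom (add_grp L') (add_grp L)"
  by (rule homI) (auto simp: tensor_pair_map.tensor_ring_map_closed[OF pair_map]
      tensor_pair_map.tensor_ring_map_add[OF pair_map])

lemma mp_closed: "L \<in> Ls \<Longrightarrow> L' \<in> Ls \<Longrightarrow> L \<subseteq> L' \<Longrightarrow> x \<in> carrier (rg L') \<Longrightarrow> mp L' L x \<in> carrier (rg L)"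
  by (rule tensor_pair_map.tensor_ring_map_closed[OF pair_map])

lemma mp_zero: "L \<in> Ls \<Longrightarrow> L' \<in> Ls \<Longrightarrow> L \<subseteq> L' \<Longrightarrow> mp L' L \<zero>\<^bsub>rg L'\<^esub> = \<zero>\<^bsub>rg L\<^esub>"
  using hom_one[OF mp_hom grp grp] by simp

lemma mp_gr: "L \<in> Ls \<Longrightarrow> L' \<in> Ls \<Longrightarrow> L \<subseteq> L' \<Longrightarrow> x \<in> gr L' q \<Longrightarrow> mp L' L x \<in> gr L q"
  by (rule tensor_pair_map.tensor_ring_map_second_degree_part[OF pair_map])

lemma mp_mult: "L \<in> Ls \<Longrightarrow> L' \<in> Ls \<Longrightarrow> L \<subseteq> L' \<Longrightarrow> x \<in> carrier (rg L') \<Longrightarrow> y \<in> carrier (rg L') \<Longrightarrow>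
    mp L' L (x \<otimes>\<^bsub>rg L'\<^esub> y) = mp L' L x \<otimes>\<^bsub>rg L\<^esub> mp L' L y"
  by (rule tensor_pair_map.tensor_ring_map_mult[OF pair_map])

lemma mp_comp: "L \<in> Ls \<Longrightarrow> L' \<in> Ls \<Longrightarrow> L'' \<in> Ls \<Longrightarrow> L \<subseteq> L' \<Longrightarrow> L' \<subseteq> L'' \<Longrightarrow> x \<in> carrier (rg L'') \<Longrightarrow>
    mp L' L (mp L'' L' x) = mp L'' L x"
  by (rule tensor_ring_map_comp[where R = "R L''" and S = "S L''"])
     (auto intro: pair f_hom g_hom f_comp g_comp)

lemma mp_ident: "L \<in> Ls \<Longrightarrow> x \<in> carrier (rg L) \<Longrightarrow> mp L L x = x"
  by (rule tensor_ring_map_ident) (auto intro: pair f_hom g_hom f_ident g_ident)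

lemma mult_closed: "L \<in> Ls \<Longrightarrow> x \<in> carrier (rg L) \<Longrightarrow> y \<in> carrier (rg L) \<Longrightarrow> x \<otimes>\<^bsub>rg L\<^esub> y \<in> carrier (rg L)"
  by (rule tensor_pair.tensor_ring_mult_closed[OF pair])

lemma mult_hom:
  assumes "L \<in> Ls" "y \<in> carrier (rg L)"
  shows "(\<lambda>x. x \<otimes>\<^bsub>rg L\<^esub> y) \<in> hom (add_grp L) (add_grp L)"
    and "(\<lambda>x. y \<otimes>\<^bsub>rg L\<^esub> x) \<in> hom (add_grp L) (add_grp L)"
  using assms by (auto intro!: homI simp: mult_closed tensor_pair.tensor_ring_distrib[OF pair])

text \<open>There are finitely many layers, so the finite support condition is automatic and the
  direct sum is a full product.\<close>

lemma carrier_alg_A: "\<alpha> \<in> carrier alg_A \<longleftrightarrow> \<alpha> \<in> (\<Pi>\<^sub>E L\<in>Ls. gr L (rank L))"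
proof -
  have c: "carrier (subgroup_generated (add_grp L) (gr L (rank L))) = gr L (rank L)" if "L \<in> Ls" for L
    using subgroup_gr[OF that] by (rule subgroup.carrier_subgroup_generated_subgroup)
  have "carrier alg_A = carrier (sum_group Ls (\<lambda>L. subgroup_generated (add_grp L) (gr L (rank L))))"
    unfolding alg_A_def by (simp add: ring_on_def)
  also have "\<dots> = {\<alpha> \<in> \<Pi>\<^sub>E L\<in>Ls. carrier (subgroup_generated (add_grp L) (gr L (rank L))).
      finite {L \<in> Ls. \<alpha> L \<noteq> \<one>\<^bsub>subgroup_generated (add_grp L) (gr L (rank L))\<^esub>}}"
    by (rule carrier_sum_group) (rule group.group_subgroup_generated[OF grp])
  also have "\<dots> = (\<Pi>\<^sub>E L\<in>Ls. gr L (rank L))"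
    using fin c by (auto cong: PiE_cong)
  finally show ?thesis by simp
qed

lemma carrier_alg_B: "\<alpha> \<in> carrier alg_B \<longleftrightarrow> \<alpha> \<in> (\<Pi>\<^sub>E L\<in>Ls. carrier (rg L)) \<and> is_coherent \<alpha>"
proof -
  have "carrier (direct_sum_ring Ls rg) = {\<alpha> \<in> \<Pi>\<^sub>E L\<in>Ls. carrier (add_grp L).
      finite {L \<in> Ls. \<alpha> L \<noteq> \<one>\<^bsub>add_grp L\<^esub>}}"
    unfolding direct_sum_ring_def ring_on_def using carrier_sum_group[of Ls add_grp] grp by simp
  then show ?thesis using fin by (auto simp: alg_B_def Let_def)
qed

text \<open>The sum is written as a product in the additive monoid, so that
  \<open>hom_finprod\<close> can move it through \<open>mp\<close>, through \<open>cp\<close> and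
  through multiplication by a fixed element.\<close>

definition comparison :: "('p set \<Rightarrow> ('a, 'b) tensor) \<Rightarrow> 'p set \<Rightarrow> ('a, 'b) tensor" where
  "comparison \<alpha> = (\<lambda>L\<in>Ls. finprod (add_grp L) (\<lambda>L'. mp L' L (\<alpha> L')) (larger L))"

lemma alg_A_comp: "\<alpha> \<in> carrier alg_A \<Longrightarrow> L \<in> Ls \<Longrightarrow> \<alpha> L \<in> gr L (rank L)"
  by (auto simp: carrier_alg_A)

lemma comparison_terms:
  assumes "\<alpha> \<in> carrier alg_A" "L \<in> Ls"
  shows "(\<lambda>L'. mp L' L (\<alpha> L')) \<in> larger L \<rightarrow> carrier (add_grp L)"
proof
  fix L' assume "L' \<in> larger L"
  then show "mp L' L (\<alpha> L') \<in> carrier (add_grp L)"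
    using mp_closed[OF assms(2) _ _ gr_carrier[OF _ alg_A_comp[OF assms(1)]], of L'] by simp
qed

lemma comparison_closed:
  assumes "\<alpha> \<in> carrier alg_A" "L \<in> Ls"
  shows "comparison \<alpha> L \<in> carrier (rg L)"
  using comm_monoid.finprod_closed[OF cmon[OF assms(2)] comparison_terms[OF assms]] assms(2)
  by (simp add: comparison_def)

text \<open>The summand coming from \<open>L'\<close> has second degree \<open>rank L'\<close>,
  which \<open>mp\<close> preserves. Projection to degree \<open>q\<close> therefore keeps exactly
  the layers of rank \<open>q\<close>.\<close>

lemma component_comparison:
  assumes \<alpha>: "\<alpha> \<in> carrier alg_A" and L: "L \<in> Ls"
  shows "cp L q (comparison \<alpha> L) =
    finprod (add_grp L) (\<lambda>L'. mp L' L (\<alpha> L')) {L' \<in> Ls. L \<subseteq> L' \<and> rank L' = q}"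
proof -
  have "cp L q (comparison \<alpha> L) = finprod (add_grp L) (\<lambda>L'. cp L q (mp L' L (\<alpha> L'))) (larger L)"
    using hom_finprod[OF comm_add[OF L] comm_add[OF L] cp_hom[OF L] comparison_terms[OF \<alpha> L]] L
    by (simp add: comparison_def)
  also have "\<dots> = finprod (add_grp L) (\<lambda>L'. mp L' L (\<alpha> L')) {L' \<in> Ls. L \<subseteq> L' \<and> rank L' = q}"
  proof (rule comm_monoid.finprod_mono_neutral_cong_right[OF cmon[OF L]])
    have g: "mp L' L (\<alpha> L') \<in> gr L (rank L')" if "L' \<in> larger L" for L'
      using that L by (auto intro!: mp_gr alg_A_comp[OF \<alpha>])
    show "(\<lambda>L'. cp L q (mp L' L (\<alpha> L'))) \<in> larger L \<rightarrow> carrier (add_grp L)"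
      using g L by (auto intro!: gr_carrier[OF L cp_gr] intro: gr_carrier)
    show "cp L q (mp L' L (\<alpha> L')) = \<one>\<^bsub>add_grp L\<^esub>" if "L' \<in> larger L - {L' \<in> Ls. L \<subseteq> L' \<and> rank L' = q}" for L'
      using cp_other[OF L g[of L']] that by auto
    show "cp L q (mp L' L (\<alpha> L')) = mp L' L (\<alpha> L')" if "L' \<in> {L' \<in> Ls. L \<subseteq> L' \<and> rank L' = q}" for L'
      using cp_same[OF L] g[of L'] that by auto
  qed (use fin in auto)
  finally show ?thesis .
qed

lemma same_rank_above: "L \<in> Ls \<Longrightarrow> {L' \<in> Ls. L \<subseteq> L' \<and> rank L' = rank L} = {L}"
  using rank_eq by fastforce

text \<open>\<open>L\<close> is the only layer of its own rank containing it, and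
  \<open>mp L L\<close> is the identity. So taking top components is a left inverse of
  \<open>comparison\<close>.\<close>

lemma top_component_comparison:
  assumes \<alpha>: "\<alpha> \<in> carrier alg_A" and L: "L \<in> Ls"
  shows "cp L (rank L) (comparison \<alpha> L) = \<alpha> L"
proof -
  have "\<alpha> L \<in> carrier (rg L)" using gr_carrier alg_A_comp \<alpha> L by blast
  then show ?thesis
    using comm_monoid.finprod_insert[OF cmon[OF L], of "{}" L "\<lambda>L'. mp L' L (\<alpha> L')"]
      monoid.r_one[OF comm_monoid.axioms(1)[OF cmon[OF L]], of "\<alpha> L"]
      comm_monoid.finprod_empty[OF cmon[OF L], of "\<lambda>L'. mp L' L (\<alpha> L')"]
    by (simp add: component_comparison[OF \<alpha> L] same_rank_above[OF L] mp_ident[OF L])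
qed

text \<open>Each \<open>\<alpha> L'\<close> is the top component of
  \<open>comparison \<alpha>\<close> at \<open>L'\<close>; inserting this into
  \<open>component_comparison\<close> gives precisely the coherence condition.\<close>

lemma comparison_coherent:
  assumes \<alpha>: "\<alpha> \<in> carrier alg_A"
  shows "is_coherent (comparison \<alpha>)"
  unfolding is_coherent_def finsum_def
proof (intro allI ballI impI)
  fix q L assume L: "L \<in> Ls" "q < rank L"
  show "finprod (add_grp L) (\<lambda>L'. mp L' L (cp L' q (comparison \<alpha> L'))) {L' \<in> Ls. L \<subseteq> L' \<and> rank L' = q} =
     cp L q (comparison \<alpha> L)"
    unfolding component_comparison[OF \<alpha> L(1)]
    by (rule comm_monoid.finprod_cong'[OF cmon[OF L(1)] refl])
       (use top_component_comparison[OF \<alpha>] comparison_terms[OF \<alpha> L(1)] in auto)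
qed

lemma comparison_in_alg_B: "\<alpha> \<in> carrier alg_A \<Longrightarrow> comparison \<alpha> \<in> carrier alg_B"
  using comparison_closed comparison_coherent by (auto simp: carrier_alg_B) (simp add: comparison_def)

lemma comparison_inj: "inj_on comparison (carrier alg_A)"
proof (rule inj_onI)
  fix \<alpha> \<beta> assume *: "\<alpha> \<in> carrier alg_A" "\<beta> \<in> carrier alg_A" "comparison \<alpha> = comparison \<beta>"
  then have "\<alpha> L = \<beta> L" if "L \<in> Ls" for L
    using top_component_comparison that by metis
  then show "\<alpha> = \<beta>"
    using * by (intro PiE_ext[of \<alpha> Ls _ \<beta>]) (auto simp: carrier_alg_A)
qed

text \<open>The preimage consists of the parts of degree \<open>rank L\<close>. Both sides then
  agree in every degree: below the rank by coherence, at the rank by the left inverse property,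
  above it because all parts vanish.\<close>

lemma comparison_surj:
  assumes \<beta>: "\<beta> \<in> carrier alg_B"
  shows "\<beta> \<in> comparison ` carrier alg_A"
proof
  let ?\<alpha> = "\<lambda>L\<in>Ls. cp L (rank L) (\<beta> L)"
  have \<beta>c: "\<beta> L \<in> carrier (rg L)" if "L \<in> Ls" for L using \<beta> that by (auto simp: carrier_alg_B)
  show \<alpha>: "?\<alpha> \<in> carrier alg_A" using \<beta>c cp_gr by (auto simp: carrier_alg_A)
  show "\<beta> = comparison ?\<alpha>"
  proof (rule PiE_ext)
    show "\<beta> \<in> (\<Pi>\<^sub>E L\<in>Ls. carrier (rg L))" "comparison ?\<alpha> \<in> (\<Pi>\<^sub>E L\<in>Ls. carrier (rg L))"
      using \<beta> comparison_in_alg_B[OF \<alpha>] by (auto simp: carrier_alg_B)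
    fix L assume L: "L \<in> Ls"
    show "\<beta> L = comparison ?\<alpha> L"
    proof (rule tensor_pair.second_degree_component_eqI[OF pair[OF L]])
      fix q
      consider "q < rank L" | "q = rank L" | "rank L < q" by linarith
      then show "cp L q (\<beta> L) = cp L q (comparison ?\<alpha> L)"
      proof cases
        case 1
        have "cp L q (\<beta> L) = finprod (add_grp L) (\<lambda>L'. mp L' L (cp L' q (\<beta> L'))) {L' \<in> Ls. L \<subseteq> L' \<and> rank L' = q}"
          using \<beta> 1 L by (simp add: carrier_alg_B is_coherent_def finsum_def)
        also have "\<dots> = cp L q (comparison ?\<alpha> L)"
          unfolding component_comparison[OF \<alpha> L]
          by (rule comm_monoid.finprod_cong'[OF cmon[OF L] refl])
             (use comparison_terms[OF \<alpha> L] in auto)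
        finally show ?thesis .
      next
        case 2
        then show ?thesis using top_component_comparison[OF \<alpha> L] L by simp
      next
        case 3
        have "cp L q x = \<zero>\<^bsub>rg L\<^esub>" if "x \<in> carrier (rg L)" for x
          by (rule gr_vanish[OF L 3 cp_gr[OF L that]])
        then show ?thesis using \<beta>c[OF L] comparison_closed[OF \<alpha> L] by simp
      qed
    qed
  qed
qed

section \<open>Compatibility of the comparison map with the ring operations\<close>

lemma comparison_add:
  assumes \<alpha>: "\<alpha> \<in> carrier alg_A" and \<beta>: "\<beta> \<in> carrier alg_A"
  shows "comparison (\<alpha> \<oplus>\<^bsub>alg_A\<^esub> \<beta>) = comparison \<alpha> \<oplus>\<^bsub>alg_B\<^esub> comparison \<beta>"
proof
  fix L
  show "comparison (\<alpha> \<oplus>\<^bsub>alg_A\<^esub> \<beta>) L = (comparison \<alpha> \<oplus>\<^bsub>alg_B\<^esub> comparison \<beta>) L"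
  proof (cases "L \<in> Ls")
    case L: True
    have "comparison (\<alpha> \<oplus>\<^bsub>alg_A\<^esub> \<beta>) L =
        finprod (add_grp L) (\<lambda>L'. mp L' L (\<alpha> L') \<otimes>\<^bsub>add_grp L\<^esub> mp L' L (\<beta> L')) (larger L)"
      using L unfolding comparison_def restrict_apply'[OF L]
    proof (intro comm_monoid.finprod_cong'[OF cmon[OF L] refl])
      show "(\<lambda>L'. mp L' L (\<alpha> L') \<otimes>\<^bsub>add_grp L\<^esub> mp L' L (\<beta> L')) \<in> larger L \<rightarrow> carrier (add_grp L)"
        using comparison_terms[OF \<alpha> L] comparison_terms[OF \<beta> L]
          monoid.m_closed[OF comm_monoid.axioms(1)[OF cmon[OF L]]] by (auto simp: Pi_iff)
      fix L' assume L': "L' \<in> larger L"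
      then have "\<alpha> L' \<in> carrier (add_grp L')" "\<beta> L' \<in> carrier (add_grp L')"
        using \<alpha> \<beta> by (auto intro!: gr_carrier alg_A_comp)
      from hom_mult[OF mp_hom this, of L] show "mp L' L ((\<alpha> \<oplus>\<^bsub>alg_A\<^esub> \<beta>) L') = mp L' L (\<alpha> L') \<otimes>\<^bsub>add_grp L\<^esub> mp L' L (\<beta> L')"
        using L' L by (simp add: alg_A_def ring_on_def)
    qed
    also have "\<dots> = comparison \<alpha> L \<otimes>\<^bsub>add_grp L\<^esub> comparison \<beta> L"
      using comm_monoid.finprod_multf[OF cmon[OF L] comparison_terms[OF \<alpha> L] comparison_terms[OF \<beta> L]] L
      by (simp add: comparison_def)
    finally show ?thesis using L by (simp add: alg_B_def Let_def direct_sum_ring_def ring_on_def)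
  qed (simp add: comparison_def alg_B_def Let_def direct_sum_ring_def ring_on_def)
qed

text \<open>Every layer lies in \<open>T\<close>, so the sum at each layer contains the image of the
  unit at \<open>T\<close>, and all its other terms are zero.\<close>

lemma comparison_one: "comparison \<one>\<^bsub>alg_A\<^esub> = \<one>\<^bsub>alg_B\<^esub>"
proof
  fix L
  show "comparison \<one>\<^bsub>alg_A\<^esub> L = \<one>\<^bsub>alg_B\<^esub> L"
  proof (cases "L \<in> Ls")
    case L: True
    have one: "\<one>\<^bsub>rg L\<^esub> \<in> carrier (rg L)"
      by (rule tensor_pair.tensor_ring_one_closed[OF pair[OF L]])
    have "comparison \<one>\<^bsub>alg_A\<^esub> L = finprod (add_grp L) (\<lambda>L'. if L' = T then \<one>\<^bsub>rg L\<^esub> else \<one>\<^bsub>add_grp L\<^esub>) (larger L)"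
      unfolding comparison_def restrict_apply'[OF L]
    proof (intro comm_monoid.finprod_cong'[OF cmon[OF L] refl])
      show "(\<lambda>L'. if L' = T then \<one>\<^bsub>rg L\<^esub> else \<one>\<^bsub>add_grp L\<^esub>) \<in> larger L \<rightarrow> carrier (add_grp L)"
        using one monoid.one_closed[OF comm_monoid.axioms(1)[OF cmon[OF L]]] by auto
      fix L' assume "L' \<in> larger L"
      then show "mp L' L (\<one>\<^bsub>alg_A\<^esub> L') = (if L' = T then \<one>\<^bsub>rg L\<^esub> else \<one>\<^bsub>add_grp L\<^esub>)"
        using L mp_zero tensor_pair_map.tensor_ring_map_one[OF pair_map[OF L]]
        by (auto simp: alg_A_def ring_on_def)
    qed
    also have "\<dots> = \<one>\<^bsub>rg L\<^esub>"
      using comm_monoid.finprod_singleton_swap[OF cmon[OF L], of T "larger L" "\<lambda>_. \<one>\<^bsub>rg L\<^esub>"] top L one fin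
      by simp
    finally show ?thesis using L by (simp add: alg_B_def Let_def direct_sum_ring_def ring_on_def)
  qed (simp add: comparison_def alg_B_def Let_def direct_sum_ring_def ring_on_def)
qed

text \<open>
  The product of the images of \<open>\<alpha>\<^sub>L\<^sub>1\<close> and \<open>\<alpha>'\<^sub>L\<^sub>2\<close> in the ring of \<open>L\<close> is either hit by exactly one layer
  between \<open>L\<close> and \<open>L1 \<inter> L2\<close>, or it vanishes for degree reasons on the component of \<open>L1 \<inter> L2\<close> around \<open>L\<close>.
\<close>

lemma comparison_mult:
  assumes \<alpha>: "\<alpha> \<in> carrier alg_A" and \<alpha>': "\<alpha>' \<in> carrier alg_A"
  shows "comparison (\<alpha> \<otimes>\<^bsub>alg_A\<^esub> \<alpha>') = comparison \<alpha> \<otimes>\<^bsub>alg_B\<^esub> comparison \<alpha>'"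
proof
  fix L
  show "comparison (\<alpha> \<otimes>\<^bsub>alg_A\<^esub> \<alpha>') L = (comparison \<alpha> \<otimes>\<^bsub>alg_B\<^esub> comparison \<alpha>') L"
  proof (cases "L \<in> Ls")
    case L: True
    interpret G: comm_monoid "add_grp L" by (rule cmon[OF L])
    define t where "t = (\<lambda>(L1, L2). mp L1 L (\<alpha> L1) \<otimes>\<^bsub>rg L\<^esub> mp L2 L (\<alpha>' L2))"
    define P where "P = (\<lambda>M. {(L1, L2). L1 \<in> Ls \<and> L2 \<in> Ls \<and> M \<subseteq> L1 \<inter> L2 \<and> rank M = rank L1 + rank L2})"
    let ?J = "larger L \<times> larger L"
    have fJ: "finite ?J" "finite (larger L)" using fin by auto
    have \<alpha>c: "\<alpha> M \<in> carrier (rg M)" "\<alpha>' M \<in> carrier (rg M)" if "M \<in> Ls" for M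
      using that \<alpha> \<alpha>' gr_carrier alg_A_comp by blast+
    have tc: "t j \<in> carrier (add_grp L)" if "j \<in> ?J" for j
      using that L \<alpha>c by (auto simp: t_def intro!: mult_closed mp_closed)
    have PJ: "P M \<subseteq> ?J" if "M \<in> larger L" for M using that by (auto simp: P_def)
    have one: "\<one>\<^bsub>add_grp L\<^esub> \<in> carrier (add_grp L)" by (rule G.one_closed)
    \<comment> \<open>The sum over \<open>P M\<close> is padded with zeros to a sum over all of
      \<open>?J\<close>, an index set independent of \<open>M\<close>. This allows the sums over
      layers and over pairs to be exchanged.\<close>
    have 1: "comparison (\<alpha> \<otimes>\<^bsub>alg_A\<^esub> \<alpha>') L =
        finprod (add_grp L) (\<lambda>M. finprod (add_grp L) (\<lambda>j. if j \<in> P M then t j else \<one>\<^bsub>add_grp L\<^esub>) ?J) (larger L)"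
      unfolding comparison_def restrict_apply'[OF L]
    proof (rule G.finprod_cong'[OF refl])
      show "(\<lambda>M. finprod (add_grp L) (\<lambda>j. if j \<in> P M then t j else \<one>\<^bsub>add_grp L\<^esub>) ?J) \<in> larger L \<rightarrow> carrier (add_grp L)"
        using tc one by (intro Pi_I G.finprod_closed) auto
      fix M assume M: "M \<in> larger L"
      then have MLs: "M \<in> Ls" "L \<subseteq> M" by auto
      let ?u = "\<lambda>(L1, L2). mp L1 M (\<alpha> L1) \<otimes>\<^bsub>rg M\<^esub> mp L2 M (\<alpha>' L2)"
      have u: "?u \<in> P M \<rightarrow> carrier (add_grp M)"
        using MLs \<alpha>c by (auto simp: P_def intro!: mult_closed mp_closed)
      have "(\<alpha> \<otimes>\<^bsub>alg_A\<^esub> \<alpha>') M = finprod (add_grp M) ?u (P M)"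
        using MLs by (simp add: alg_A_def ring_on_def finsum_def P_def)
      then have "mp M L ((\<alpha> \<otimes>\<^bsub>alg_A\<^esub> \<alpha>') M) = finprod (add_grp L) (\<lambda>j. mp M L (?u j)) (P M)"
        using hom_finprod[OF comm_add[OF MLs(1)] comm_add[OF L] mp_hom[OF L MLs] u] by simp
      also have "\<dots> = finprod (add_grp L) (\<lambda>j. if j \<in> P M then t j else \<one>\<^bsub>add_grp L\<^esub>) ?J"
      proof (rule G.finprod_mono_neutral_cong_left[OF fJ(1) PJ[OF M]])
        fix j assume "j \<in> P M"
        then obtain L1 L2 where j: "j = (L1, L2)" "L1 \<in> Ls" "L2 \<in> Ls" "M \<subseteq> L1" "M \<subseteq> L2" "(L1, L2) \<in> P M"
          by (auto simp: P_def)
        have "mp M L (mp L1 M (\<alpha> L1) \<otimes>\<^bsub>rg M\<^esub> mp L2 M (\<alpha>' L2)) =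
            mp M L (mp L1 M (\<alpha> L1)) \<otimes>\<^bsub>rg L\<^esub> mp M L (mp L2 M (\<alpha>' L2))"
          by (intro mp_mult[OF L MLs] mp_closed MLs j \<alpha>c)
        also have "\<dots> = t j"
          using j MLs L \<alpha>c by (simp add: t_def mp_comp)
        finally show "mp M L (?u j) = (if j \<in> P M then t j else \<one>\<^bsub>add_grp L\<^esub>)" using j by simp
      qed (use tc one in auto)
      finally show "mp M L ((\<alpha> \<otimes>\<^bsub>alg_A\<^esub> \<alpha>') M) =
          finprod (add_grp L) (\<lambda>j. if j \<in> P M then t j else \<one>\<^bsub>add_grp L\<^esub>) ?J" .
    qed
    have 2: "\<dots> = finprod (add_grp L) (\<lambda>j. finprod (add_grp L) (\<lambda>M. if j \<in> P M then t j else \<one>\<^bsub>add_grp L\<^esub>) (larger L)) ?J"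
      using tc one by (intro G.finprod_swap fJ) auto
    have 3: "\<dots> = finprod (add_grp L) t ?J"
    proof (rule G.finprod_cong'[OF refl])
      fix j assume jJ: "j \<in> ?J"
      then obtain L1 L2 where j: "j = (L1, L2)" "L1 \<in> Ls" "L2 \<in> Ls" "L \<subseteq> L1" "L \<subseteq> L2" by auto
      obtain L0 where L0: "L0 \<in> Ls" "L \<subseteq> L0" "L0 \<subseteq> L1" "L0 \<subseteq> L2" "rank L0 \<le> rank L1 + rank L2"
        and max: "\<And>M. M \<in> Ls \<Longrightarrow> L \<subseteq> M \<Longrightarrow> M \<subseteq> L1 \<inter> L2 \<Longrightarrow> M \<subseteq> L0"
        using meet[OF L j(2-5)] by auto
      show "finprod (add_grp L) (\<lambda>M. if j \<in> P M then t j else \<one>\<^bsub>add_grp L\<^esub>) (larger L) = t j"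
      proof (cases "rank L0 = rank L1 + rank L2")
        case True
        \<comment> \<open>Any admissible \<open>M\<close> lies inside \<open>L0\<close> by
          maximality, and membership in \<open>P M\<close> gives it the rank of \<open>L0\<close>;
          nested layers of equal rank coincide.\<close>
        have "j \<in> P M \<longleftrightarrow> L0 = M" if "M \<in> larger L" for M
          using that True j L0 max[of M] rank_eq[of M L0] by (auto simp: P_def)
        then have "finprod (add_grp L) (\<lambda>M. if j \<in> P M then t j else \<one>\<^bsub>add_grp L\<^esub>) (larger L) =
            finprod (add_grp L) (\<lambda>M. if L0 = M then t j else \<one>\<^bsub>add_grp L\<^esub>) (larger L)"
          using tc[OF jJ] one by (intro G.finprod_cong'[OF refl]) auto
        also have "\<dots> = t j"
          using G.finprod_singleton[of L0 "larger L" "\<lambda>_. t j"] L0 fJ tc[OF jJ] by simp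
        finally show ?thesis .
      next
        case False
        let ?v = "mp L1 L0 (\<alpha> L1) \<otimes>\<^bsub>rg L0\<^esub> mp L2 L0 (\<alpha>' L2)"
        have "?v \<in> gr L0 (rank L1 + rank L2)"
          by (intro tensor_pair.second_degree_part_mult[OF pair[OF L0(1)]] mp_gr L0 j alg_A_comp \<alpha> \<alpha>')
        then have v: "?v = \<zero>\<^bsub>rg L0\<^esub>" using False L0 by (intro gr_vanish[of L0]) auto
        have "t j = mp L0 L (mp L1 L0 (\<alpha> L1)) \<otimes>\<^bsub>rg L\<^esub> mp L0 L (mp L2 L0 (\<alpha>' L2))"
          using j L0 L \<alpha>c by (simp add: t_def mp_comp)
        also have "\<dots> = mp L0 L ?v"
          by (intro mp_mult[symmetric] mp_closed L L0 j \<alpha>c)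
        also have "\<dots> = \<one>\<^bsub>add_grp L\<^esub>" unfolding v using mp_zero[OF L L0(1,2)] by simp
        finally have tj: "t j = \<one>\<^bsub>add_grp L\<^esub>" .
        show ?thesis unfolding tj by (rule G.finprod_one_eqI) (simp only: if_cancel)
      qed
    qed (use tc in auto)
    have ca: "(\<lambda>M. mp M L (\<alpha> M)) \<in> larger L \<rightarrow> carrier (add_grp L)" "(\<lambda>M. mp M L (\<alpha>' M)) \<in> larger L \<rightarrow> carrier (add_grp L)"
      by (intro comparison_terms \<alpha> \<alpha>' L)+
    have "comparison \<alpha> L \<otimes>\<^bsub>rg L\<^esub> comparison \<alpha>' L =
        finprod (add_grp L) (\<lambda>L1. mp L1 L (\<alpha> L1) \<otimes>\<^bsub>rg L\<^esub> comparison \<alpha>' L) (larger L)"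
      using hom_finprod[OF comm_add[OF L] comm_add[OF L] mult_hom(1)[OF L comparison_closed[OF \<alpha>' L]] ca(1)] L
      by (simp add: comparison_def[of \<alpha>])
    also have "\<dots> = finprod (add_grp L) (\<lambda>L1. finprod (add_grp L) (\<lambda>L2. t (L1, L2)) (larger L)) (larger L)"
    proof (rule G.finprod_cong'[OF refl])
      show "(\<lambda>L1. finprod (add_grp L) (\<lambda>L2. t (L1, L2)) (larger L)) \<in> larger L \<rightarrow> carrier (add_grp L)"
        using tc by (intro Pi_I G.finprod_closed) auto
      fix L1 assume "L1 \<in> larger L"
      then have "mp L1 L (\<alpha> L1) \<in> carrier (rg L)" using ca(1) by auto
      from hom_finprod[OF comm_add[OF L] comm_add[OF L] mult_hom(2)[OF L this] ca(2)] L
      show "mp L1 L (\<alpha> L1) \<otimes>\<^bsub>rg L\<^esub> comparison \<alpha>' L = finprod (add_grp L) (\<lambda>L2. t (L1, L2)) (larger L)"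
        by (simp add: comparison_def t_def)
    qed
    also have "\<dots> = finprod (add_grp L) t ?J"
      using G.finprod_cartesian_product[of "larger L" "larger L" "\<lambda>a b. t (a, b)"] fJ tc by simp
    finally have "comparison (\<alpha> \<otimes>\<^bsub>alg_A\<^esub> \<alpha>') L = comparison \<alpha> L \<otimes>\<^bsub>rg L\<^esub> comparison \<alpha>' L"
      using 1 2 3 by simp
    then show ?thesis using L by (simp add: alg_B_def Let_def direct_sum_ring_def ring_on_def)
  qed (simp add: comparison_def alg_B_def Let_def direct_sum_ring_def ring_on_def)
qed

theorem alg_A_iso_alg_B: "alg_A \<simeq> alg_B"
proof -
  have "comparison \<in> ring_iso alg_A alg_B"
  proof (rule ring_iso_memI)
    show "bij_betw comparison (carrier alg_A) (carrier alg_B)"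
      using comparison_inj comparison_in_alg_B comparison_surj by (auto simp: bij_betw_def)
  qed (auto intro: comparison_in_alg_B comparison_mult comparison_add comparison_one)
  then show ?thesis by (auto simp: is_ring_iso_def)
qed

end

section \<open>Vanishing of singular cohomology\<close>

text \<open>The linear extension of a cochain to chains. Integers are modelled as the free abelian
  group on one point, so that \<open>frag_extend\<close> does the extension; the value is read off
  as the coefficient of \<open>()\<close>.\<close>

definition cochain_eval :: "'a cochain \<Rightarrow> 'a chain \<Rightarrow> int" where
  "cochain_eval \<phi> c = Poly_Mapping.lookup (frag_extend (\<lambda>\<sigma>. frag_cmul (\<phi> \<sigma>) (frag_of ())) c) ()"

lemma cochain_eval_0 [simp]: "cochain_eval \<phi> 0 = 0"
  and cochain_eval_of [simp]: "cochain_eval \<phi> (frag_of \<sigma>) = \<phi> \<sigma>"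
  and cochain_eval_add: "cochain_eval \<phi> (a + b) = cochain_eval \<phi> a + cochain_eval \<phi> b"
  and cochain_eval_diff: "cochain_eval \<phi> (a - b) = cochain_eval \<phi> a - cochain_eval \<phi> b"
  and cochain_eval_cmul: "cochain_eval \<phi> (frag_cmul k a) = k * cochain_eval \<phi> a"
  by (simp_all add: cochain_eval_def frag_extend_add frag_extend_diff frag_extend_minus
      frag_extend_cmul lookup_add lookup_minus)

lemma cochain_eval_sum:
  "finite I \<Longrightarrow> cochain_eval \<phi> (sum f I) = (\<Sum>i\<in>I. cochain_eval \<phi> (f i))"
  by (induction I rule: finite_induct) (auto simp: cochain_eval_add)

lemma cochain_eval_cong:
  assumes "Poly_Mapping.keys c \<subseteq> S" "\<And>\<sigma>. \<sigma> \<in> S \<Longrightarrow> \<phi> \<sigma> = \<psi> \<sigma>"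
  shows "cochain_eval \<phi> c = cochain_eval \<psi> c"
  using assms(1)
  by (induction rule: frag_induction) (auto simp: cochain_eval_diff assms(2))

lemma cochain_eval_eq_0:
  assumes "Poly_Mapping.keys c \<subseteq> S" "\<And>\<sigma>. \<sigma> \<in> S \<Longrightarrow> \<phi> \<sigma> = 0"
  shows "cochain_eval \<phi> c = 0"
  using assms(1)
  by (induction rule: frag_induction) (auto simp: cochain_eval_diff assms(2))

lemma cochain_eval_frag_extend:
  "cochain_eval \<phi> (frag_extend D c) = cochain_eval (\<lambda>\<tau>. cochain_eval \<phi> (D \<tau>)) c"
  using subset_UNIV
  by (induction c rule: frag_induction) (auto simp: cochain_eval_diff frag_extend_diff)

lemma carrier_cochain_group:
  "carrier (cochain_group p X) = extensional (singular_simplex_set p X)"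
  by (simp add: cochain_group_def PiE_def)

lemma one_cochain_group: "\<one>\<^bsub>cochain_group p X\<^esub> = (\<lambda>\<sigma>\<in>singular_simplex_set p X. 0)"
  by (simp add: cochain_group_def)

lemma coboundary_eq_eval:
  assumes "singular_simplex (Suc p) X \<sigma>"
  shows "coboundary p X \<phi> \<sigma> = cochain_eval \<phi> (chain_boundary (Suc p) (frag_of \<sigma>))"
  using assms by (simp add: coboundary_def chain_boundary_of cochain_eval_sum cochain_eval_cmul
      cochain_eval_add del: sum.atMost_Suc)

lemma eval_coboundary:
  assumes "singular_chain (Suc p) X c"
  shows "cochain_eval (coboundary p X \<phi>) c = cochain_eval \<phi> (chain_boundary (Suc p) c)"
  using assms unfolding singular_chain_def
  by (induction rule: frag_induction)
     (auto simp: cochain_eval_diff chain_boundary_diff coboundary_eq_eval)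

lemma coboundary_extensional: "coboundary p X \<phi> \<in> extensional (singular_simplex_set (Suc p) X)"
  by (simp add: coboundary_def)

section \<open>Cocycles and coboundaries as functionals on chains\<close>

lemma cocycles_iff:
  "\<phi> \<in> cocycles p X \<longleftrightarrow> \<phi> \<in> extensional (singular_simplex_set p X) \<and>
     (\<forall>c. singular_chain (Suc p) X c \<longrightarrow> cochain_eval \<phi> (chain_boundary (Suc p) c) = 0)"
proof -
  have "coboundary p X \<phi> = (\<lambda>\<sigma>\<in>singular_simplex_set (Suc p) X. 0) \<longleftrightarrow>
     (\<forall>c. singular_chain (Suc p) X c \<longrightarrow> cochain_eval \<phi> (chain_boundary (Suc p) c) = 0)"
    (is "?l \<longleftrightarrow> ?r")
  proof
    assume ?l
    then show ?r
      by (metis (no_types, lifting) cochain_eval_eq_0 eval_coboundary restrict_apply' singular_chain_def)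
  next
    assume ?r
    then show ?l
      by (intro extensionalityI[OF coboundary_extensional])
         (auto simp: coboundary_eq_eval singular_chain_of)
  qed
  then show ?thesis
    by (simp add: cocycles_def kernel_def carrier_cochain_group one_cochain_group)
qed

text \<open>The primitive may be an arbitrary function: boundaries of simplices of \<open>X\<close>
  involve only simplices of \<open>X\<close>, so restricting it gives a genuine cochain with the
  same coboundary.\<close>

lemma coboundaries_Suc_iff:
  "\<phi> \<in> coboundaries (Suc p) X \<longleftrightarrow> \<phi> \<in> extensional (singular_simplex_set (Suc p) X) \<and>
     (\<exists>e. \<forall>\<sigma>. singular_simplex (Suc p) X \<sigma> \<longrightarrow>
        \<phi> \<sigma> = cochain_eval e (chain_boundary (Suc p) (frag_of \<sigma>)))" (is "?l \<longleftrightarrow> ?r")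
proof
  assume ?l
  then show ?r
    by (auto simp: coboundaries_def coboundary_extensional coboundary_eq_eval)
next
  assume ?r
  then obtain e where e: "\<phi> \<in> extensional (singular_simplex_set (Suc p) X)"
    "\<And>\<sigma>. singular_simplex (Suc p) X \<sigma> \<Longrightarrow>
        \<phi> \<sigma> = cochain_eval e (chain_boundary (Suc p) (frag_of \<sigma>))" by blast
  have "cochain_eval e (chain_boundary (Suc p) (frag_of \<sigma>)) =
        cochain_eval (restrict e (singular_simplex_set p X)) (chain_boundary (Suc p) (frag_of \<sigma>))"
    if "singular_simplex (Suc p) X \<sigma>" for \<sigma>
    by (rule cochain_eval_cong[where S = "singular_simplex_set p X"])
       (use singular_chain_boundary_alt[of p X "frag_of \<sigma>"] that in
         \<open>auto simp: singular_chain_def\<close>)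
  then have "\<phi> = coboundary p X (restrict e (singular_simplex_set p X))"
    by (intro extensionalityI[OF e(1) coboundary_extensional]) (auto simp: e(2) coboundary_eq_eval)
  then show ?l
    by (auto simp: coboundaries_def carrier_cochain_group)
qed

text \<open>In degree 0 this is the vanishing of unreduced cohomology, which forces the space to be
  empty. That degenerate case starts the Mayer-Vietoris arguments with disjoint open sets.\<close>

definition acyclic_at :: "nat \<Rightarrow> 'a topology \<Rightarrow> bool" where
  "acyclic_at q X \<longleftrightarrow> cocycles q X \<subseteq> coboundaries q X"

text \<open>Arbitrary functions replace extensional cochains here, so that primitives found on
  different subspaces can be added and compared without restricting them first.\<close>

lemma acyclic_atD:
  assumes "acyclic_at (Suc p) X"
    and "\<And>c. singular_chain (Suc (Suc p)) X c \<Longrightarrow> cochain_eval \<phi> (chain_boundary (Suc (Suc p)) c) = 0"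
  obtains e where "\<And>c. singular_chain (Suc p) X c \<Longrightarrow>
      cochain_eval \<phi> c = cochain_eval e (chain_boundary (Suc p) c)"
proof -
  let ?S = "singular_simplex_set (Suc p) X"
  have eq: "cochain_eval (restrict \<phi> ?S) c = cochain_eval \<phi> c" if "singular_chain (Suc p) X c" for c
    by (rule cochain_eval_cong[where S = ?S]) (use that in \<open>auto simp: singular_chain_def\<close>)
  have "restrict \<phi> ?S \<in> cocycles (Suc p) X"
    using assms(2) by (auto simp: cocycles_iff eq singular_chain_boundary_alt)
  then have "restrict \<phi> ?S \<in> coboundaries (Suc p) X"
    using assms(1) by (auto simp: acyclic_at_def)
  then obtain e where e: "\<And>\<sigma>. singular_simplex (Suc p) X \<sigma> \<Longrightarrow>
        \<phi> \<sigma> = cochain_eval e (chain_boundary (Suc p) (frag_of \<sigma>))"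
    by (auto simp: coboundaries_Suc_iff)
  have "cochain_eval \<phi> c = cochain_eval e (chain_boundary (Suc p) c)"
    if "singular_chain (Suc p) X c" for c
    using that unfolding singular_chain_def
    by (induction rule: frag_induction) (auto simp: e cochain_eval_diff chain_boundary_diff)
  then show ?thesis by (rule that)
qed

lemma acyclic_at_SucI:
  assumes "\<And>\<phi>. (\<And>c. singular_chain (Suc (Suc p)) X c \<Longrightarrow>
      cochain_eval \<phi> (chain_boundary (Suc (Suc p)) c) = 0) \<Longrightarrow>
     \<exists>e. \<forall>\<sigma>. singular_simplex (Suc p) X \<sigma> \<longrightarrow>
        \<phi> \<sigma> = cochain_eval e (chain_boundary (Suc p) (frag_of \<sigma>))"
  shows "acyclic_at (Suc p) X"
  using assms by (auto simp: acyclic_at_def cocycles_iff coboundaries_Suc_iff)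

lemma acyclic_at_empty:
  assumes "topspace X = {}"
  shows "acyclic_at q X"
proof -
  have S: "singular_simplex_set p X = {}" for p
    using assms by (simp add: singular_simplex_empty)
  show ?thesis
  proof (cases q)
    case 0
    have "\<phi> = (\<lambda>\<sigma>\<in>singular_simplex_set 0 X. 0)" if "\<phi> \<in> cocycles 0 X" for \<phi>
      by (rule extensionalityI[where A = "singular_simplex_set 0 X"])
         (use that in \<open>simp add: cocycles_iff\<close>, simp, use S[of 0] in blast)
    with 0 show ?thesis
      by (auto simp: acyclic_at_def coboundaries_def one_cochain_group)
  next
    case (Suc p)
    then show ?thesis
      using assms by (simp add: acyclic_at_SucI singular_simplex_empty)
  qed
qed

subsection \<open>Small simplices\<close>

definition small_simplex :: "nat \<Rightarrow> 'a topology \<Rightarrow> 'a set set \<Rightarrow> ((nat \<Rightarrow> real) \<Rightarrow> 'a) \<Rightarrow> bool" where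
  "small_simplex p X \<C> \<sigma> \<longleftrightarrow> (\<exists>V\<in>\<C>. singular_simplex p (subtopology X V) \<sigma>)"

definition small_chain :: "nat \<Rightarrow> 'a topology \<Rightarrow> 'a set set \<Rightarrow> 'a chain \<Rightarrow> bool" where
  "small_chain p X \<C> c \<longleftrightarrow> Poly_Mapping.keys c \<subseteq> Collect (small_simplex p X \<C>)"

lemma small_chain_0 [simp]: "small_chain p X \<C> 0"
  by (simp add: small_chain_def)

lemma small_chain_of [simp]: "small_chain p X \<C> (frag_of \<sigma>) \<longleftrightarrow> small_simplex p X \<C> \<sigma>"
  by (simp add: small_chain_def)

lemma small_chain_diff:
  "small_chain p X \<C> a \<Longrightarrow> small_chain p X \<C> b \<Longrightarrow> small_chain p X \<C> (a - b)"
  unfolding small_chain_def using keys_diff[of a b] by blast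

lemma small_chain_subtopology:
  "V \<in> \<C> \<Longrightarrow> singular_chain p (subtopology X V) c \<Longrightarrow> small_chain p X \<C> c"
  unfolding small_chain_def singular_chain_def small_simplex_def by blast

lemma small_chain_boundary:
  assumes "small_chain p X \<C> c"
  shows "small_chain (p - Suc 0) X \<C> (chain_boundary p c)"
  using assms unfolding small_chain_def[of p]
proof (induction rule: frag_induction)
  case (one \<sigma>)
  then obtain V where "V \<in> \<C>" "singular_simplex p (subtopology X V) \<sigma>"
    by (auto simp: small_simplex_def)
  then show ?case
    by (meson singular_chain_boundary singular_chain_of small_chain_subtopology)
qed (auto simp: chain_boundary_diff small_chain_diff)

text \<open>Iterated barycentric subdivision makes \<open>c\<close> small, at the cost of the
  boundary of \<open>h p c\<close> and of \<open>h\<close> applied to the boundary of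
  \<open>c\<close>. Since \<open>h\<close> is chosen for all spaces at once, it maps chains inside a
  member of the cover to chains inside that member, so the last term is small as well.\<close>

lemma chain_with_small_boundary:
  assumes \<C>: "\<And>U. U \<in> \<C> \<Longrightarrow> openin X U" and X: "topspace X \<subseteq> \<Union>\<C>"
    and c: "singular_chain p X c" and small: "small_chain (p - Suc 0) X \<C> (chain_boundary p c)"
  obtains y where "singular_chain (Suc p) X y" "small_chain p X \<C> (c - chain_boundary (Suc p) y)"
proof -
  obtain n where n: "\<And>m f. \<lbrakk>n \<le> m; f \<in> Poly_Mapping.keys ((singular_subdivision p ^^ m) c)\<rbrakk>
      \<Longrightarrow> \<exists>V \<in> \<C>. f \<in> (standard_simplex p) \<rightarrow> V"
    using sufficient_iterated_singular_subdivision_exists[OF \<C> X c] by blast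
  obtain h where h: "\<And>p. h p 0 = (0 :: 'a chain)"
    "\<And>p c1 c2. h p (c1-c2) = h p c1 - h p c2"
    "\<And>p X c. singular_chain p X c \<Longrightarrow> singular_chain (Suc p) X (h p c)"
    "\<And>p X c. singular_chain p X c \<Longrightarrow>
      chain_boundary (Suc p) (h p c) + h (p - Suc 0) (chain_boundary p c) = (singular_subdivision p ^^ n) c - c"
    using chain_homotopic_iterated_singular_subdivision[of n] by blast
  have sd: "singular_chain p X ((singular_subdivision p ^^ m) c)" for m
    by (induction m) (auto simp: c singular_chain_singular_subdivision)
  have 1: "small_chain p X \<C> ((singular_subdivision p ^^ n) c)"
    unfolding small_chain_def small_simplex_def
  proof clarify
    fix f assume f: "f \<in> Poly_Mapping.keys ((singular_subdivision p ^^ n) c)"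
    then obtain V where V: "V \<in> \<C>" "f \<in> standard_simplex p \<rightarrow> V"
      using n[OF order_refl f] by blast
    have "singular_simplex p X f" using f sd[of n] by (auto simp: singular_chain_def)
    then show "\<exists>V\<in>\<C>. singular_simplex p (subtopology X V) f"
      using V by (auto simp: singular_simplex_subtopology)
  qed
  have 2: "small_chain p X \<C> (h (p - Suc 0) (chain_boundary p c))"
  proof (cases p)
    case 0
    then show ?thesis by (simp add: chain_boundary_def h)
  next
    case (Suc k)
    have "small_chain (Suc k) X \<C> (h k b)" if "small_chain k X \<C> b" for b
      using that unfolding small_chain_def[of k]
    proof (induction rule: frag_induction)
      case (one \<sigma>)
      then show ?case
        by (auto simp: small_simplex_def singular_chain_of intro!: small_chain_subtopology[OF _ h(3)])
    qed (auto simp: h small_chain_diff)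
    then show ?thesis using small Suc by simp
  qed
  show ?thesis
  proof (rule that)
    show "singular_chain (Suc p) X (- h p c)"
      using h(3)[OF c] by (simp add: singular_chain_minus)
    have "c - chain_boundary (Suc p) (- h p c) =
        (singular_subdivision p ^^ n) c - h (p - Suc 0) (chain_boundary p c)"
      using h(4)[OF c] by (simp add: chain_boundary_minus algebra_simps)
    then show "small_chain p X \<C> (c - chain_boundary (Suc p) (- h p c))"
      using 1 2 by (simp add: small_chain_diff)
  qed
qed

text \<open>A deformation of singular chains into small ones, built degree by degree: on a simplex
  the next map is chosen for the simplex minus \<open>E\<close> of its boundary, whose boundary is
  small by the previous degree. The homotopy identity is recorded only on boundaries, where its term
  with \<open>E\<close> of a double boundary is zero; this is the form the next degree
  consumes.\<close>

lemma small_chain_contraction: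
  assumes \<C>: "\<And>U. U \<in> \<C> \<Longrightarrow> openin X U" and X: "topspace X \<subseteq> \<Union>\<C>"
  shows "\<exists>E. (\<forall>\<tau>. singular_simplex p X \<tau> \<longrightarrow> singular_chain (Suc p) X (E \<tau>)) \<and>
    (\<forall>\<tau>. small_simplex p X \<C> \<tau> \<longrightarrow> E \<tau> = 0) \<and>
    (\<forall>c. singular_chain (Suc p) X c \<longrightarrow> small_chain p X \<C>
       (chain_boundary (Suc p) c - chain_boundary (Suc p) (frag_extend E (chain_boundary (Suc p) c))))"
proof (induction p)
  case 0
  have "\<exists>y. \<not> small_simplex 0 X \<C> \<tau> \<and> singular_simplex 0 X \<tau> \<longrightarrow>
      singular_chain (Suc 0) X y \<and> small_chain 0 X \<C> (frag_of \<tau> - chain_boundary (Suc 0) y)" for \<tau>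
    using chain_with_small_boundary[OF \<C> X, of 0 "frag_of \<tau>"]
    by (metis chain_boundary_def singular_chain_of small_chain_0)
  then obtain E0 where E0: "\<And>\<tau>. \<not> small_simplex 0 X \<C> \<tau> \<Longrightarrow> singular_simplex 0 X \<tau> \<Longrightarrow>
      singular_chain (Suc 0) X (E0 \<tau>) \<and> small_chain 0 X \<C> (frag_of \<tau> - chain_boundary (Suc 0) (E0 \<tau>))"
    by metis
  \<comment> \<open>Zero is a legitimate choice on a small simplex, and it makes the deformation fix
    small chains.\<close>
  define E where "E = (\<lambda>\<tau>. if small_simplex 0 X \<C> \<tau> then 0 else E0 \<tau>)"
  have *: "small_chain 0 X \<C> (c - chain_boundary (Suc 0) (frag_extend E c))"
    if "singular_chain 0 X c" for c
    using that unfolding singular_chain_def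
  proof (induction rule: frag_induction)
    case (diff a b)
    then show ?case
      using small_chain_diff[OF diff] by (simp add: frag_extend_diff chain_boundary_diff algebra_simps)
  qed (auto simp: E_def E0)
  show ?case
  proof (intro exI[of _ E] conjI allI impI)
    fix c assume "singular_chain (Suc 0) X c"
    then show "small_chain 0 X \<C> (chain_boundary (Suc 0) c -
        chain_boundary (Suc 0) (frag_extend E (chain_boundary (Suc 0) c)))"
      by (intro * singular_chain_boundary_alt)
  qed (simp_all add: E_def E0)
next
  case (Suc p)
  then obtain E where E: "\<And>\<tau>. singular_simplex p X \<tau> \<Longrightarrow> singular_chain (Suc p) X (E \<tau>)"
    "\<And>\<tau>. small_simplex p X \<C> \<tau> \<Longrightarrow> E \<tau> = 0"
    "\<And>c. singular_chain (Suc p) X c \<Longrightarrow> small_chain p X \<C>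
       (chain_boundary (Suc p) c - chain_boundary (Suc p) (frag_extend E (chain_boundary (Suc p) c)))"
    by blast
  have Ec: "singular_chain (Suc p) X (frag_extend E c)" if "singular_chain p X c" for c
    using that by (intro singular_chain_extend E) (auto simp: singular_chain_def)
  have E0: "frag_extend E c = 0" if "small_chain p X \<C> c" for c
    using that by (intro frag_extend_eq_0 E) (auto simp: small_chain_def)
  let ?z = "\<lambda>c. c - frag_extend E (chain_boundary (Suc p) c)"
  have "\<exists>y. \<not> small_simplex (Suc p) X \<C> \<tau> \<and> singular_simplex (Suc p) X \<tau> \<longrightarrow>
      singular_chain (Suc (Suc p)) X y \<and>
      small_chain (Suc p) X \<C> (?z (frag_of \<tau>) - chain_boundary (Suc (Suc p)) y)" for \<tau>
  proof (cases "singular_simplex (Suc p) X \<tau>")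
    case True
    then have s: "singular_chain (Suc p) X (frag_of \<tau>)" by (simp add: singular_chain_of)
    show ?thesis
      by (rule chain_with_small_boundary[OF \<C> X, of "Suc p" "?z (frag_of \<tau>)"])
         (use s E(3)[OF s] in \<open>auto simp: chain_boundary_diff singular_chain_diff Ec
           singular_chain_boundary_alt\<close>)
  qed auto
  then obtain F0 where F0: "\<And>\<tau>. \<not> small_simplex (Suc p) X \<C> \<tau> \<Longrightarrow> singular_simplex (Suc p) X \<tau> \<Longrightarrow>
      singular_chain (Suc (Suc p)) X (F0 \<tau>) \<and>
      small_chain (Suc p) X \<C> (?z (frag_of \<tau>) - chain_boundary (Suc (Suc p)) (F0 \<tau>))"
    by metis
  define F where "F = (\<lambda>\<tau>. if small_simplex (Suc p) X \<C> \<tau> then 0 else F0 \<tau>)"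
  have *: "small_chain (Suc p) X \<C> (?z c - chain_boundary (Suc (Suc p)) (frag_extend F c))"
    if "singular_chain (Suc p) X c" for c
    using that unfolding singular_chain_def
  proof (induction rule: frag_induction)
    case (one \<sigma>)
    show ?case
    proof (cases "small_simplex (Suc p) X \<C> \<sigma>")
      case True
      then have "small_chain p X \<C> (chain_boundary (Suc p) (frag_of \<sigma>))"
        using small_chain_boundary[of "Suc p" X \<C> "frag_of \<sigma>"] by simp
      with True show ?thesis by (simp add: F_def E0)
    next
      case False
      then show ?thesis using F0 one by (simp add: F_def)
    qed
  next
    case (diff a b)
    then show ?case
      using small_chain_diff[OF diff] by (simp add: frag_extend_diff chain_boundary_diff algebra_simps)
  qed auto
  show ?case
  proof (intro exI[of _ F] conjI allI impI)
    fix c assume c: "singular_chain (Suc (Suc p)) X c"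
    have "chain_boundary (Suc p) (chain_boundary (Suc (Suc p)) c) = 0"
      using chain_boundary_boundary[OF c] by simp
    then show "small_chain (Suc p) X \<C> (chain_boundary (Suc (Suc p)) c -
        chain_boundary (Suc (Suc p)) (frag_extend F (chain_boundary (Suc (Suc p)) c)))"
      using *[OF singular_chain_boundary_alt[OF c]] by simp
  qed (simp_all add: F_def F0)
qed

text \<open>The cohomology of a space relative to the simplices subordinate to an open cover vanishes.\<close>

lemma cocycle_vanishing_on_small:
  assumes \<C>: "\<And>U. U \<in> \<C> \<Longrightarrow> openin X U" and X: "topspace X \<subseteq> \<Union>\<C>"
    and cyc: "\<And>c. singular_chain (Suc (Suc p)) X c \<Longrightarrow>
      cochain_eval \<phi> (chain_boundary (Suc (Suc p)) c) = 0"
    and small: "\<And>\<sigma>. small_simplex (Suc p) X \<C> \<sigma> \<Longrightarrow> \<phi> \<sigma> = 0"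
  obtains e where "\<And>c. singular_chain (Suc p) X c \<Longrightarrow>
      cochain_eval \<phi> c = cochain_eval e (chain_boundary (Suc p) c)"
    "\<And>\<tau>. small_simplex p X \<C> \<tau> \<Longrightarrow> e \<tau> = 0"
proof -
  obtain E where E: "\<And>\<tau>. singular_simplex p X \<tau> \<Longrightarrow> singular_chain (Suc p) X (E \<tau>)"
    "\<And>\<tau>. small_simplex p X \<C> \<tau> \<Longrightarrow> E \<tau> = 0"
    "\<And>c. singular_chain (Suc p) X c \<Longrightarrow> small_chain p X \<C>
       (chain_boundary (Suc p) c - chain_boundary (Suc p) (frag_extend E (chain_boundary (Suc p) c)))"
    using small_chain_contraction[OF \<C> X, of p] by auto
  show ?thesis
  \<comment> \<open>The primitive evaluates the cocycle on the track of the deformation. The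
    corrected chain \<open>?z\<close> has small boundary, so up to a boundary it is a small chain,
    where \<open>\<phi>\<close> is zero.\<close>
  proof (rule that[of "\<lambda>\<tau>. cochain_eval \<phi> (E \<tau>)"])
    fix c assume c: "singular_chain (Suc p) X c"
    let ?z = "c - frag_extend E (chain_boundary (Suc p) c)"
    have "singular_chain (Suc p) X (frag_extend E (chain_boundary (Suc p) c))"
      using singular_chain_boundary_alt[OF c]
      by (intro singular_chain_extend E) (auto simp: singular_chain_def)
    then have "singular_chain (Suc p) X ?z" by (simp add: c singular_chain_diff)
    then obtain y where y: "singular_chain (Suc (Suc p)) X y"
      "small_chain (Suc p) X \<C> (?z - chain_boundary (Suc (Suc p)) y)"
      using chain_with_small_boundary[OF \<C> X, of "Suc p" ?z] E(3)[OF c]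
      by (auto simp: chain_boundary_diff)
    have "cochain_eval \<phi> (?z - chain_boundary (Suc (Suc p)) y) = 0"
      by (rule cochain_eval_eq_0[OF y(2)[unfolded small_chain_def]]) (simp add: small)
    then have "cochain_eval \<phi> ?z = 0"
      using cyc[OF y(1)] by (simp add: cochain_eval_diff)
    then show "cochain_eval \<phi> c = cochain_eval (\<lambda>\<tau>. cochain_eval \<phi> (E \<tau>)) (chain_boundary (Suc p) c)"
      by (simp add: cochain_eval_diff cochain_eval_frag_extend)
  qed (simp add: E)
qed

subsection \<open>Mayer--Vietoris\<close>

lemma cochain_eval_diff_left:
  "cochain_eval (\<lambda>\<sigma>. \<phi> \<sigma> - \<psi> \<sigma>) c = cochain_eval \<phi> c - cochain_eval \<psi> c"
  using subset_UNIV by (induction c rule: frag_induction) (auto simp: cochain_eval_diff)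

lemma cochain_eval_add_left:
  "cochain_eval (\<lambda>\<sigma>. \<phi> \<sigma> + \<psi> \<sigma>) c = cochain_eval \<phi> c + cochain_eval \<psi> c"
  using subset_UNIV by (induction c rule: frag_induction) (auto simp: cochain_eval_diff)

lemma cochain_eval_boundary:
  "cochain_eval (\<lambda>\<tau>. cochain_eval \<phi> (chain_boundary p (frag_of \<tau>))) c = cochain_eval \<phi> (chain_boundary p c)"
  using subset_UNIV
  by (induction c rule: frag_induction) (auto simp: cochain_eval_diff chain_boundary_diff)

lemma cochain_eval_chain_map:
  "cochain_eval (\<lambda>\<tau>. \<phi> (simplex_map p f \<tau>)) c = cochain_eval \<phi> (chain_map p f c)"
  using subset_UNIV
  by (induction c rule: frag_induction) (auto simp: cochain_eval_diff chain_map_diff)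

lemma cochain_eval_cong_chain:
  assumes "singular_chain p X c" "\<And>\<sigma>. singular_simplex p X \<sigma> \<Longrightarrow> \<phi> \<sigma> = \<psi> \<sigma>"
  shows "cochain_eval \<phi> c = cochain_eval \<psi> c"
  by (rule cochain_eval_cong[OF assms(1)[unfolded singular_chain_def]]) (simp add: assms(2))

lemma chain_boundary_boundary_Suc:
  "singular_chain (Suc (Suc p)) X c \<Longrightarrow> chain_boundary (Suc p) (chain_boundary (Suc (Suc p)) c) = 0"
  using chain_boundary_boundary[of "Suc (Suc p)" X c] by simp

lemma acyclic_at_0D:
  assumes "acyclic_at 0 X" "\<And>c. singular_chain (Suc 0) X c \<Longrightarrow> cochain_eval \<phi> (chain_boundary (Suc 0) c) = 0"
    and "singular_simplex 0 X \<tau>"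
  shows "\<phi> \<tau> = 0"
proof -
  have "cochain_eval (restrict \<phi> (singular_simplex_set 0 X)) c = cochain_eval \<phi> c"
    if "singular_chain 0 X c" for c
    by (rule cochain_eval_cong_chain[OF that]) simp
  then have "restrict \<phi> (singular_simplex_set 0 X) \<in> cocycles 0 X"
    using assms(2) by (auto simp: cocycles_iff singular_chain_boundary_alt)
  then have "restrict \<phi> (singular_simplex_set 0 X) = (\<lambda>\<sigma>\<in>singular_simplex_set 0 X. 0)"
    using assms(1) by (auto simp: acyclic_at_def coboundaries_def one_cochain_group)
  then show ?thesis
    using assms(3) by (metis mem_Collect_eq restrict_apply')
qed

lemma open_pair_cover:
  assumes "openin X U" "openin X V" "topspace X \<subseteq> U \<union> V"
  shows "\<And>W. W \<in> {U, V} \<Longrightarrow> openin X W" "topspace X \<subseteq> \<Union>{U, V}"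
  using assms by auto

text \<open>Primitives \<open>a\<close> on \<open>U\<close> and \<open>b\<close> on \<open>V\<close>
  differ by a cocycle on the intersection. Its primitive corrects \<open>a\<close> until both agree
  there, so they glue to \<open>f\<close>. What remains, \<open>\<phi>\<close> minus the coboundary
  of \<open>f\<close>, is zero on simplices subordinate to the cover and is handled by
  \<open>cocycle_vanishing_on_small\<close>.\<close>

lemma acyclic_at_Un:
  assumes op: "openin X U" "openin X V" "topspace X \<subseteq> U \<union> V"
    and U: "acyclic_at (Suc n) (subtopology X U)" and V: "acyclic_at (Suc n) (subtopology X V)"
    and UV: "acyclic_at n (subtopology X (U \<inter> V))"
  shows "acyclic_at (Suc n) X"
proof (rule acyclic_at_SucI)
  fix \<phi> assume cyc: "\<And>c. singular_chain (Suc (Suc n)) X c \<Longrightarrow>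
    cochain_eval \<phi> (chain_boundary (Suc (Suc n)) c) = 0"
  obtain a where a: "\<And>c. singular_chain (Suc n) (subtopology X U) c \<Longrightarrow>
      cochain_eval \<phi> c = cochain_eval a (chain_boundary (Suc n) c)"
    by (rule acyclic_atD[OF U, of \<phi>]) (auto simp: cyc singular_chain_subtopology)
  obtain b where b: "\<And>c. singular_chain (Suc n) (subtopology X V) c \<Longrightarrow>
      cochain_eval \<phi> c = cochain_eval b (chain_boundary (Suc n) c)"
    by (rule acyclic_atD[OF V, of \<phi>]) (auto simp: cyc singular_chain_subtopology)
  define d where "d = (\<lambda>\<tau>. a \<tau> - b \<tau>)"
  have d: "cochain_eval d (chain_boundary (Suc n) c) = 0"
    if c: "singular_chain (Suc n) (subtopology X (U \<inter> V)) c" for c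
  proof -
    have "singular_chain (Suc n) (subtopology X U) c" "singular_chain (Suc n) (subtopology X V) c"
      using c by (auto simp: singular_chain_subtopology)
    then show ?thesis by (simp add: d_def cochain_eval_diff_left flip: a b)
  qed
  have "\<exists>a'. (\<forall>c. singular_chain (Suc n) (subtopology X U) c \<longrightarrow>
        cochain_eval \<phi> c = cochain_eval a' (chain_boundary (Suc n) c)) \<and>
     (\<forall>\<tau>. singular_simplex n (subtopology X (U \<inter> V)) \<tau> \<longrightarrow> a' \<tau> = b \<tau>)"
  proof (cases n)
    \<comment> \<open>No correction is possible in degree 0, but the hypothesis now makes the
      difference itself vanish on the intersection.\<close>
    case 0
    have "d \<tau> = 0" if "singular_simplex n (subtopology X (U \<inter> V)) \<tau>" for \<tau>
      using acyclic_at_0D[of "subtopology X (U \<inter> V)" d \<tau>] UV d that 0 by simp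
    then show ?thesis using a by (intro exI[of _ a]) (auto simp: d_def)
  next
    case (Suc m)
    obtain e where e: "\<And>c. singular_chain n (subtopology X (U \<inter> V)) c \<Longrightarrow>
       cochain_eval d c = cochain_eval e (chain_boundary n c)"
      using acyclic_atD[of m "subtopology X (U \<inter> V)" d] UV d Suc by metis
    let ?a = "\<lambda>\<tau>. a \<tau> - cochain_eval e (chain_boundary n (frag_of \<tau>))"
    show ?thesis
    proof (intro exI[of _ ?a] conjI allI impI)
      fix c assume c: "singular_chain (Suc n) (subtopology X U) c"
      show "cochain_eval \<phi> c = cochain_eval ?a (chain_boundary (Suc n) c)"
        using a[OF c] chain_boundary_boundary_Suc[of m "subtopology X U" c] c Suc
        by (simp add: cochain_eval_diff_left cochain_eval_boundary)
    next
      fix \<tau> assume "singular_simplex n (subtopology X (U \<inter> V)) \<tau>"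
      then show "?a \<tau> = b \<tau>" using e[of "frag_of \<tau>"] by (simp add: singular_chain_of d_def)
    qed
  qed
  then obtain a' where a': "\<And>c. singular_chain (Suc n) (subtopology X U) c \<Longrightarrow>
        cochain_eval \<phi> c = cochain_eval a' (chain_boundary (Suc n) c)"
    "\<And>\<tau>. singular_simplex n (subtopology X (U \<inter> V)) \<tau> \<Longrightarrow> a' \<tau> = b \<tau>" by blast
  define f where "f = (\<lambda>\<tau>. if singular_simplex n (subtopology X U) \<tau> then a' \<tau> else b \<tau>)"
  define \<psi> where "\<psi> = (\<lambda>\<sigma>. \<phi> \<sigma> - cochain_eval f (chain_boundary (Suc n) (frag_of \<sigma>)))"
  have \<psi>: "cochain_eval \<psi> c = cochain_eval \<phi> c - cochain_eval f (chain_boundary (Suc n) c)" for c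
    by (simp add: \<psi>_def cochain_eval_diff_left cochain_eval_boundary)
  obtain e where e: "\<And>c. singular_chain (Suc n) X c \<Longrightarrow>
      cochain_eval \<psi> c = cochain_eval e (chain_boundary (Suc n) c)"
  proof (rule cocycle_vanishing_on_small[OF open_pair_cover[OF op], of n \<psi>])
    show "cochain_eval \<psi> (chain_boundary (Suc (Suc n)) c) = 0"
      if "singular_chain (Suc (Suc n)) X c" for c
      using chain_boundary_boundary_Suc[OF that] cyc[OF that] by (simp add: \<psi>)
    show "\<psi> \<sigma> = 0" if \<sigma>: "small_simplex (Suc n) X {U, V} \<sigma>" for \<sigma>
    proof -
      consider "singular_chain (Suc n) (subtopology X U) (frag_of \<sigma>)"
        | "singular_chain (Suc n) (subtopology X V) (frag_of \<sigma>)"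
        using \<sigma> by (auto simp: small_simplex_def singular_chain_of)
      then show ?thesis
      proof cases
        case 1
        have "cochain_eval f (chain_boundary (Suc n) (frag_of \<sigma>)) =
            cochain_eval a' (chain_boundary (Suc n) (frag_of \<sigma>))"
          by (rule cochain_eval_cong_chain[OF singular_chain_boundary_alt[OF 1]]) (simp add: f_def)
        then show ?thesis using a'(1)[OF 1] by (simp add: \<psi>_def)
      next
        case 2
        have "cochain_eval f (chain_boundary (Suc n) (frag_of \<sigma>)) =
            cochain_eval b (chain_boundary (Suc n) (frag_of \<sigma>))"
          by (rule cochain_eval_cong_chain[OF singular_chain_boundary_alt[OF 2]])
             (auto simp: f_def singular_simplex_subtopology intro!: a'(2))
        then show ?thesis using b[OF 2] by (simp add: \<psi>_def)
      qed
    qed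
  qed (assumption, blast)
  show "\<exists>e. \<forall>\<sigma>. singular_simplex (Suc n) X \<sigma> \<longrightarrow>
      \<phi> \<sigma> = cochain_eval e (chain_boundary (Suc n) (frag_of \<sigma>))"
  proof (intro exI[of _ "\<lambda>\<tau>. f \<tau> + e \<tau>"] allI impI)
    fix \<sigma> assume "singular_simplex (Suc n) X \<sigma>"
    then show "\<phi> \<sigma> = cochain_eval (\<lambda>\<tau>. f \<tau> + e \<tau>) (chain_boundary (Suc n) (frag_of \<sigma>))"
      using e[of "frag_of \<sigma>"] by (simp add: singular_chain_of \<psi>_def cochain_eval_add_left)
  qed
qed

text \<open>Exactness at the intersection, with the connecting map made explicit. The coboundary of
  \<open>\<phi>\<close> on \<open>U\<close>, extended by zero to \<open>\<omega>\<close>, is closed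
  up to a correction \<open>e\<close> invisible on small simplices. A primitive
  \<open>\<eta>\<close> of the resulting global cocycle splits \<open>\<phi>\<close> as
  (\<open>\<phi>\<close> - \<open>\<eta>\<close>) + \<open>\<eta>\<close>, the first summand being
  closed on \<open>U\<close> and the second on \<open>V\<close>.\<close>

lemma acyclic_at_Int:
  assumes op: "openin X U" "openin X V" "topspace X \<subseteq> U \<union> V"
    and U: "acyclic_at (Suc n) (subtopology X U)" and V: "acyclic_at (Suc n) (subtopology X V)"
    and X: "acyclic_at (Suc (Suc n)) X"
  shows "acyclic_at (Suc n) (subtopology X (U \<inter> V))"
proof (rule acyclic_at_SucI)
  fix \<phi> assume cyc: "\<And>c. singular_chain (Suc (Suc n)) (subtopology X (U \<inter> V)) c \<Longrightarrow>
    cochain_eval \<phi> (chain_boundary (Suc (Suc n)) c) = 0"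
  \<comment> \<open>Off the intersection the values of \<open>\<phi>\<close> are arbitrary, so
    \<open>\<phi>\<close> serves as its own extension to \<open>U\<close>. The default 0 makes
    \<open>\<omega>\<close> vanish on \<open>V\<close>: a simplex of \<open>V\<close> that also lies
    in \<open>U\<close> is one of the intersection, where \<open>\<phi>\<close> is closed.\<close>
  define \<omega> where "\<omega> = (\<lambda>\<sigma>. if singular_simplex (Suc (Suc n)) (subtopology X U) \<sigma>
     then cochain_eval \<phi> (chain_boundary (Suc (Suc n)) (frag_of \<sigma>)) else 0)"
  have \<omega>U: "cochain_eval \<omega> c = cochain_eval \<phi> (chain_boundary (Suc (Suc n)) c)"
    if "singular_chain (Suc (Suc n)) (subtopology X U) c" for c
  proof -
    have "cochain_eval \<omega> c = cochain_eval (\<lambda>\<tau>. cochain_eval \<phi> (chain_boundary (Suc (Suc n)) (frag_of \<tau>))) c"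
      by (rule cochain_eval_cong_chain[OF that]) (simp add: \<omega>_def)
    then show ?thesis by (simp add: cochain_eval_boundary)
  qed
  have \<omega>V: "cochain_eval \<omega> c = 0" if "singular_chain (Suc (Suc n)) (subtopology X V) c" for c
    by (rule cochain_eval_eq_0[OF that[unfolded singular_chain_def]])
       (auto simp: \<omega>_def singular_simplex_subtopology singular_chain_of intro!: cyc)
  define \<psi> where "\<psi> = (\<lambda>\<rho>. cochain_eval \<omega> (chain_boundary (Suc (Suc (Suc n))) (frag_of \<rho>)))"
  obtain e where e: "\<And>c. singular_chain (Suc (Suc (Suc n))) X c \<Longrightarrow>
      cochain_eval \<psi> c = cochain_eval e (chain_boundary (Suc (Suc (Suc n))) c)"
    and e0: "\<And>\<tau>. small_simplex (Suc (Suc n)) X {U, V} \<tau> \<Longrightarrow> e \<tau> = 0"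
  proof (rule cocycle_vanishing_on_small[OF open_pair_cover[OF op], of "Suc (Suc n)" \<psi>])
    show "cochain_eval \<psi> (chain_boundary (Suc (Suc (Suc (Suc n)))) c) = 0"
      if "singular_chain (Suc (Suc (Suc (Suc n)))) X c" for c
      using chain_boundary_boundary_Suc[OF that] by (simp add: \<psi>_def cochain_eval_boundary)
    show "\<psi> \<sigma> = 0" if \<sigma>: "small_simplex (Suc (Suc (Suc n))) X {U, V} \<sigma>" for \<sigma>
    proof -
      consider "singular_chain (Suc (Suc (Suc n))) (subtopology X U) (frag_of \<sigma>)"
        | "singular_chain (Suc (Suc (Suc n))) (subtopology X V) (frag_of \<sigma>)"
        using \<sigma> by (auto simp: small_simplex_def singular_chain_of)
      then show ?thesis
      proof cases
        case 1
        then show ?thesis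
          using \<omega>U[OF singular_chain_boundary_alt[OF 1]] chain_boundary_boundary_Suc[OF 1]
          by (simp add: \<psi>_def)
      next
        case 2
        then show ?thesis
          using \<omega>V[OF singular_chain_boundary_alt[OF 2]] by (simp add: \<psi>_def)
      qed
    qed
  qed (assumption, blast)
  have e0': "cochain_eval e c = 0"
    if "singular_chain (Suc (Suc n)) (subtopology X W) c" "W \<in> {U, V}" for c W
    by (rule cochain_eval_eq_0[OF that(1)[unfolded singular_chain_def]])
       (use that(2) in \<open>auto simp: small_simplex_def intro!: e0\<close>)
  obtain \<eta> where \<eta>: "\<And>c. singular_chain (Suc (Suc n)) X c \<Longrightarrow>
      cochain_eval (\<lambda>\<tau>. \<omega> \<tau> - e \<tau>) c = cochain_eval \<eta> (chain_boundary (Suc (Suc n)) c)"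
  proof (rule acyclic_atD[OF X, of "\<lambda>\<tau>. \<omega> \<tau> - e \<tau>"])
    show "cochain_eval (\<lambda>\<tau>. \<omega> \<tau> - e \<tau>) (chain_boundary (Suc (Suc (Suc n))) c) = 0"
      if "singular_chain (Suc (Suc (Suc n))) X c" for c
      using e[OF that] by (simp add: cochain_eval_diff_left \<psi>_def cochain_eval_boundary)
  qed blast
  have subX: "singular_chain p X c" if "singular_chain p (subtopology X W) c" for p W c
    using that by (simp add: singular_chain_subtopology)
  obtain a where a: "\<And>c. singular_chain (Suc n) (subtopology X U) c \<Longrightarrow>
      cochain_eval (\<lambda>\<tau>. \<phi> \<tau> - \<eta> \<tau>) c = cochain_eval a (chain_boundary (Suc n) c)"
  proof (rule acyclic_atD[OF U, of "\<lambda>\<tau>. \<phi> \<tau> - \<eta> \<tau>"])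
    show "cochain_eval (\<lambda>\<tau>. \<phi> \<tau> - \<eta> \<tau>) (chain_boundary (Suc (Suc n)) c) = 0"
      if "singular_chain (Suc (Suc n)) (subtopology X U) c" for c
      using \<eta>[OF subX[OF that]] \<omega>U[OF that] e0'[OF that] by (simp add: cochain_eval_diff_left)
  qed blast
  obtain b where b: "\<And>c. singular_chain (Suc n) (subtopology X V) c \<Longrightarrow>
      cochain_eval \<eta> c = cochain_eval b (chain_boundary (Suc n) c)"
  proof (rule acyclic_atD[OF V, of \<eta>])
    show "cochain_eval \<eta> (chain_boundary (Suc (Suc n)) c) = 0"
      if "singular_chain (Suc (Suc n)) (subtopology X V) c" for c
      using \<eta>[OF subX[OF that]] \<omega>V[OF that] e0'[OF that] by (simp add: cochain_eval_diff_left)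
  qed blast
  show "\<exists>e. \<forall>\<sigma>. singular_simplex (Suc n) (subtopology X (U \<inter> V)) \<sigma> \<longrightarrow>
      \<phi> \<sigma> = cochain_eval e (chain_boundary (Suc n) (frag_of \<sigma>))"
  proof (intro exI[of _ "\<lambda>\<tau>. a \<tau> + b \<tau>"] allI impI)
    fix \<sigma> assume "singular_simplex (Suc n) (subtopology X (U \<inter> V)) \<sigma>"
    then have "singular_chain (Suc n) (subtopology X U) (frag_of \<sigma>)"
      "singular_chain (Suc n) (subtopology X V) (frag_of \<sigma>)"
      by (auto simp: singular_chain_of singular_simplex_subtopology)
    then show "\<phi> \<sigma> = cochain_eval (\<lambda>\<tau>. a \<tau> + b \<tau>) (chain_boundary (Suc n) (frag_of \<sigma>))"
      using a[of "frag_of \<sigma>"] b[of "frag_of \<sigma>"] by (simp add: cochain_eval_add_left)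
  qed
qed

subsection \<open>Homotopy invariance\<close>

definition cylinder :: "nat \<Rightarrow> (real \<times> (nat \<Rightarrow> real)) topology" where
  "cylinder p = prod_topology (top_of_set {0..1}) (subtopology (powertop_real UNIV) (standard_simplex p))"

text \<open>\<open>P\<close> is a chain in the cylinder over the standard simplex. Pushing it
  forward along each simplex of a chain yields the prism operator of an arbitrary space.\<close>

definition cyl :: "nat \<Rightarrow> (real \<times> (nat \<Rightarrow> real)) chain \<Rightarrow> 'a chain \<Rightarrow> (real \<times> 'a) chain" where
  "cyl p P c = frag_extend (\<lambda>\<sigma>. chain_map (Suc p) (map_prod id \<sigma>) P) c"

lemma cyl_0 [simp]: "cyl p P 0 = 0"
  and cyl_of [simp]: "cyl p P (frag_of \<sigma>) = chain_map (Suc p) (map_prod id \<sigma>) P"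
  and cyl_diff: "cyl p P (a - b) = cyl p P a - cyl p P b"
  by (simp_all add: cyl_def frag_extend_diff)

lemma continuous_map_cylinder:
  assumes "singular_simplex p X \<sigma>"
  shows "continuous_map (cylinder p) (prod_topology (top_of_set {0..1}) X) (map_prod id \<sigma>)"
proof -
  have "continuous_map (cylinder p) X (\<sigma> \<circ> snd)"
    using assms unfolding cylinder_def singular_simplex_def
    by (intro continuous_map_compose[OF continuous_map_snd]) auto
  then show ?thesis
    unfolding continuous_map_pairwise
    by (simp add: o_def cylinder_def continuous_map_fst)
qed

lemma singular_chain_cyl:
  assumes P: "singular_chain (Suc p) (cylinder p) P" and c: "singular_chain p X c"
  shows "singular_chain (Suc p) (prod_topology (top_of_set {0..1}) X) (cyl p P c)"
  using c unfolding singular_chain_def[of p]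
proof (induction rule: frag_induction)
  case (one \<sigma>)
  then show ?case
    using singular_chain_chain_map[OF P continuous_map_cylinder[of p X \<sigma>]] by simp
qed (auto simp: cyl_diff singular_chain_diff)

definition prism_base :: "(real \<times> (nat \<Rightarrow> real)) chain \<Rightarrow> bool" where
  "prism_base P \<longleftrightarrow> singular_chain (Suc 0) (cylinder 0) P \<and>
    chain_boundary (Suc 0) P = chain_map 0 (Pair 1) (frag_of (\<lambda>x\<in>standard_simplex 0. x))
      - chain_map 0 (Pair 0) (frag_of (\<lambda>x\<in>standard_simplex 0. x))"

text \<open>The boundary identity of a prism operator, demanded only on the identity simplex;
  \<open>boundary_cyl_Suc\<close> carries it to all simplices by naturality.\<close>

definition prism_step :: "nat \<Rightarrow> (real \<times> (nat \<Rightarrow> real)) chain \<Rightarrow> (real \<times> (nat \<Rightarrow> real)) chain \<Rightarrow> bool" where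
  "prism_step p P Q \<longleftrightarrow> singular_chain (Suc (Suc p)) (cylinder (Suc p)) Q \<and>
    chain_boundary (Suc (Suc p)) Q =
      chain_map (Suc p) (Pair 1) (frag_of (\<lambda>x\<in>standard_simplex (Suc p). x))
      - chain_map (Suc p) (Pair 0) (frag_of (\<lambda>x\<in>standard_simplex (Suc p). x))
      - cyl p P (chain_boundary (Suc p) (frag_of (\<lambda>x\<in>standard_simplex (Suc p). x)))"

lemma chain_map_Pair_simplex:
  assumes "singular_simplex p X \<sigma>"
  shows "chain_map p (map_prod id \<sigma>) (chain_map p (Pair t) (frag_of (\<lambda>x\<in>standard_simplex p. x))) =
    chain_map p (Pair t) (frag_of \<sigma>)"
  using assms by (auto simp: simplex_map_def singular_simplex_def frag_of_eq fun_eq_iff extensional_def)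

lemma chain_map_cyl:
  assumes P: "singular_chain (Suc p) (cylinder p) P" and c: "singular_chain p Y c"
  shows "chain_map (Suc p) (map_prod id f) (cyl p P c) = cyl p P (chain_map p f c)"
  using c unfolding singular_chain_def[of p]
proof (induction rule: frag_induction)
  case (one \<tau>)
  have "chain_map (Suc p) (map_prod id f) (chain_map (Suc p) (map_prod id \<tau>) P) =
      chain_map (Suc p) (map_prod id f \<circ> map_prod id \<tau>) P"
    by (simp add: chain_map_compose)
  also have "\<dots> = chain_map (Suc p) (map_prod id (simplex_map p f \<tau>)) P"
    by (rule chain_map_eq[OF P]) (auto simp: cylinder_def simplex_map_def)
  finally show ?case by (simp only: cyl_of chain_map_of)
qed (auto simp: cyl_diff chain_map_diff)

lemma boundary_cyl_0:
  assumes P: "prism_base P" and c: "singular_chain 0 X c"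
  shows "chain_boundary (Suc 0) (cyl 0 P c) = chain_map 0 (Pair 1) c - chain_map 0 (Pair 0) c"
  using c unfolding singular_chain_def
proof (induction rule: frag_induction)
  case (one \<sigma>)
  then have "singular_simplex 0 X \<sigma>" by simp
  note * = chain_map_Pair_simplex[OF this]
  have "chain_boundary (Suc 0) (cyl 0 P (frag_of \<sigma>)) =
      chain_map 0 (map_prod id \<sigma>) (chain_boundary (Suc 0) P)"
    using chain_boundary_chain_map[of "Suc 0" "cylinder 0" P] P by (simp add: prism_base_def)
  also have "\<dots> = chain_map 0 (Pair 1) (frag_of \<sigma>) - chain_map 0 (Pair 0) (frag_of \<sigma>)"
    using P by (simp only: prism_base_def chain_map_diff *)
  finally show ?case .
qed (auto simp: cyl_diff chain_map_diff chain_boundary_diff)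

lemma boundary_cyl_Suc:
  assumes P: "singular_chain (Suc p) (cylinder p) P" and Q: "prism_step p P Q"
    and c: "singular_chain (Suc p) X c"
  shows "chain_boundary (Suc (Suc p)) (cyl (Suc p) Q c) =
    chain_map (Suc p) (Pair 1) c - chain_map (Suc p) (Pair 0) c - cyl p P (chain_boundary (Suc p) c)"
  using c unfolding singular_chain_def
proof (induction rule: frag_induction)
  case (one \<sigma>)
  then have \<sigma>: "singular_simplex (Suc p) X \<sigma>" by simp
  let ?\<iota> = "frag_of (\<lambda>x\<in>standard_simplex (Suc p). x)"
  let ?\<Delta> = "subtopology (powertop_real UNIV) (standard_simplex (Suc p))"
  have \<iota>: "singular_chain (Suc p) ?\<Delta> ?\<iota>"
    by (simp add: singular_chain_of singular_simplex_def)
  have s\<iota>: "chain_map (Suc p) \<sigma> ?\<iota> = frag_of \<sigma>"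
    using singular_simplex_chain_map_id[OF \<sigma>] by (simp add: id_def)
  have "chain_map (Suc p) (map_prod id \<sigma>) (cyl p P (chain_boundary (Suc p) ?\<iota>)) =
      cyl p P (chain_map p \<sigma> (chain_boundary (Suc p) ?\<iota>))"
    by (rule chain_map_cyl[OF P singular_chain_boundary_alt[OF \<iota>]])
  also have "chain_map p \<sigma> (chain_boundary (Suc p) ?\<iota>) = chain_boundary (Suc p) (frag_of \<sigma>)"
    using chain_boundary_chain_map[OF \<iota>, of \<sigma>] s\<iota> by (simp del: chain_map_of)
  finally have 1: "chain_map (Suc p) (map_prod id \<sigma>) (cyl p P (chain_boundary (Suc p) ?\<iota>)) =
      cyl p P (chain_boundary (Suc p) (frag_of \<sigma>))" .
  have "chain_boundary (Suc (Suc p)) (cyl (Suc p) Q (frag_of \<sigma>)) =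
      chain_map (Suc p) (map_prod id \<sigma>) (chain_boundary (Suc (Suc p)) Q)"
    using chain_boundary_chain_map[of "Suc (Suc p)" "cylinder (Suc p)" Q] Q
    by (simp add: prism_step_def)
  also have "\<dots> = chain_map (Suc p) (Pair 1) (frag_of \<sigma>) - chain_map (Suc p) (Pair 0) (frag_of \<sigma>)
      - cyl p P (chain_boundary (Suc p) (frag_of \<sigma>))"
    using Q by (simp only: prism_step_def chain_map_diff chain_map_Pair_simplex[OF \<sigma>] 1)
  finally show ?case .
qed (auto simp: cyl_diff chain_map_diff chain_boundary_diff)

lemma contractible_standard_simplex:
  "contractible_space (subtopology (powertop_real UNIV) (standard_simplex p))"
proof -
  let ?\<Delta> = "subtopology (powertop_real UNIV) (standard_simplex p)"
  let ?a = "\<lambda>j::nat. if j = 0 then 1 else (0::real)"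
  let ?h = "\<lambda>(t::real, x). \<lambda>i. (1 - t) * x i + t * ?a i"
  have "continuous_map (prod_topology (top_of_set {0..1}) ?\<Delta>) (powertop_real UNIV) ?h"
  proof -
    have x: "continuous_map (prod_topology (top_of_set {0..1::real}) ?\<Delta>) euclideanreal (\<lambda>z. snd z i)" for i
    proof -
      have "continuous_map ?\<Delta> euclideanreal (\<lambda>x. x i)"
        by (intro continuous_map_from_subtopology continuous_map_product_projection) simp
      then show ?thesis
        using continuous_map_compose[OF continuous_map_snd[of "top_of_set {0..1::real}" ?\<Delta>]]
        by (fastforce simp: o_def)
    qed
    have t: "continuous_map (prod_topology (top_of_set {0..1::real}) ?\<Delta>) euclideanreal fst"
      using continuous_map_fst[of "top_of_set {0..1::real}" ?\<Delta>] continuous_map_into_fulltopology by blast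
    show ?thesis
      unfolding continuous_map_componentwise
      by (auto simp: case_prod_unfold intro!: continuous_intros x t)
  qed
  moreover have "?a \<in> standard_simplex p"
    using basis_in_standard_simplex[of 0 p] by simp
  ultimately have "continuous_map (prod_topology (top_of_set {0..1}) ?\<Delta>) ?\<Delta> ?h"
    by (auto simp: continuous_map_in_subtopology intro!: convex_standard_simplex)
  then have "homotopic_with (\<lambda>x. True) ?\<Delta> ?\<Delta> id (\<lambda>x. ?a)"
    unfolding homotopic_with_def by (intro exI[of _ ?h]) auto
  then show ?thesis unfolding contractible_space_def by blast
qed

lemma contractible_cylinder: "contractible_space (cylinder p)"
  using contractible_standard_simplex[of p]
  by (simp add: cylinder_def contractible_space_prod_topology convex_imp_contractible)

text \<open>The cycle is homologous to its image under a constant map, which lives in a one-point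
  space, and there a cycle of positive degree bounds.\<close>

lemma cycle_in_contractible_space:
  assumes X: "contractible_space X" and c: "singular_chain (Suc p) X c" "chain_boundary (Suc p) c = 0"
  obtains y where "singular_chain (Suc (Suc p)) X y" "chain_boundary (Suc (Suc p)) y = c"
proof (cases "c = 0")
  case True
  then show ?thesis using that[of 0] by simp
next
  case False
  then have "topspace X \<noteq> {}" using c(1) singular_chain_empty by blast
  then obtain a where a: "a \<in> topspace X" "homotopic_with (\<lambda>x. True) X X id (\<lambda>x. a)"
    using X unfolding contractible_space by (metis topspace_discrete_topology)
  have c': "singular_relcycle (Suc p) X {} c"
    using c by (simp add: singular_cycle)
  let ?k = "chain_map (Suc p) (\<lambda>x. a) c"
  have h: "homologous_rel (Suc p) X {} (chain_map (Suc p) id c) ?k"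
    using homotopic_imp_homologous_rel_chain_maps[of "{}" "{}" X X id "\<lambda>x. a" "Suc p" c] a c' by simp
  have ta: "topspace (subtopology X {a}) = {a}" using a by auto
  have "singular_relcycle (Suc p) (subtopology X {a}) {} ?k"
    by (rule singular_relcycle_chain_map[OF c']) (auto simp: continuous_map_in_subtopology a)
  then have "singular_relboundary (Suc p) (subtopology X {a}) {} ?k"
    using singular_boundary_eq_cycle_singleton[OF ta, of "Suc p"] by simp
  then have "singular_relboundary (Suc p) X {} ?k"
    using singular_boundary_mono[of "{a}" UNIV "Suc p" X ?k] by simp
  moreover have "chain_map (Suc p) id c = c" using c(1) by (simp add: chain_map_ident)
  ultimately have "singular_relboundary (Suc p) X {} c"
    using h singular_relboundary_add[of "Suc p" X "{}" "c - ?k" ?k] by (simp add: homologous_rel_def)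
  then show ?thesis using that by (auto simp: singular_boundary)
qed

text \<open>Acyclic models: the prescribed boundary of the next prism is a cycle in a contractible
  cylinder and hence can be filled. In degree 0 the filling comes from the fact that two maps into a
  contractible space are homotopic.\<close>

lemma prism_exists:
  obtains P where "prism_base (P 0)" "\<And>p. prism_step p (P p) (P (Suc p))"
    "\<And>p. singular_chain (Suc p) (cylinder p) (P p)"
proof -
  let ?\<Delta> = "\<lambda>p. subtopology (powertop_real UNIV) (standard_simplex p)"
  let ?\<iota> = "\<lambda>p. frag_of (\<lambda>x\<in>standard_simplex p. x)"
  have \<iota>: "singular_chain p (?\<Delta> p) (?\<iota> p)" for p
    by (simp add: singular_chain_of singular_simplex_def)
  have cP: "continuous_map (?\<Delta> p) (cylinder p) (Pair t)" if "t \<in> {0..1}" for t p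
    using that unfolding cylinder_def by (simp add: continuous_map_pairwise o_def)
  \<comment> \<open>The invariant speaks only of chains that are boundaries: on them the previous
    prism operator drops out of the boundary formula, so that degree 0 and higher degrees take the
    same form.\<close>
  have "\<exists>P. \<forall>p. (singular_chain (Suc p) (cylinder p) (P p) \<and>
      (\<forall>q c. singular_chain (Suc p) (?\<Delta> q) c \<longrightarrow>
        chain_boundary (Suc p) (cyl p (P p) (chain_boundary (Suc p) c)) =
        chain_map p (Pair 1) (chain_boundary (Suc p) c) - chain_map p (Pair 0) (chain_boundary (Suc p) c)) \<and>
      (p = 0 \<longrightarrow> prism_base (P p))) \<and> prism_step p (P p) (P (Suc p))"
  proof (rule dependent_nat_choice)
    have "homotopic_with (\<lambda>x. True) (?\<Delta> 0) (cylinder 0) (Pair 1) (Pair 0)"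
      using cP contractible_cylinder by (intro homotopic_into_contractible_space) auto
    then have "homologous_rel 0 (cylinder 0) {} (chain_map 0 (Pair 1) (?\<iota> 0)) (chain_map 0 (Pair 0) (?\<iota> 0))"
      using homotopic_imp_homologous_rel_chain_maps[of "{}" "{}" "?\<Delta> 0" "cylinder 0" "Pair 1" "Pair 0" 0 "?\<iota> 0"] \<iota>[of 0]
      by (simp add: singular_cycle chain_boundary_def)
    then obtain P where "prism_base P"
      by (auto simp: homologous_rel_def singular_boundary prism_base_def)
    moreover then have "singular_chain (Suc 0) (cylinder 0) P" by (simp add: prism_base_def)
    ultimately show "\<exists>P. singular_chain (Suc 0) (cylinder 0) P \<and>
      (\<forall>q c. singular_chain (Suc 0) (?\<Delta> q) c \<longrightarrow>
        chain_boundary (Suc 0) (cyl 0 P (chain_boundary (Suc 0) c)) =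
        chain_map 0 (Pair 1) (chain_boundary (Suc 0) c) - chain_map 0 (Pair 0) (chain_boundary (Suc 0) c)) \<and>
      ((0::nat) = 0 \<longrightarrow> prism_base P)"
      using boundary_cyl_0 singular_chain_boundary_alt by blast
  next
    fix P p
    assume P: "singular_chain (Suc p) (cylinder p) P \<and>
      (\<forall>q c. singular_chain (Suc p) (?\<Delta> q) c \<longrightarrow>
        chain_boundary (Suc p) (cyl p P (chain_boundary (Suc p) c)) =
        chain_map p (Pair 1) (chain_boundary (Suc p) c) - chain_map p (Pair 0) (chain_boundary (Suc p) c)) \<and>
      (p = 0 \<longrightarrow> prism_base P)"
    let ?z = "chain_map (Suc p) (Pair 1) (?\<iota> (Suc p)) - chain_map (Suc p) (Pair 0) (?\<iota> (Suc p))
      - cyl p P (chain_boundary (Suc p) (?\<iota> (Suc p)))"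
    have "singular_chain (Suc p) (cylinder (Suc p)) (cyl p P (chain_boundary (Suc p) (?\<iota> (Suc p))))"
      unfolding cylinder_def[of "Suc p"]
      using P singular_chain_boundary_alt[OF \<iota>[of "Suc p"]] by (intro singular_chain_cyl) auto
    then have z: "singular_chain (Suc p) (cylinder (Suc p)) ?z"
      using singular_chain_chain_map[OF \<iota>[of "Suc p"] cP]
      by (intro singular_chain_diff) (auto simp del: chain_map_of)
    have dz: "chain_boundary (Suc p) ?z = 0"
    proof -
      have "chain_boundary (Suc p) (chain_map (Suc p) (Pair t) (?\<iota> (Suc p))) =
          chain_map p (Pair t) (chain_boundary (Suc p) (?\<iota> (Suc p)))" for t :: real
        using chain_boundary_chain_map[OF \<iota>[of "Suc p"], of "Pair t"] by (simp del: chain_map_of)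
      then show ?thesis
        using P \<iota>[of "Suc p"] by (simp del: chain_map_of add: chain_boundary_diff)
    qed
    obtain Q where Q: "singular_chain (Suc (Suc p)) (cylinder (Suc p)) Q"
      "chain_boundary (Suc (Suc p)) Q = ?z"
      using cycle_in_contractible_space[OF contractible_cylinder z dz] by blast
    then have st: "prism_step p P Q" by (simp add: prism_step_def)
    have "chain_boundary (Suc (Suc p)) (cyl (Suc p) Q (chain_boundary (Suc (Suc p)) c)) =
        chain_map (Suc p) (Pair 1) (chain_boundary (Suc (Suc p)) c)
        - chain_map (Suc p) (Pair 0) (chain_boundary (Suc (Suc p)) c)"
      if c: "singular_chain (Suc (Suc p)) (?\<Delta> q) c" for q c
      using boundary_cyl_Suc[OF _ st singular_chain_boundary_alt[OF c]] P
        chain_boundary_boundary_Suc[OF c] by simp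
    with Q st show "\<exists>Q. (singular_chain (Suc (Suc p)) (cylinder (Suc p)) Q \<and>
      (\<forall>q c. singular_chain (Suc (Suc p)) (?\<Delta> q) c \<longrightarrow>
        chain_boundary (Suc (Suc p)) (cyl (Suc p) Q (chain_boundary (Suc (Suc p)) c)) =
        chain_map (Suc p) (Pair 1) (chain_boundary (Suc (Suc p)) c)
        - chain_map (Suc p) (Pair 0) (chain_boundary (Suc (Suc p)) c)) \<and>
      (Suc p = 0 \<longrightarrow> prism_base Q)) \<and> prism_step p P Q"
      by blast
  qed
  then show ?thesis using that by metis
qed

text \<open>A homotopy from \<open>g \<circ> f\<close> to the identity of \<open>X\<close> is
  enough, since it makes the cohomology of \<open>X\<close> a direct summand of that of
  \<open>Y\<close>.\<close>

lemma acyclic_at_homotopy: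
  assumes f: "continuous_map X Y f" and g: "continuous_map Y X g"
    and hom: "homotopic_with (\<lambda>h. True) X X (g \<circ> f) id"
    and Y: "acyclic_at (Suc n) Y"
  shows "acyclic_at (Suc n) X"
proof (rule acyclic_at_SucI)
  fix \<phi> assume cyc: "\<And>c. singular_chain (Suc (Suc n)) X c \<Longrightarrow>
    cochain_eval \<phi> (chain_boundary (Suc (Suc n)) c) = 0"
  obtain h where h: "continuous_map (prod_topology (top_of_set {0..1::real}) X) X h"
    "\<And>x. h (0, x) = g (f x)" "\<And>x. h (1, x) = x"
    using hom by (auto simp: homotopic_with_def)
  obtain P where P: "\<And>p. prism_step p (P p) (P (Suc p))" "\<And>p. singular_chain (Suc p) (cylinder p) (P p)"
    by (rule prism_exists) (rule that, assumption, assumption)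
  obtain e where e: "\<And>c. singular_chain (Suc n) Y c \<Longrightarrow>
      cochain_eval (\<lambda>\<tau>. \<phi> (simplex_map (Suc n) g \<tau>)) c = cochain_eval e (chain_boundary (Suc n) c)"
  proof (rule acyclic_atD[OF Y, of "\<lambda>\<tau>. \<phi> (simplex_map (Suc n) g \<tau>)"])
    fix c assume c: "singular_chain (Suc (Suc n)) Y c"
    have "cochain_eval (\<lambda>\<tau>. \<phi> (simplex_map (Suc n) g \<tau>)) (chain_boundary (Suc (Suc n)) c)
        = cochain_eval \<phi> (chain_boundary (Suc (Suc n)) (chain_map (Suc (Suc n)) g c))"
      using chain_boundary_chain_map[OF c, of g] by (simp add: cochain_eval_chain_map)
    then show "cochain_eval (\<lambda>\<tau>. \<phi> (simplex_map (Suc n) g \<tau>)) (chain_boundary (Suc (Suc n)) c) = 0"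
      using cyc[OF singular_chain_chain_map[OF c g]] by simp
  qed blast
  let ?D = "\<lambda>c. chain_map (Suc n) h (cyl n (P n) c)"
  show "\<exists>e. \<forall>\<sigma>. singular_simplex (Suc n) X \<sigma> \<longrightarrow>
      \<phi> \<sigma> = cochain_eval e (chain_boundary (Suc n) (frag_of \<sigma>))"
  \<comment> \<open>The primitive has two parts: the primitive \<open>e\<close> found on
    \<open>Y\<close>, pulled back along \<open>f\<close>, and the value of \<open>\<phi>\<close> on
    the track of a simplex under the homotopy, which accounts for the difference between
    \<open>g \<circ> f\<close> and the identity.\<close>
  proof (intro exI[of _ "\<lambda>\<tau>. e (simplex_map n f \<tau>) + cochain_eval \<phi> (?D (frag_of \<tau>))"] allI impI)
    fix \<sigma> assume "singular_simplex (Suc n) X \<sigma>"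
    then have \<sigma>: "singular_chain (Suc n) X (frag_of \<sigma>)" by (simp add: singular_chain_of)
    let ?C = "cyl (Suc n) (P (Suc n)) (frag_of \<sigma>)"
    have C: "singular_chain (Suc (Suc n)) (prod_topology (top_of_set {0..1}) X) ?C"
      by (rule singular_chain_cyl[OF P(2) \<sigma>])
    have m1: "chain_map (Suc n) h (chain_map (Suc n) (Pair 1) (frag_of \<sigma>)) = frag_of \<sigma>"
    proof -
      have "chain_map (Suc n) h (chain_map (Suc n) (Pair 1) (frag_of \<sigma>)) =
          chain_map (Suc n) (h \<circ> Pair 1) (frag_of \<sigma>)" by (simp only: chain_map_compose o_apply)
      also have "\<dots> = frag_of \<sigma>" by (rule chain_map_id_gen[OF \<sigma>]) (simp add: h)
      finally show ?thesis .
    qed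
    have m0: "chain_map (Suc n) h (chain_map (Suc n) (Pair 0) (frag_of \<sigma>)) =
        chain_map (Suc n) g (chain_map (Suc n) f (frag_of \<sigma>))"
    proof -
      have "h \<circ> Pair 0 = g \<circ> f" by (simp add: fun_eq_iff h)
      then show ?thesis by (metis chain_map_compose o_apply)
    qed
    have "chain_boundary (Suc (Suc n)) (chain_map (Suc (Suc n)) h ?C) =
        chain_map (Suc n) h (chain_boundary (Suc (Suc n)) ?C)"
      using chain_boundary_chain_map[OF C, of h] by simp
    also have "\<dots> = frag_of \<sigma> - chain_map (Suc n) g (chain_map (Suc n) f (frag_of \<sigma>))
        - ?D (chain_boundary (Suc n) (frag_of \<sigma>))"
      by (simp only: boundary_cyl_Suc[OF P(2) P(1) \<sigma>] chain_map_diff m0 m1)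
    finally have "cochain_eval \<phi> (frag_of \<sigma> - chain_map (Suc n) g (chain_map (Suc n) f (frag_of \<sigma>))
        - ?D (chain_boundary (Suc n) (frag_of \<sigma>))) = 0"
      using cyc[OF singular_chain_chain_map[OF C h(1)]] by simp
    moreover have "cochain_eval \<phi> (chain_map (Suc n) g (chain_map (Suc n) f (frag_of \<sigma>))) =
        cochain_eval (\<lambda>\<tau>. e (simplex_map n f \<tau>)) (chain_boundary (Suc n) (frag_of \<sigma>))"
      using e[OF singular_chain_chain_map[OF \<sigma> f]] chain_boundary_chain_map[OF \<sigma>, of f]
      by (simp add: cochain_eval_chain_map del: chain_map_of)
    moreover have "cochain_eval (\<lambda>\<tau>. cochain_eval \<phi> (?D (frag_of \<tau>))) c = cochain_eval \<phi> (?D c)" for c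
      using subset_UNIV
      by (induction c rule: frag_induction) (auto simp: cochain_eval_diff cyl_diff chain_map_diff)
    ultimately show "\<phi> \<sigma> = cochain_eval (\<lambda>\<tau>. e (simplex_map n f \<tau>) + cochain_eval \<phi> (?D (frag_of \<tau>)))
        (chain_boundary (Suc n) (frag_of \<sigma>))"
      by (simp add: cochain_eval_add_left cochain_eval_diff del: chain_map_of)
  qed
qed

text \<open>The boundary of the unique simplex is zero in odd degree and the simplex one degree
  lower in positive even degree. In even degree the value of \<open>\<phi>\<close> is thus its own
  primitive; in odd degree the simplex is a boundary, which forces \<open>\<phi>\<close> to be
  zero.\<close>

lemma acyclic_at_singleton:
  assumes X: "topspace X = {a}"
  shows "acyclic_at (Suc n) X"
proof (rule acyclic_at_SucI)
  fix \<phi> assume cyc: "\<And>c. singular_chain (Suc (Suc n)) X c \<Longrightarrow>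
    cochain_eval \<phi> (chain_boundary (Suc (Suc n)) c) = 0"
  let ?s = "\<lambda>p. \<lambda>x\<in>standard_simplex p. a"
  have s: "singular_chain p X (frag_of (?s p))" for p
    using singular_simplex_singleton[OF X] by (simp add: singular_chain_of)
  show "\<exists>e. \<forall>\<sigma>. singular_simplex (Suc n) X \<sigma> \<longrightarrow>
      \<phi> \<sigma> = cochain_eval e (chain_boundary (Suc n) (frag_of \<sigma>))"
  proof (cases "odd n")
    case True
    then show ?thesis
      using chain_boundary_of_singleton[OF X s[of "Suc n"]] singular_simplex_singleton[OF X]
      by (intro exI[of _ "\<lambda>_. \<phi> (?s (Suc n))"]) auto
  next
    case False
    then have "\<phi> (?s (Suc n)) = 0"
      using cyc[OF s] chain_boundary_of_singleton[OF X s[of "Suc (Suc n)"]] by simp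
    then show ?thesis
      using singular_simplex_singleton[OF X]
      by (intro exI[of _ "\<lambda>_. 0"]) (auto simp: cochain_eval_eq_0[OF subset_UNIV])
  qed
qed

lemma acyclic_at_contractible_space:
  assumes "contractible_space X"
  shows "acyclic_at (Suc n) X"
proof (cases "topspace X = {}")
  case False
  then obtain a where a: "a \<in> topspace X" "homotopic_with (\<lambda>x. True) X X id (\<lambda>x. a)"
    using assms unfolding contractible_space by (metis topspace_discrete_topology)
  show ?thesis
  proof (rule acyclic_at_homotopy)
    show "continuous_map X (subtopology X {a}) (\<lambda>x. a)"
      using a by (simp add: continuous_map_in_subtopology)
    show "homotopic_with (\<lambda>h. True) X X (id \<circ> (\<lambda>x. a)) id"
      using a(2) by (simp add: homotopic_with_sym id_def)
    show "acyclic_at (Suc n) (subtopology X {a})"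
      by (rule acyclic_at_singleton[of _ a]) (use a in auto)
  qed (simp add: continuous_map_from_subtopology)
qed (simp add: acyclic_at_empty)

section \<open>Complements of central hyperplane arrangements\<close>

text \<open>Complex bilinear, in contrast to the real inner product of the type, so that its kernels
  are complex hyperplanes.\<close>

definition pairing :: "complex ^ 'd \<Rightarrow> complex ^ 'd \<Rightarrow> complex" where
  "pairing c w = (\<Sum>i\<in>UNIV. c $ i * w $ i)"

lemma pairing_add: "pairing c (v + w) = pairing c v + pairing c w"
  and pairing_diff: "pairing c (v - w) = pairing c v - pairing c w"
  and pairing_scale: "pairing c (a *s w) = a * pairing c w"
  and pairing_0 [simp]: "pairing c 0 = 0"
  by (simp_all add: pairing_def sum.distrib sum_subtractf algebra_simps sum_distrib_left)

lemma continuous_on_pairing [continuous_intros]: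
  "continuous_on S f \<Longrightarrow> continuous_on S (\<lambda>x. pairing c (f x))"
  unfolding pairing_def by (intro continuous_intros)

lemma continuous_on_scale_vec [continuous_intros]:
  fixes g :: "'b::topological_space \<Rightarrow> complex ^ 'd"
  shows "continuous_on S f \<Longrightarrow> continuous_on S g \<Longrightarrow> continuous_on S (\<lambda>x. f x *s g x)"
  unfolding vector_scalar_mult_def by (intro continuous_intros)

lemma scaleR_eq_scale_vec: "r *\<^sub>R (w :: complex ^ 'd) = complex_of_real r *s w"
  unfolding vec_eq_iff vector_scaleR_component vector_smult_component by (simp add: scaleR_conv_of_real)

lemma convex_complex_subspace:
  fixes W :: "(complex ^ 'd) set"
  assumes "vec.subspace W"
  shows "convex W"
  using assms by (auto simp: convex_def scaleR_eq_scale_vec vec.subspace_add vec.subspace_scale)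

definition common_kernel :: "(complex ^ 'd) set \<Rightarrow> (complex ^ 'd) set" where
  "common_kernel C = {w. \<forall>c\<in>C. pairing c w = 0}"

lemma subspace_common_kernel: "vec.subspace (common_kernel C)"
  by (auto simp: vec.subspace_def common_kernel_def pairing_add pairing_scale)

lemma common_kernel_empty [simp]: "common_kernel {} = UNIV"
  and common_kernel_insert: "common_kernel (insert c C) = common_kernel {c} \<inter> common_kernel C"
  by (auto simp: common_kernel_def)

text \<open>\<open>\<nu>\<close> splits \<open>W\<close> into its intersection with the kernel and a
  complex line. The normalisation makes w - c(w) \<open>\<nu>\<close> the projection to the
  kernel.\<close>

lemma hyperplane_section:
  assumes W: "vec.subspace W" and ne: "\<not> W \<subseteq> common_kernel {c}"
  obtains \<nu> where "\<nu> \<in> W" "pairing c \<nu> = 1" "vec.dim W = vec.dim (W \<inter> common_kernel {c}) + 1"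
proof -
  obtain u where u: "u \<in> W" "pairing c u \<noteq> 0"
    using ne by (auto simp: common_kernel_def)
  define \<nu> where "\<nu> = (1 / pairing c u) *s u"
  have \<nu>: "\<nu> \<in> W" "pairing c \<nu> = 1"
    using u W by (auto simp: \<nu>_def pairing_scale vec.subspace_scale)
  let ?H = "W \<inter> common_kernel {c}"
  have H: "vec.subspace ?H" by (intro vec.subspace_inter W subspace_common_kernel)
  have "\<nu> \<notin> vec.span ?H"
    using \<nu> H by (simp add: vec.span_eq_iff[THEN iffD2] common_kernel_def)
  then have "vec.dim (insert \<nu> ?H) = vec.dim ?H + 1" by (simp add: vec.dim_insert)
  moreover have "vec.span (insert \<nu> ?H) = W"
  proof
    show "vec.span (insert \<nu> ?H) \<subseteq> W"
      using \<nu> W by (intro vec.span_minimal) auto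
    show "W \<subseteq> vec.span (insert \<nu> ?H)"
    proof
      fix w assume w: "w \<in> W"
      have "w - pairing c w *s \<nu> \<in> ?H"
        using w \<nu> W by (simp add: common_kernel_def pairing_diff pairing_scale
            vec.subspace_diff vec.subspace_scale)
      then show "w \<in> vec.span (insert \<nu> ?H)"
        using vec.span_breakdown_eq vec.span_base by blast
    qed
  qed
  ultimately have "vec.dim W = vec.dim ?H + 1" by (metis vec.dim_span)
  then show ?thesis using that \<nu> by blast
qed

section \<open>Acyclicity of products with regions of the plane\<close>

lemma acyclic_at_top_of_set_Un:
  assumes "openin (top_of_set (A \<union> B)) A" "openin (top_of_set (A \<union> B)) B"
    and "acyclic_at (Suc n) (top_of_set A)" "acyclic_at (Suc n) (top_of_set B)"
    and "acyclic_at n (top_of_set (A \<inter> B))"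
  shows "acyclic_at (Suc n) (top_of_set (A \<union> B))"
  using assms
  by (intro acyclic_at_Un[of "top_of_set (A \<union> B)" A B])
     (auto simp: subtopology_subtopology Int_absorb1 Un_Int_assoc_eq inf.absorb2 le_infI1)

lemma acyclic_at_top_of_set_Int:
  assumes "openin (top_of_set (A \<union> B)) A" "openin (top_of_set (A \<union> B)) B"
    and "acyclic_at (Suc n) (top_of_set A)" "acyclic_at (Suc n) (top_of_set B)"
    and "acyclic_at (Suc (Suc n)) (top_of_set (A \<union> B))"
  shows "acyclic_at (Suc n) (top_of_set (A \<inter> B))"
  using acyclic_at_Int[of "top_of_set (A \<union> B)" A B n] assms
  by (simp add: subtopology_subtopology Int_absorb1 inf.absorb2 le_infI1)

text \<open>
  The part of the product decomposition \<open>W = ker c \<oplus> \<complex> \<nu>\<close> lying over \<open>N \<subseteq> ker c\<close> and \<open>S \<subseteq> \<complex>\<close>.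
\<close>

definition product_part ::
    "complex ^ 'd \<Rightarrow> complex ^ 'd \<Rightarrow> (complex ^ 'd) set \<Rightarrow> complex set \<Rightarrow> (complex ^ 'd) set" where
  "product_part c \<nu> N S = {w. w - pairing c w *s \<nu> \<in> N \<and> pairing c w \<in> S}"

lemma product_partI:
  assumes "pairing c \<nu> = 1" "n \<in> N" "pairing c n = 0" "s \<in> S"
  shows "n + s *s \<nu> \<in> product_part c \<nu> N S"
  using assms by (simp add: product_part_def pairing_add pairing_scale)

lemma openin_product_part:
  assumes "open S"
  shows "openin (top_of_set (product_part c \<nu> N T)) (product_part c \<nu> N (S \<inter> T))"
proof -
  have "product_part c \<nu> N (S \<inter> T) = product_part c \<nu> N T \<inter> (\<lambda>w. pairing c w) -` S"
    by (auto simp: product_part_def)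
  moreover have "continuous_on (product_part c \<nu> N T) (\<lambda>w. pairing c w)"
    by (intro continuous_intros)
  ultimately show ?thesis using continuous_openin_preimage_gen assms by metis
qed

text \<open>\<open>S\<close> is star-shaped about \<open>s0\<close>, so straight lines in the
  direction of \<open>\<nu>\<close> contract the product to the copy of \<open>N\<close> over
  \<open>s0\<close>.\<close>

lemma acyclic_at_product_part:
  assumes \<nu>: "pairing c \<nu> = 1" and N: "N \<subseteq> common_kernel {c}"
    and S: "s0 \<in> S" "\<And>s u. s \<in> S \<Longrightarrow> 0 \<le> u \<Longrightarrow> u \<le> 1 \<Longrightarrow>
      complex_of_real (1 - u) * s0 + complex_of_real u * s \<in> S"
    and ac: "acyclic_at (Suc n) (top_of_set N)"
  shows "acyclic_at (Suc n) (top_of_set (product_part c \<nu> N S))"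
proof (rule acyclic_at_homotopy[OF _ _ _ ac])
  let ?B = "product_part c \<nu> N S"
  let ?f = "\<lambda>w. w - pairing c w *s \<nu>" and ?g = "\<lambda>y. y + s0 *s \<nu>"
  have N0: "pairing c y = 0" if "y \<in> N" for y using that N by (auto simp: common_kernel_def)
  show f: "continuous_map (top_of_set ?B) (top_of_set N) ?f"
    by (auto simp: product_part_def intro!: continuous_intros)
  show g: "continuous_map (top_of_set N) (top_of_set ?B) ?g"
    using \<nu> S(1) by (auto simp: N0 intro!: continuous_intros product_partI)
  show "homotopic_with (\<lambda>h. True) (top_of_set ?B) (top_of_set ?B) (?g \<circ> ?f) id"
  proof (rule homotopic_with_linear)
    show "continuous_on ?B (?g \<circ> ?f)" "continuous_on ?B id"
      by (auto simp: o_def intro!: continuous_intros)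
    fix w assume w: "w \<in> ?B"
    show "closed_segment ((?g \<circ> ?f) w) (id w) \<subseteq> ?B"
    proof
      fix x assume "x \<in> closed_segment ((?g \<circ> ?f) w) (id w)"
      then obtain u where u: "0 \<le> u" "u \<le> 1" "x = (1 - u) *\<^sub>R (?g (?f w)) + u *\<^sub>R w"
        by (auto simp: in_segment)
      have "x = ?f w + (complex_of_real (1 - u) * s0 + complex_of_real u * pairing c w) *s \<nu>"
        unfolding u(3) scaleR_eq_scale_vec by (simp add: vec_eq_iff algebra_simps)
      then show "x \<in> ?B"
        using w u S(2) \<nu> N0 by (auto simp: product_part_def[of c \<nu> N S] pairing_add pairing_diff pairing_scale)
    qed
  qed
qed

text \<open>The punctured plane is the union of two slit planes, star-shaped about 1 and -1, whose
  intersection consists of two disjoint open half-planes. Gluing the half-planes keeps the degree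
  and gluing the slit planes raises it by one, so both degrees of \<open>N\<close> occur in the
  hypotheses.\<close>

lemma acyclic_at_product_part_punctured:
  assumes \<nu>: "pairing c \<nu> = 1" and N: "N \<subseteq> common_kernel {c}"
    and ac1: "acyclic_at (Suc n) (top_of_set N)" and ac2: "acyclic_at (Suc (Suc n)) (top_of_set N)"
  shows "acyclic_at (Suc (Suc n)) (top_of_set (product_part c \<nu> N (-{0})))"
proof -
  let ?B = "product_part c \<nu> N"
  have U: "?B S \<union> ?B T = ?B (S \<union> T)" and I: "?B S \<inter> ?B T = ?B (S \<inter> T)" for S T
    by (auto simp: product_part_def)
  have op: "openin (top_of_set (?B T)) (?B S)" if "open S" "S \<subseteq> T" for S T
    using openin_product_part[OF that(1), of c \<nu> N T] that(2) by (simp add: Int_absorb2)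
  have cvx: "acyclic_at (Suc m) (top_of_set (?B S))"
    if S: "convex S" "S \<noteq> {}" "acyclic_at (Suc m) (top_of_set N)" for m S
  proof -
    obtain s0 where s0: "s0 \<in> S" using S(2) by blast
    show ?thesis
    proof (rule acyclic_at_product_part[OF \<nu> N s0 _ S(3)])
      fix s and u :: real assume "s \<in> S" "0 \<le> u" "u \<le> 1"
      then show "complex_of_real (1 - u) * s0 + complex_of_real u * s \<in> S"
        using convexD[OF S(1) s0, of s "1 - u" u] by (simp add: scaleR_conv_of_real)
    qed
  qed
  have un: "{s. Im s > 0} \<union> {s. Im s < 0} = {s. Im s \<noteq> 0}" by auto
  have half: "acyclic_at (Suc n) (top_of_set (?B {s. Im s > 0} \<union> ?B {s. Im s < 0}))"
  proof (rule acyclic_at_top_of_set_Un)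
    show "acyclic_at (Suc n) (top_of_set (?B {s. Im s > 0}))"
      by (rule cvx[OF convex_halfspace_Im_gt _ ac1]) (auto intro: exI[of _ \<i>])
    show "acyclic_at (Suc n) (top_of_set (?B {s. Im s < 0}))"
      by (rule cvx[OF convex_halfspace_Im_lt _ ac1]) (auto intro: exI[of _ "-\<i>"])
    have "?B {s. Im s > 0} \<inter> ?B {s. Im s < 0} = {}" by (auto simp: product_part_def)
    then show "acyclic_at n (top_of_set (?B {s. Im s > 0} \<inter> ?B {s. Im s < 0}))"
      by (simp add: acyclic_at_empty)
  qed (auto simp: U un intro!: op open_halfspace_Im_gt open_halfspace_Im_lt)
  have "acyclic_at (Suc (Suc n)) (top_of_set (?B (- \<real>\<^sub>\<le>\<^sub>0) \<union> ?B (- \<real>\<^sub>\<ge>\<^sub>0)))"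
  proof (rule acyclic_at_top_of_set_Un)
    show "acyclic_at (Suc (Suc n)) (top_of_set (?B (- \<real>\<^sub>\<le>\<^sub>0)))"
    proof (rule acyclic_at_product_part[OF \<nu> N, of 1])
      fix s :: complex and u :: real assume "s \<in> - \<real>\<^sub>\<le>\<^sub>0" "0 \<le> u" "u \<le> 1"
      then show "complex_of_real (1 - u) * 1 + complex_of_real u * s \<in> - \<real>\<^sub>\<le>\<^sub>0"
        by (cases "u = 0") (auto simp: complex_nonpos_Reals_iff not_le add_nonneg_pos)
    qed (use ac2 in \<open>auto simp: complex_nonpos_Reals_iff\<close>)
    show "acyclic_at (Suc (Suc n)) (top_of_set (?B (- \<real>\<^sub>\<ge>\<^sub>0)))"
    proof (rule acyclic_at_product_part[OF \<nu> N, of "-1"])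
      fix s :: complex and u :: real assume *: "s \<in> - \<real>\<^sub>\<ge>\<^sub>0" "0 \<le> u" "u \<le> 1"
      \<comment> \<open>The segment from -1 to \<open>s\<close> can meet the real axis away from -1
        only if \<open>s\<close> is real, hence negative; then all its points are negative.\<close>
      have "u * Re s < 1 - u" if "u \<noteq> 0" "Re s < 0"
        using * that by (smt (verit) mult_pos_neg)
      then show "complex_of_real (1 - u) * (-1) + complex_of_real u * s \<in> - \<real>\<^sub>\<ge>\<^sub>0"
        using * by (cases "u = 0") (auto simp: complex_nonneg_Reals_iff not_le)
    qed (use ac2 in \<open>auto simp: complex_nonneg_Reals_iff\<close>)
    have "- \<real>\<^sub>\<le>\<^sub>0 \<inter> - \<real>\<^sub>\<ge>\<^sub>0 = {s. Im s \<noteq> 0}"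
      by (auto simp: complex_nonneg_Reals_iff complex_nonpos_Reals_iff)
    then show "acyclic_at (Suc n) (top_of_set (?B (- \<real>\<^sub>\<le>\<^sub>0) \<inter> ?B (- \<real>\<^sub>\<ge>\<^sub>0)))"
      using half by (simp add: U un I)
  qed (auto simp: U intro!: op open_Compl closed_nonpos_Reals_complex closed_nonneg_Reals_complex)
  moreover have "- \<real>\<^sub>\<le>\<^sub>0 \<union> - \<real>\<^sub>\<ge>\<^sub>0 = - {0::complex}"
    by (auto simp: complex_nonneg_Reals_iff complex_nonpos_Reals_iff complex_eq_iff)
  ultimately show ?thesis by (simp add: U)
qed

text \<open>Hyperplanes are given by functionals, which may be proportional to one another on
  \<open>W\<close> or vanish on it; in the latter case the complement is empty.\<close>

definition arrangement_complement :: "(complex ^ 'd) set \<Rightarrow> (complex ^ 'd) set \<Rightarrow> (complex ^ 'd) set" where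
  "arrangement_complement W C = {w \<in> W. \<forall>c\<in>C. pairing c w \<noteq> 0}"

lemma openin_arrangement_complement:
  assumes "finite C"
  shows "openin (top_of_set W) (arrangement_complement W C)"
proof -
  have "arrangement_complement W C = W \<inter> (\<Inter>c\<in>C. (\<lambda>w. pairing c w) -` (- {0}))"
    by (auto simp: arrangement_complement_def)
  moreover have "open (\<Inter>c\<in>C. (\<lambda>w. pairing c w) -` (- {0}))"
    by (intro open_INT assms ballI open_vimage continuous_intros)
  ultimately show ?thesis by (metis openin_open_Int)
qed

text \<open>
  Removing a hyperplane \<open>ker c\<close> from \<open>U = M(C)\<close>: by Mayer--Vietoris for \<open>U\<close> and
  \<open>V = W - ker c\<close> one needs the vanishing for \<open>U \<union> V\<close>. Near the hyperplane this union is the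
  product of the restricted arrangement complement and \<open>\<complex>\<close>, so that a second Mayer--Vietoris
  argument applies.
\<close>

theorem acyclic_at_arrangement_complement:
  assumes "finite C" "vec.subspace W" "vec.dim W < q + vec.dim (W \<inter> common_kernel C)"
  shows "acyclic_at q (top_of_set (arrangement_complement W C))"
  using assms
proof (induction C arbitrary: W q rule: finite_induct)
  case empty
  then obtain n where "q = Suc n" by (cases q) auto
  moreover have "contractible W"
    using empty by (intro convex_imp_contractible convex_complex_subspace)
  ultimately show ?case
    by (simp add: arrangement_complement_def acyclic_at_contractible_space)
next
  case (insert c C)
  let ?W' = "W \<inter> common_kernel {c}"
  have W': "vec.subspace ?W'" by (intro vec.subspace_inter insert.prems subspace_common_kernel)
  show ?case
  proof (cases "W \<subseteq> common_kernel {c}")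
    \<comment> \<open>The complement is empty here, and the empty space is acyclic in every degree,
      including 0.\<close>
    case True
    then have "arrangement_complement W (insert c C) = {}"
      by (auto simp: arrangement_complement_def common_kernel_def)
    then show ?thesis by (simp add: acyclic_at_empty)
  next
    case False
    then obtain \<nu> where \<nu>: "\<nu> \<in> W" "pairing c \<nu> = 1" and dim: "vec.dim W = vec.dim ?W' + 1"
      using hyperplane_section insert.prems by blast
    have K: "W \<inter> common_kernel (insert c C) = ?W' \<inter> common_kernel C"
      by (subst common_kernel_insert) auto
    have "vec.dim (?W' \<inter> common_kernel C) \<le> vec.dim ?W'" by (intro vec.dim_subset) auto
    \<comment> \<open>The common kernel already lies in \<open>?W'\<close>, which has one dimension
      less than \<open>W\<close>. The bound therefore leaves at least two degrees, one of them for
      the shift caused by the punctured line.\<close>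
    then have "q \<ge> 2" using insert.prems dim K by simp
    then obtain n where q: "q = Suc (Suc n)" by (metis add_2_eq_Suc le_Suc_ex)
    define U where "U = arrangement_complement W C"
    define V where "V = arrangement_complement W {c}"
    define N where "N = arrangement_complement ?W' C"
    define P where "P = product_part c \<nu> N UNIV"
    have Nk: "N \<subseteq> common_kernel {c}" by (auto simp: N_def arrangement_complement_def)
    have inW: "w - pairing c w *s \<nu> \<in> W \<longleftrightarrow> w \<in> W" for w
      using \<nu> insert.prems(1)
      by (metis diff_add_cancel vec.subspace_add vec.subspace_diff vec.subspace_scale)
    have inW': "w - pairing c w *s \<nu> \<in> common_kernel {c}" for w
      using \<nu> by (simp add: common_kernel_def pairing_diff pairing_scale)
    have V_eq: "V = product_part c \<nu> ?W' (- {0})"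
      using inW inW' by (auto simp: V_def arrangement_complement_def product_part_def)
    have PV_eq: "P \<inter> V = product_part c \<nu> N (- {0})"
      using inW inW' by (auto simp: V_eq P_def N_def arrangement_complement_def product_part_def)
    \<comment> \<open>On the kernel of \<open>c\<close> the conditions defining \<open>U\<close> and
      \<open>N\<close> agree, and every point of \<open>W\<close> off it lies in \<open>V\<close>.
      Hence the tube \<open>P\<close> over \<open>N\<close> can replace \<open>U\<close> in the
      union.\<close>
    have UV: "U \<union> V = P \<union> V"
      using inW inW' by (auto simp: U_def V_def P_def N_def arrangement_complement_def product_part_def)
    have UVi: "U \<inter> V = arrangement_complement W (insert c C)"
      by (auto simp: U_def V_def arrangement_complement_def)
    have sub: "U \<union> V \<subseteq> W" by (auto simp: U_def V_def arrangement_complement_def)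
    have PW: "P \<subseteq> W" using UV sub by blast
    have oU: "openin (top_of_set W) U" and oV: "openin (top_of_set W) V"
      unfolding U_def V_def using insert.hyps by (auto intro: openin_arrangement_complement)
    have oP: "openin (top_of_set W) P"
    proof -
      have "P = W \<inter> (\<lambda>w. w - pairing c w *s \<nu>) -` N"
        using PW by (auto simp: P_def product_part_def)
      moreover have "openin (top_of_set W) (W \<inter> (\<lambda>w. w - pairing c w *s \<nu>) -` N)"
        by (rule continuous_openin_preimage[where T = ?W'])
           (use inW inW' insert.hyps in \<open>auto simp: N_def intro!: continuous_intros openin_arrangement_complement\<close>)
      ultimately show ?thesis by simp
    qed
    have op: "openin (top_of_set (U \<union> V)) U" "openin (top_of_set (U \<union> V)) V"
      "openin (top_of_set (P \<union> V)) P" "openin (top_of_set (P \<union> V)) V"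
      using oU oV oP sub UV by (auto intro: openin_subset_trans)
    have dU: "vec.dim (?W' \<inter> common_kernel C) \<le> vec.dim (W \<inter> common_kernel C)"
      by (intro vec.dim_subset) auto
    \<comment> \<open>Dropping a functional can only enlarge the common kernel, so the bound
      persists for the same \<open>q\<close>.\<close>
    have acU: "acyclic_at (Suc (Suc n)) (top_of_set U)"
      unfolding U_def by (rule insert.IH) (use insert.prems K dU q in auto)
    \<comment> \<open>The restricted arrangement has the same common kernel in a space of one
      dimension less, so its complement is acyclic already from degree \<open>q - 1\<close>
      on.\<close>
    have acN: "acyclic_at (Suc n) (top_of_set N)" "acyclic_at (Suc (Suc n)) (top_of_set N)"
      "acyclic_at (Suc (Suc (Suc n))) (top_of_set N)"
      unfolding N_def by (rule insert.IH; use insert.prems W' K dim q in simp)+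
    have "contractible ?W'" by (intro convex_imp_contractible convex_complex_subspace W')
    then have acW': "acyclic_at (Suc m) (top_of_set ?W')" for m
      by (simp add: acyclic_at_contractible_space)
    have acV: "acyclic_at (Suc (Suc m)) (top_of_set V)" for m
      unfolding V_eq by (rule acyclic_at_product_part_punctured[OF \<nu>(2) _ acW' acW']) auto
    have acPV: "acyclic_at (Suc (Suc n)) (top_of_set (P \<inter> V))"
      unfolding PV_eq by (rule acyclic_at_product_part_punctured[OF \<nu>(2) Nk acN(1,2)])
    have acP: "acyclic_at (Suc (Suc (Suc n))) (top_of_set P)"
      unfolding P_def by (rule acyclic_at_product_part[OF \<nu>(2) Nk _ _ acN(3)]) auto
    have "acyclic_at (Suc (Suc (Suc n))) (top_of_set (U \<union> V))"
      unfolding UV by (rule acyclic_at_top_of_set_Un[OF op(3,4) acP acV acPV])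
    from acyclic_at_top_of_set_Int[OF op(1,2) acU acV this]
    show ?thesis by (simp add: UVi q)
  qed
qed

section \<open>The cohomology ring\<close>

lemma mult_cochain_group: "mult (cochain_group p X) = (\<lambda>\<phi> \<psi>. \<lambda>\<sigma>\<in>singular_simplex_set p X. \<phi> \<sigma> + \<psi> \<sigma>)"
  by (simp add: cochain_group_def integer_group_def)

lemma comm_group_cochain_group: "comm_group (cochain_group p X)"
  by (rule group.group_comm_groupI) (auto simp: cochain_group_def fun_eq_iff integer_group_def[symmetric] mult_cochain_group)

lemma group_cochain_group: "group (cochain_group p X)"
  using comm_group_cochain_group by (rule comm_group.axioms(2))

lemma coboundary_hom: "coboundary p X \<in> hom (cochain_group p X) (cochain_group (Suc p) X)"
proof (rule homI)
  fix \<phi> \<psi>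
  have f: "singular_simplex p X (singular_face (Suc p) k \<sigma>)"
    if "singular_simplex (Suc p) X \<sigma>" "k \<le> Suc p" for k \<sigma>
    using singular_simplex_singular_face[OF that(1) _ that(2)] by simp
  show "coboundary p X (\<phi> \<otimes>\<^bsub>cochain_group p X\<^esub> \<psi>) =
      coboundary p X \<phi> \<otimes>\<^bsub>cochain_group (Suc p) X\<^esub> coboundary p X \<psi>"
    unfolding coboundary_def mult_cochain_group
    by (rule restrict_ext) (simp add: f distrib_left sum.distrib del: sum.atMost_Suc)
qed (simp add: carrier_cochain_group coboundary_extensional)

lemma subgroup_cocycles: "subgroup (cocycles p X) (cochain_group p X)"
  unfolding cocycles_def
  by (intro group_hom.subgroup_kernel group_hom.intro group_cochain_group)
     (simp add: group_hom_axioms_def coboundary_hom)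

lemma subgroup_coboundaries: "subgroup (coboundaries p X) (cochain_group p X)"
proof (cases p)
  case 0
  then show ?thesis using group.triv_subgroup[OF group_cochain_group] by (simp add: coboundaries_def)
next
  case (Suc n)
  interpret h: group_hom "cochain_group n X" "cochain_group p X" "coboundary n X"
    using Suc by (intro group_hom.intro group_cochain_group) (simp add: group_hom_axioms_def coboundary_hom)
  show ?thesis using h.img_is_subgroup by (simp add: coboundaries_def Suc)
qed

lemma coboundaries_subset_cocycles: "coboundaries p X \<subseteq> cocycles p X"
proof (cases p)
  case 0
  then show ?thesis using subgroup.one_closed[OF subgroup_cocycles, of 0 X] by (simp add: coboundaries_def)
next
  case (Suc n)
  have "cochain_eval (coboundary n X e) (chain_boundary (Suc (Suc n)) c) = 0"
    if "singular_chain (Suc (Suc n)) X c" for e c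
    using chain_boundary_boundary_Suc[OF that]
    by (simp add: eval_coboundary[OF singular_chain_boundary_alt[OF that]])
  then show ?thesis
    by (auto simp: Suc coboundaries_def cocycles_iff coboundary_extensional)
qed

definition cocycle_group :: "nat \<Rightarrow> 'a topology \<Rightarrow> 'a cochain monoid" where
  "cocycle_group p X = subgroup_generated (cochain_group p X) (cocycles p X)"

lemma carrier_cocycle_group [simp]: "carrier (cocycle_group p X) = cocycles p X"
  unfolding cocycle_group_def by (rule subgroup.carrier_subgroup_generated_subgroup[OF subgroup_cocycles])

lemma mult_cocycle_group [simp]: "mult (cocycle_group p X) = mult (cochain_group p X)"
  by (simp add: cocycle_group_def)

lemma comm_group_cocycle_group: "comm_group (cocycle_group p X)"
proof (rule group.group_comm_groupI)
  show "group (cocycle_group p X)"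
    unfolding cocycle_group_def by (rule group.group_subgroup_generated[OF group_cochain_group])
  fix x y assume "x \<in> carrier (cocycle_group p X)" "y \<in> carrier (cocycle_group p X)"
  then show "x \<otimes>\<^bsub>cocycle_group p X\<^esub> y = y \<otimes>\<^bsub>cocycle_group p X\<^esub> x"
    by (simp add: mult_cochain_group add.commute)
qed

lemma group_cocycle_group: "group (cocycle_group p X)"
  using comm_group_cocycle_group by (rule comm_group.axioms(2))

lemma subgroup_coboundaries': "subgroup (coboundaries p X) (cocycle_group p X)"
  using subgroup_coboundaries[of p X] coboundaries_subset_cocycles[of p X] carrier_cocycle_group[of p X]
  unfolding cocycle_group_def by (simp add: group.subgroup_subgroup_generated_iff[OF group_cochain_group])

lemma cohomology_group_eq: "cohomology_group p X = cocycle_group p X Mod coboundaries p X"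
  by (simp add: cohomology_group_def cocycle_group_def)

definition cohomology_class :: "nat \<Rightarrow> 'a topology \<Rightarrow> 'a cochain \<Rightarrow> 'a cochain set" where
  "cohomology_class p X \<phi> = coboundaries p X #>\<^bsub>cochain_group p X\<^esub> \<phi>"

lemma r_coset_cocycle_group: "coboundaries p X #>\<^bsub>cocycle_group p X\<^esub> \<phi> = cohomology_class p X \<phi>"
  by (simp add: cohomology_class_def r_coset_def)

lemma set_mult_cocycle_group: "A <#>\<^bsub>cocycle_group p X\<^esub> B = A <#>\<^bsub>cochain_group p X\<^esub> B"
  by (simp add: set_mult_def)

lemma carrier_cohomology_group: "carrier (cohomology_group p X) = cohomology_class p X ` cocycles p X"
  by (simp add: cohomology_group_eq carrier_FactGroup r_coset_cocycle_group)

lemma comm_group_cohomology_group: "comm_group (cohomology_group p X)"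
  unfolding cohomology_group_eq
  by (rule comm_group.abelian_FactGroup[OF comm_group_cocycle_group subgroup_coboundaries'])

lemma mult_cohomology_class:
  assumes "\<phi> \<in> cocycles p X" "\<psi> \<in> cocycles p X"
  shows "cohomology_class p X \<phi> \<otimes>\<^bsub>cohomology_group p X\<^esub> cohomology_class p X \<psi> =
    cohomology_class p X (\<phi> \<otimes>\<^bsub>cochain_group p X\<^esub> \<psi>)"
  using coset_mult[OF comm_group_cocycle_group subgroup_coboundaries', of \<phi> p X \<psi>] assms
  unfolding r_coset_cocycle_group cohomology_group_eq by simp

lemma trivial_cohomology_group:
  assumes "acyclic_at p X"
  shows "carrier (cohomology_group p X) = {\<one>\<^bsub>cohomology_group p X\<^esub>}"
proof -
  have "cohomology_class p X \<phi> = coboundaries p X" if "\<phi> \<in> cocycles p X" for \<phi>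
  proof -
    have "\<phi> \<in> coboundaries p X" using that assms by (auto simp: acyclic_at_def)
    then show ?thesis
      unfolding cohomology_class_def by (rule subgroup.rcos_const[OF subgroup_coboundaries group_cochain_group])
  qed
  moreover have "cocycles p X \<noteq> {}" using subgroup.one_closed[OF subgroup_cocycles[of p X]] by blast
  ultimately have "cohomology_class p X ` cocycles p X = {coboundaries p X}" by force
  moreover have "\<one>\<^bsub>cohomology_group p X\<^esub> = coboundaries p X" by (simp add: cohomology_group_eq)
  ultimately show ?thesis by (simp only: carrier_cohomology_group)
qed

subsection \<open>The cup product\<close>

text \<open>The inclusion of the standard simplex as the face spanned by the vertices from
  \<open>p\<close> on.\<close>

definition shift_simplex :: "nat \<Rightarrow> (nat \<Rightarrow> real) \<Rightarrow> nat \<Rightarrow> real" where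
  "shift_simplex p x = (\<lambda>i. if i < p then 0 else x (i - p))"

lemma back_face_eq: "back_face p q \<sigma> = restrict (\<lambda>x. \<sigma> (shift_simplex p x)) (standard_simplex q)"
  by (simp add: back_face_def shift_simplex_def)

lemma shift_simplex_in:
  assumes "x \<in> standard_simplex q"
  shows "shift_simplex p x \<in> standard_simplex (p + q)"
proof -
  have "(\<Sum>i\<le>p + q. if i < p then 0 else x (i - p)) = (\<Sum>i\<in>{p..p + q}. if i < p then 0 else x (i - p))"
    by (rule sum.mono_neutral_right) auto
  also have "\<dots> = (\<Sum>i\<in>{p..p + q}. x (i - p))" by (rule sum.cong) auto
  also have "\<dots> = (\<Sum>i\<le>q. x i)"
    by (rule sum.reindex_bij_witness[of _ "\<lambda>i. i + p" "\<lambda>i. i - p"]) auto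
  finally show ?thesis using assms by (auto simp: standard_simplex_def shift_simplex_def)
qed

lemma continuous_shift_simplex:
  "continuous_map (subtopology (powertop_real UNIV) (standard_simplex q))
     (subtopology (powertop_real UNIV) (standard_simplex (p + q))) (shift_simplex p)"
proof -
  have "continuous_map (powertop_real UNIV) euclideanreal (\<lambda>x. if i < p then 0 else x (i - p))" for i
    by (auto intro: continuous_map_product_projection)
  then have "continuous_map (powertop_real UNIV) (powertop_real UNIV) (shift_simplex p)"
    by (simp add: shift_simplex_def continuous_map_componentwise_UNIV)
  then show ?thesis
    by (auto simp: continuous_map_in_subtopology shift_simplex_in intro: continuous_map_from_subtopology)
qed

lemma singular_simplex_front_face:
  assumes "singular_simplex (p + q) X \<sigma>"
  shows "singular_simplex p X (front_face p \<sigma>)"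
proof -
  have "continuous_map (subtopology (powertop_real UNIV) (standard_simplex p)) X \<sigma>"
    using assms continuous_map_from_subtopology_mono[OF _ standard_simplex_mono[of p "p + q"]]
    by (auto simp: singular_simplex_def)
  then show ?thesis
    by (auto simp: singular_simplex_def front_face_def intro: continuous_map_eq)
qed

lemma singular_simplex_back_face:
  assumes "singular_simplex (p + q) X \<sigma>"
  shows "singular_simplex q X (back_face p q \<sigma>)"
proof -
  have "continuous_map (subtopology (powertop_real UNIV) (standard_simplex q)) X (\<sigma> \<circ> shift_simplex p)"
    using assms by (intro continuous_map_compose[OF continuous_shift_simplex]) (simp add: singular_simplex_def)
  then show ?thesis
    by (auto simp: singular_simplex_def back_face_eq o_def intro: continuous_map_eq)
qed

lemma simplical_face_Suc_in: "k \<le> Suc p \<Longrightarrow> x \<in> standard_simplex p \<Longrightarrow> simplical_face k x \<in> standard_simplex (Suc p)"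
  using simplical_face_in_standard_simplex[of "Suc p" k x] by simp

lemma front_face_singular_face:
  assumes "k \<le> Suc p"
  shows "front_face p (singular_face (Suc (p + q)) k \<sigma>) = singular_face (Suc p) k (front_face (Suc p) \<sigma>)"
  unfolding front_face_def singular_face_def diff_Suc_1 One_nat_def[symmetric]
  by (rule restrict_ext) (use assms standard_simplex_mono[of p "p + q"] in \<open>auto simp: simplical_face_Suc_in\<close>)

lemma front_face_singular_face_high:
  assumes "p < k"
  shows "front_face p (singular_face (Suc (p + q)) k \<sigma>) = front_face p \<sigma>"
  unfolding front_face_def
proof (rule restrict_ext)
  fix x assume x: "x \<in> standard_simplex p"
  then have "simplical_face k x = x"
    using assms by (auto simp: simplical_face_def standard_simplex_def fun_eq_iff)
  then show "singular_face (Suc (p + q)) k \<sigma> x = \<sigma> x"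
    using x standard_simplex_mono[of p "p + q"] by (auto simp: singular_face_def)
qed

lemma back_face_singular_face_low:
  assumes "k \<le> p"
  shows "back_face p q (singular_face (Suc (p + q)) k \<sigma>) = back_face (Suc p) q \<sigma>"
  unfolding back_face_eq
proof (rule restrict_ext)
  fix x assume x: "x \<in> standard_simplex q"
  have "simplical_face k (shift_simplex p x) = shift_simplex (Suc p) x"
    using assms by (auto simp: simplical_face_def shift_simplex_def fun_eq_iff)
  then show "singular_face (Suc (p + q)) k \<sigma> (shift_simplex p x) = \<sigma> (shift_simplex (Suc p) x)"
    using shift_simplex_in[OF x, of p] by (simp add: singular_face_def)
qed

lemma back_face_singular_face:
  assumes "j \<le> Suc q"
  shows "back_face p q (singular_face (Suc (p + q)) (p + j) \<sigma>) = singular_face (Suc q) j (back_face p (Suc q) \<sigma>)"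
  unfolding back_face_eq singular_face_def diff_Suc_1 One_nat_def[symmetric]
proof (rule restrict_ext)
  fix x assume x: "x \<in> standard_simplex q"
  have "simplical_face (p + j) (shift_simplex p x) = shift_simplex p (simplical_face j x)"
    by (auto simp: simplical_face_def shift_simplex_def fun_eq_iff)
  then show "restrict (\<sigma> \<circ> simplical_face (p + j)) (standard_simplex (p + q)) (shift_simplex p x) =
      (restrict (\<lambda>x. \<sigma> (shift_simplex p x)) (standard_simplex (Suc q)) \<circ> simplical_face j) x"
    using shift_simplex_in[OF x, of p] simplical_face_Suc_in[OF assms x] by simp
qed

lemma coboundary_apply:
  assumes "singular_simplex (Suc p) X \<sigma>"
  shows "coboundary p X \<phi> \<sigma> = (\<Sum>k\<le>Suc p. (-1) ^ k * \<phi> (singular_face (Suc p) k \<sigma>))"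
  using assms by (simp add: coboundary_def)

text \<open>The faces are split at \<open>p\<close>: the earlier ones come from faces of the front
  simplex, the later ones from faces of the back simplex. Each partial sum lacks one face of its
  coboundary, the last of the front and the first of the back; the two missing terms have the same
  absolute value and opposite signs.\<close>

lemma coboundary_cup:
  assumes \<sigma>: "singular_simplex (Suc (p + q)) X \<sigma>"
  shows "coboundary (p + q) X (cochain_cup X p q \<phi> \<psi>) \<sigma> =
    coboundary p X \<phi> (front_face (Suc p) \<sigma>) * \<psi> (back_face (Suc p) q \<sigma>) +
    (-1) ^ p * (\<phi> (front_face p \<sigma>) * coboundary q X \<psi> (back_face p (Suc q) \<sigma>))"
proof -
  have ff: "singular_simplex (Suc p) X (front_face (Suc p) \<sigma>)"
    using singular_simplex_front_face[of "Suc p" q X \<sigma>] \<sigma> by simp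
  have bf: "singular_simplex (Suc q) X (back_face p (Suc q) \<sigma>)"
    using singular_simplex_back_face[of p "Suc q" X \<sigma>] \<sigma> by simp
  let ?F = "\<phi> (front_face p \<sigma>)" and ?B = "\<psi> (back_face (Suc p) q \<sigma>)"
  let ?t = "\<lambda>k. (-1) ^ k * (\<phi> (front_face p (singular_face (Suc (p + q)) k \<sigma>)) *
    \<psi> (back_face p q (singular_face (Suc (p + q)) k \<sigma>)))"
  have cf: "cochain_cup X p q \<phi> \<psi> (singular_face (Suc (p + q)) k \<sigma>) =
      \<phi> (front_face p (singular_face (Suc (p + q)) k \<sigma>)) * \<psi> (back_face p q (singular_face (Suc (p + q)) k \<sigma>))"
    if "k \<le> Suc (p + q)" for k
    using singular_simplex_singular_face[OF \<sigma> _ that] by (simp add: cochain_cup_def)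
  have "coboundary (p + q) X (cochain_cup X p q \<phi> \<psi>) \<sigma> = (\<Sum>k\<le>Suc (p + q). ?t k)"
    unfolding coboundary_apply[OF \<sigma>] by (rule sum.cong) (simp_all add: cf)
  also have "{..Suc (p + q)} = {..p} \<union> {Suc p..Suc (p + q)}" by auto
  also have "(\<Sum>k\<in>\<dots>. ?t k) = (\<Sum>k\<le>p. ?t k) + (\<Sum>k=Suc p..Suc (p + q). ?t k)"
    by (rule sum.union_disjoint) auto
  also have "(\<Sum>k=Suc p..Suc (p + q). ?t k) = (\<Sum>j=Suc 0..Suc q. ?t (p + j))"
    by (rule sum.reindex_bij_witness[of _ "\<lambda>j. p + j" "\<lambda>k. k - p"]) auto
  also have "\<dots> = (\<Sum>j=Suc 0..Suc q. (-1) ^ p * (?F * ((-1) ^ j * \<psi> (singular_face (Suc q) j (back_face p (Suc q) \<sigma>)))))"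
    by (rule sum.cong) (auto simp: front_face_singular_face_high back_face_singular_face power_add)
  also have "\<dots> = (-1) ^ p * (?F * (\<Sum>j=Suc 0..Suc q. (-1) ^ j * \<psi> (singular_face (Suc q) j (back_face p (Suc q) \<sigma>))))"
    by (simp only: sum_distrib_left)
  also have "(\<Sum>j=Suc 0..Suc q. (-1) ^ j * \<psi> (singular_face (Suc q) j (back_face p (Suc q) \<sigma>))) =
      coboundary q X \<psi> (back_face p (Suc q) \<sigma>) - ?B"
  proof -
    have "singular_face (Suc q) 0 (back_face p (Suc q) \<sigma>) = back_face (Suc p) q \<sigma>"
      using back_face_singular_face[of 0 q p \<sigma>] back_face_singular_face_low[of p p q \<sigma>] by simp
    then show ?thesis
      unfolding coboundary_apply[OF bf] by (simp add: atMost_atLeast0 sum.atLeast_Suc_atMost del: sum.cl_ivl_Suc)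
  qed
  also have "(\<Sum>k\<le>p. ?t k) = (\<Sum>k\<le>p. (-1) ^ k * \<phi> (singular_face (Suc p) k (front_face (Suc p) \<sigma>))) * ?B"
    unfolding sum_distrib_right
    by (rule sum.cong) (auto simp: front_face_singular_face back_face_singular_face_low)
  also have "(\<Sum>k\<le>p. (-1) ^ k * \<phi> (singular_face (Suc p) k (front_face (Suc p) \<sigma>))) =
      coboundary p X \<phi> (front_face (Suc p) \<sigma>) + (-1) ^ p * ?F"
  proof -
    have "singular_face (Suc p) (Suc p) (front_face (Suc p) \<sigma>) = front_face p \<sigma>"
      using front_face_singular_face[of "Suc p" p q \<sigma>] front_face_singular_face_high[of p "Suc p" q \<sigma>] by simp
    then show ?thesis unfolding coboundary_apply[OF ff] by simp
  qed
  finally show ?thesis by (simp add: algebra_simps)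
qed

lemma cochain_cup_extensional: "cochain_cup X p q \<phi> \<psi> \<in> extensional (singular_simplex_set (p + q) X)"
  by (simp add: cochain_cup_def)

lemma cocycles_alt:
  "\<phi> \<in> cocycles p X \<longleftrightarrow> \<phi> \<in> extensional (singular_simplex_set p X) \<and>
    (\<forall>\<sigma>. singular_simplex (Suc p) X \<sigma> \<longrightarrow> coboundary p X \<phi> \<sigma> = 0)"
proof -
  have "coboundary p X \<phi> = (\<lambda>\<sigma>\<in>singular_simplex_set (Suc p) X. 0) \<longleftrightarrow>
      (\<forall>\<sigma>. singular_simplex (Suc p) X \<sigma> \<longrightarrow> coboundary p X \<phi> \<sigma> = 0)"
    (is "?l \<longleftrightarrow> ?r")
  proof
    assume ?r
    then show ?l by (intro extensionalityI[OF coboundary_extensional restrict_extensional]) auto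
  qed simp
  then show ?thesis
    by (simp add: cocycles_def kernel_def carrier_cochain_group one_cochain_group)
qed

lemma cup_cocycle:
  assumes "\<phi> \<in> cocycles p X" "\<psi> \<in> cocycles q X"
  shows "cochain_cup X p q \<phi> \<psi> \<in> cocycles (p + q) X"
  unfolding cocycles_alt[of _ "p + q"]
proof (intro conjI allI impI cochain_cup_extensional)
  fix \<sigma> assume \<sigma>: "singular_simplex (Suc (p + q)) X \<sigma>"
  have "singular_simplex (Suc p) X (front_face (Suc p) \<sigma>)" "singular_simplex (Suc q) X (back_face p (Suc q) \<sigma>)"
    using singular_simplex_front_face[of "Suc p" q X \<sigma>] singular_simplex_back_face[of p "Suc q" X \<sigma>] \<sigma> by auto
  then show "coboundary (p + q) X (cochain_cup X p q \<phi> \<psi>) \<sigma> = 0"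
    using assms by (simp add: coboundary_cup[OF \<sigma>] cocycles_alt)
qed

text \<open>By the Leibniz rule the product with the primitive is a primitive of the product, the
  other term vanishing on the cocycle. In degree 0 the only coboundary is zero.\<close>

lemma cup_coboundary_left:
  assumes "\<phi> \<in> coboundaries p X" "\<psi> \<in> cocycles q X"
  shows "cochain_cup X p q \<phi> \<psi> \<in> coboundaries (p + q) X"
proof (cases p)
  case 0
  then have "cochain_cup X p q \<phi> \<psi> = \<one>\<^bsub>cochain_group (p + q) X\<^esub>"
    using assms(1) singular_simplex_front_face[of 0 q X]
    by (auto simp: coboundaries_def one_cochain_group cochain_cup_def intro!: restrict_ext)
  then show ?thesis using subgroup.one_closed[OF subgroup_coboundaries] by simp
next
  case (Suc n)
  then obtain e where e: "\<phi> = coboundary n X e" using assms(1) by (auto simp: coboundaries_def)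
  have "cochain_cup X p q \<phi> \<psi> = coboundary (n + q) X (cochain_cup X n q e \<psi>)"
  proof (rule extensionalityI[where A = "singular_simplex_set (p + q) X"])
    fix \<sigma> assume "\<sigma> \<in> singular_simplex_set (p + q) X"
    then have \<sigma>: "singular_simplex (Suc (n + q)) X \<sigma>" by (simp add: Suc)
    have "singular_simplex (Suc q) X (back_face n (Suc q) \<sigma>)"
      using singular_simplex_back_face[of n "Suc q" X \<sigma>] \<sigma> by auto
    then show "cochain_cup X p q \<phi> \<psi> \<sigma> = coboundary (n + q) X (cochain_cup X n q e \<psi>) \<sigma>"
      using assms(2) \<sigma> by (simp add: coboundary_cup[OF \<sigma>] cocycles_alt cochain_cup_def[of X "Suc n" q] Suc e)
  qed (use coboundary_extensional[of "n + q" X] cochain_cup_extensional[of X "Suc n" q \<phi> \<psi>] in \<open>auto simp: Suc\<close>)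
  moreover have "cochain_cup X n q e \<psi> \<in> carrier (cochain_group (n + q) X)"
    by (simp add: carrier_cochain_group cochain_cup_extensional)
  ultimately show ?thesis by (simp add: coboundaries_def Suc)
qed

text \<open>As on the left, except that the Leibniz sign must be absorbed: the primitive is
  multiplied by (-1)^p.\<close>

lemma cup_coboundary_right:
  assumes "\<phi> \<in> cocycles p X" "\<psi> \<in> coboundaries q X"
  shows "cochain_cup X p q \<phi> \<psi> \<in> coboundaries (p + q) X"
proof (cases q)
  case 0
  then have "cochain_cup X p q \<phi> \<psi> = \<one>\<^bsub>cochain_group (p + q) X\<^esub>"
    using assms(2) singular_simplex_back_face[of p 0 X]
    by (auto simp: coboundaries_def one_cochain_group cochain_cup_def intro!: restrict_ext)
  then show ?thesis using subgroup.one_closed[OF subgroup_coboundaries] by simp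
next
  case (Suc n)
  then obtain e where e: "\<psi> = coboundary n X e" using assms(2) by (auto simp: coboundaries_def)
  let ?e = "\<lambda>\<tau>. (-1) ^ p * e \<tau>"
  have "cochain_cup X p q \<phi> \<psi> = coboundary (p + n) X (cochain_cup X p n \<phi> ?e)"
  proof (rule extensionalityI[where A = "singular_simplex_set (p + q) X"])
    fix \<sigma> assume "\<sigma> \<in> singular_simplex_set (p + q) X"
    then have \<sigma>: "singular_simplex (Suc (p + n)) X \<sigma>" by (simp add: Suc)
    have f: "singular_simplex (Suc p) X (front_face (Suc p) \<sigma>)"
      using singular_simplex_front_face[of "Suc p" n X \<sigma>] \<sigma> by auto
    have b: "singular_simplex (Suc n) X (back_face p (Suc n) \<sigma>)"
      using singular_simplex_back_face[of p "Suc n" X \<sigma>] \<sigma> by auto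
    have "coboundary n X ?e (back_face p (Suc n) \<sigma>) = (-1) ^ p * coboundary n X e (back_face p (Suc n) \<sigma>)"
      unfolding coboundary_apply[OF b] sum_distrib_left by (rule sum.cong) auto
    moreover have "(-1) ^ p * (x * ((-1) ^ p * y)) = x * y" for x y :: int
      by (cases "even p") auto
    ultimately show "cochain_cup X p q \<phi> \<psi> \<sigma> = coboundary (p + n) X (cochain_cup X p n \<phi> ?e) \<sigma>"
      using assms(1) \<sigma> f
      by (simp add: coboundary_cup[OF \<sigma>] cocycles_alt cochain_cup_def[of X p "Suc n"] Suc e)
  qed (use coboundary_extensional[of "p + n" X] cochain_cup_extensional[of X p "Suc n" \<phi> \<psi>] in \<open>auto simp: Suc\<close>)
  moreover have "cochain_cup X p n \<phi> ?e \<in> carrier (cochain_group (p + n) X)"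
    by (simp add: carrier_cochain_group cochain_cup_extensional)
  ultimately show ?thesis by (simp add: coboundaries_def Suc)
qed

lemma cochain_cup_hom:
  shows "\<psi> \<in> cocycles q X \<Longrightarrow> (\<lambda>\<phi>. cochain_cup X p q \<phi> \<psi>) \<in> hom (cocycle_group p X) (cocycle_group (p + q) X)"
    and "\<phi> \<in> cocycles p X \<Longrightarrow> cochain_cup X p q \<phi> \<in> hom (cocycle_group q X) (cocycle_group (p + q) X)"
proof -
  have "cochain_cup X p q (\<phi> \<otimes>\<^bsub>cochain_group p X\<^esub> \<phi>') \<psi> =
      cochain_cup X p q \<phi> \<psi> \<otimes>\<^bsub>cochain_group (p + q) X\<^esub> cochain_cup X p q \<phi>' \<psi>" for \<phi> \<phi>' \<psi>
    unfolding cochain_cup_def mult_cochain_group using singular_simplex_front_face[of p q X]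
    by (intro restrict_ext) (simp add: algebra_simps)
  then show "\<psi> \<in> cocycles q X \<Longrightarrow> (\<lambda>\<phi>. cochain_cup X p q \<phi> \<psi>) \<in> hom (cocycle_group p X) (cocycle_group (p + q) X)"
    by (intro homI) (simp_all add: cup_cocycle)
  have "cochain_cup X p q \<phi> (\<psi> \<otimes>\<^bsub>cochain_group q X\<^esub> \<psi>') =
      cochain_cup X p q \<phi> \<psi> \<otimes>\<^bsub>cochain_group (p + q) X\<^esub> cochain_cup X p q \<phi> \<psi>'" for \<phi> \<psi> \<psi>'
    unfolding cochain_cup_def mult_cochain_group using singular_simplex_back_face[of p q X]
    by (intro restrict_ext) (simp add: algebra_simps)
  then show "\<phi> \<in> cocycles p X \<Longrightarrow> cochain_cup X p q \<phi> \<in> hom (cocycle_group q X) (cocycle_group (p + q) X)"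
    by (intro homI) (simp_all add: cup_cocycle)
qed

lemma cup_cohomology_class:
  assumes "\<phi> \<in> cocycles p X" "\<psi> \<in> cocycles q X"
  shows "cup X p q (cohomology_class p X \<phi>) (cohomology_class q X \<psi>) =
    cohomology_class (p + q) X (cochain_cup X p q \<phi> \<psi>)"
proof -
  have "coboundaries (p + q) X <#>\<^bsub>cocycle_group (p + q) X\<^esub> {cochain_cup X p q a b | a b.
      a \<in> coboundaries p X #>\<^bsub>cocycle_group p X\<^esub> \<phi> \<and> b \<in> coboundaries q X #>\<^bsub>cocycle_group q X\<^esub> \<psi>} =
    coboundaries (p + q) X #>\<^bsub>cocycle_group (p + q) X\<^esub> cochain_cup X p q \<phi> \<psi>"
    by (rule induced_coset_bilinear)
       (simp_all add: comm_group_cocycle_group group_cocycle_group subgroup_coboundaries' assms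
         cochain_cup_hom cup_coboundary_left cup_coboundary_right)
  then show ?thesis
    unfolding cup_def r_coset_cocycle_group set_mult_cocycle_group .
qed

definition unit_cochain :: "'a topology \<Rightarrow> 'a cochain" where
  "unit_cochain X = (\<lambda>\<sigma>\<in>singular_simplex_set 0 X. 1)"

lemma unit_cocycle: "unit_cochain X \<in> cocycles 0 X"
  unfolding cocycles_alt
proof (intro conjI allI impI)
  fix \<sigma> assume \<sigma>: "singular_simplex (Suc 0) X \<sigma>"
  then show "coboundary 0 X (unit_cochain X) \<sigma> = 0"
    using singular_simplex_singular_face[OF \<sigma>, of 0] singular_simplex_singular_face[OF \<sigma>, of 1]
    by (simp add: coboundary_apply unit_cochain_def)
qed (simp add: unit_cochain_def)

lemma cohomology_ring_simps:
  "gpart (cohomology_ring X) p = cohomology_group p X" "gmult (cohomology_ring X) = cup X"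
  "gone (cohomology_ring X) = cohomology_class 0 X (unit_cochain X)"
  by (simp_all add: cohomology_ring_def cohomology_class_def unit_cochain_def)

lemma cohomology_groupE:
  assumes "a \<in> carrier (cohomology_group p X)"
  obtains \<phi> where "\<phi> \<in> cocycles p X" "a = cohomology_class p X \<phi>"
  using assms unfolding carrier_cohomology_group by blast

lemma cocycles_mult: "\<phi> \<in> cocycles p X \<Longrightarrow> \<psi> \<in> cocycles p X \<Longrightarrow> \<phi> \<otimes>\<^bsub>cochain_group p X\<^esub> \<psi> \<in> cocycles p X"
  by (rule subgroup.m_closed[OF subgroup_cocycles])

lemma graded_pieces_cohomology_ring: "graded_pieces (cohomology_ring X)"
proof (rule graded_pieces.intro)
  have cl: "cohomology_class p X \<phi> \<in> carrier (cohomology_group p X)" if "\<phi> \<in> cocycles p X" for p \<phi>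
    using that by (simp add: carrier_cohomology_group)
  show "comm_group (gpart (cohomology_ring X) p)" for p
    by (simp add: cohomology_ring_simps comm_group_cohomology_group)
  show "gone (cohomology_ring X) \<in> carrier (gpart (cohomology_ring X) 0)"
    by (simp add: cohomology_ring_simps cl unit_cocycle)
  fix p q a a' b b'
  assume a: "a \<in> carrier (gpart (cohomology_ring X) p)" and b: "b \<in> carrier (gpart (cohomology_ring X) q)"
  from a obtain \<phi> where \<phi>: "\<phi> \<in> cocycles p X" "a = cohomology_class p X \<phi>"
    unfolding cohomology_ring_simps by (elim cohomology_groupE)
  from b obtain \<psi> where \<psi>: "\<psi> \<in> cocycles q X" "b = cohomology_class q X \<psi>"
    unfolding cohomology_ring_simps by (elim cohomology_groupE)
  show "gmult (cohomology_ring X) p q a b \<in> carrier (gpart (cohomology_ring X) (p + q))"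
    by (simp add: cohomology_ring_simps \<phi> \<psi> cup_cohomology_class cl cup_cocycle)
  show "gmult (cohomology_ring X) p q (a \<otimes>\<^bsub>gpart (cohomology_ring X) p\<^esub> a') b =
      gmult (cohomology_ring X) p q a b \<otimes>\<^bsub>gpart (cohomology_ring X) (p + q)\<^esub> gmult (cohomology_ring X) p q a' b"
    if a': "a' \<in> carrier (gpart (cohomology_ring X) p)"
  proof -
    obtain \<phi>' where \<phi>': "\<phi>' \<in> cocycles p X" "a' = cohomology_class p X \<phi>'"
      using a' unfolding cohomology_ring_simps by (elim cohomology_groupE)
    show ?thesis
      using hom_mult[OF cochain_cup_hom(1)[OF \<psi>(1), of p], of \<phi> \<phi>'] \<phi>(1) \<phi>'(1) \<psi>(1)
      by (simp add: cohomology_ring_simps \<phi>(2) \<phi>'(2) \<psi>(2) cup_cohomology_class mult_cohomology_class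
          cup_cocycle cocycles_mult)
  qed
  show "gmult (cohomology_ring X) p q a (b \<otimes>\<^bsub>gpart (cohomology_ring X) q\<^esub> b') =
      gmult (cohomology_ring X) p q a b \<otimes>\<^bsub>gpart (cohomology_ring X) (p + q)\<^esub> gmult (cohomology_ring X) p q a b'"
    if b': "b' \<in> carrier (gpart (cohomology_ring X) q)"
  proof -
    obtain \<psi>' where \<psi>': "\<psi>' \<in> cocycles q X" "b' = cohomology_class q X \<psi>'"
      using b' unfolding cohomology_ring_simps by (elim cohomology_groupE)
    show ?thesis
      using hom_mult[OF cochain_cup_hom(2)[OF \<phi>(1), of q], of \<psi> \<psi>'] \<phi>(1) \<psi>'(1) \<psi>(1)
      by (simp add: cohomology_ring_simps \<phi>(2) \<psi>'(2) \<psi>(2) cup_cohomology_class mult_cohomology_class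
          cup_cocycle cocycles_mult)
  qed
qed

subsection \<open>Induced maps\<close>

definition pullback :: "nat \<Rightarrow> 'a topology \<Rightarrow> ('a \<Rightarrow> 'b) \<Rightarrow> 'b cochain \<Rightarrow> 'a cochain" where
  "pullback p X f \<phi> = (\<lambda>\<sigma>\<in>singular_simplex_set p X. \<phi> (simplex_map p f \<sigma>))"

lemma eval_pullback:
  assumes "singular_chain p X c"
  shows "cochain_eval (pullback p X f \<phi>) c = cochain_eval \<phi> (chain_map p f c)"
  unfolding cochain_eval_chain_map[symmetric]
  by (rule cochain_eval_cong_chain[OF assms]) (simp add: pullback_def)

lemma pullback_cocycle:
  assumes f: "continuous_map X Y f" and "\<phi> \<in> cocycles p Y"
  shows "pullback p X f \<phi> \<in> cocycles p X"
  unfolding cocycles_iff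
proof (intro conjI allI impI)
  fix c assume c: "singular_chain (Suc p) X c"
  have "cochain_eval (pullback p X f \<phi>) (chain_boundary (Suc p) c) =
      cochain_eval \<phi> (chain_boundary (Suc p) (chain_map (Suc p) f c))"
    using chain_boundary_chain_map[OF c, of f] eval_pullback[OF singular_chain_boundary_alt[OF c]] by simp
  also have "\<dots> = 0" using assms(2) singular_chain_chain_map[OF c f] by (simp add: cocycles_iff)
  finally show "cochain_eval (pullback p X f \<phi>) (chain_boundary (Suc p) c) = 0" .
qed (simp add: pullback_def)

lemma pullback_coboundary:
  assumes f: "continuous_map X Y f" and "\<phi> \<in> coboundaries p Y"
  shows "pullback p X f \<phi> \<in> coboundaries p X"
proof (cases p)
  case 0
  then show ?thesis
    using assms singular_simplex_simplex_map[OF _ f]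
    by (auto simp: coboundaries_def one_cochain_group pullback_def intro!: restrict_ext)
next
  case (Suc n)
  obtain e where e: "\<And>\<sigma>. singular_simplex p Y \<sigma> \<Longrightarrow> \<phi> \<sigma> = cochain_eval e (chain_boundary p (frag_of \<sigma>))"
    using assms(2) unfolding Suc coboundaries_Suc_iff by blast
  have "pullback p X f \<phi> \<sigma> = cochain_eval (pullback n X f e) (chain_boundary p (frag_of \<sigma>))"
    if "singular_simplex p X \<sigma>" for \<sigma>
  proof -
    have c: "singular_chain (Suc n) X (frag_of \<sigma>)" using that by (simp add: singular_chain_of Suc)
    show ?thesis
      using chain_boundary_chain_map[OF c, of f] eval_pullback[OF singular_chain_boundary_alt[OF c], of f e]
        e[OF singular_simplex_simplex_map[OF that f]] that
      by (simp add: pullback_def[of "Suc n" X f \<phi>] Suc)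
  qed
  then show ?thesis
    unfolding Suc coboundaries_Suc_iff by (auto simp: pullback_def[of "Suc n" X f \<phi>])
qed

lemma pullback_hom:
  assumes "continuous_map X Y f"
  shows "pullback p X f \<in> hom (cocycle_group p Y) (cocycle_group p X)"
proof (rule homI)
  fix \<phi> \<psi>
  show "pullback p X f (\<phi> \<otimes>\<^bsub>cocycle_group p Y\<^esub> \<psi>) =
      pullback p X f \<phi> \<otimes>\<^bsub>cocycle_group p X\<^esub> pullback p X f \<psi>"
    unfolding mult_cocycle_group mult_cochain_group pullback_def
    using singular_simplex_simplex_map[OF _ assms] by (intro restrict_ext) simp
qed (simp add: pullback_cocycle[OF assms])

text \<open>Reduces functoriality and multiplicativity in cohomology to identities between pulled
  back cocycles.\<close>

lemma cohomology_map_class: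
  assumes f: "continuous_map X Y f" and \<phi>: "\<phi> \<in> cocycles p Y"
  shows "cohomology_map X f p (cohomology_class p Y \<phi>) = cohomology_class p X (pullback p X f \<phi>)"
  using induced_coset[OF group_cocycle_group group_cocycle_group subgroup_coboundaries' subgroup_coboundaries'
      pullback_hom[OF f], of p \<phi>] \<phi> pullback_coboundary[OF f]
  unfolding r_coset_cocycle_group set_mult_cocycle_group cohomology_map_def pullback_def
  by auto

lemma front_face_simplex_map:
  "front_face p (simplex_map (p + q) f \<sigma>) = simplex_map p f (front_face p \<sigma>)"
  unfolding front_face_def simplex_map_def
  by (rule restrict_ext) (use standard_simplex_mono[of p "p + q"] in auto)

lemma back_face_simplex_map:
  "back_face p q (simplex_map (p + q) f \<sigma>) = simplex_map q f (back_face p q \<sigma>)"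
  unfolding back_face_eq simplex_map_def
  by (rule restrict_ext) (auto simp: shift_simplex_in)

lemma pullback_cup:
  assumes f: "continuous_map X Y f"
  shows "pullback (p + q) X f (cochain_cup Y p q \<phi> \<psi>) = cochain_cup X p q (pullback p X f \<phi>) (pullback q X f \<psi>)"
  unfolding pullback_def[of "p + q"] cochain_cup_def[of X]
  using singular_simplex_simplex_map[OF _ f] singular_simplex_front_face[of p q X] singular_simplex_back_face[of p q X]
  by (intro restrict_ext)
     (simp add: cochain_cup_def pullback_def front_face_simplex_map back_face_simplex_map)

lemma graded_hom_cohomology_map:
  assumes f: "continuous_map X Y f"
  shows "graded_hom (cohomology_ring Y) (cohomology_ring X) (cohomology_map X f)"
  unfolding graded_hom_def cohomology_ring_simps
proof (intro conjI allI ballI)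
  have cl: "cohomology_class p X \<phi> \<in> carrier (cohomology_group p X)" if "\<phi> \<in> cocycles p X" for p \<phi>
    using that by (simp add: carrier_cohomology_group)
  note P = pullback_cocycle[OF f]
  show "cohomology_map X f p \<in> hom (cohomology_group p Y) (cohomology_group p X)" for p
  proof (rule homI)
    show "cohomology_map X f p a \<in> carrier (cohomology_group p X)" if "a \<in> carrier (cohomology_group p Y)" for a
      using that by (elim cohomology_groupE) (simp add: cohomology_map_class[OF f] cl P)
    fix a b assume "a \<in> carrier (cohomology_group p Y)" "b \<in> carrier (cohomology_group p Y)"
    then obtain \<phi> \<psi> where \<phi>: "\<phi> \<in> cocycles p Y" "a = cohomology_class p Y \<phi>"
      and \<psi>: "\<psi> \<in> cocycles p Y" "b = cohomology_class p Y \<psi>" by (elim cohomology_groupE)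
    then show "cohomology_map X f p (a \<otimes>\<^bsub>cohomology_group p Y\<^esub> b) =
        cohomology_map X f p a \<otimes>\<^bsub>cohomology_group p X\<^esub> cohomology_map X f p b"
      using hom_mult[OF pullback_hom[OF f, of p], of \<phi> \<psi>]
      by (simp add: mult_cohomology_class cohomology_map_class[OF f] P cocycles_mult)
  qed
  show "cohomology_map X f (p + q) (cup Y p q a b) = cup X p q (cohomology_map X f p a) (cohomology_map X f q b)"
    if a: "a \<in> carrier (cohomology_group p Y)" and b: "b \<in> carrier (cohomology_group q Y)" for p q a b
  proof -
    obtain \<phi> where \<phi>: "\<phi> \<in> cocycles p Y" "a = cohomology_class p Y \<phi>" using a by (elim cohomology_groupE)
    obtain \<psi> where \<psi>: "\<psi> \<in> cocycles q Y" "b = cohomology_class q Y \<psi>" using b by (elim cohomology_groupE)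
    show ?thesis
      using \<phi>(1) \<psi>(1)
      by (simp add: \<phi>(2) \<psi>(2) cup_cohomology_class cohomology_map_class[OF f] P cup_cocycle pullback_cup[OF f])
  qed
  have "pullback 0 X f (unit_cochain Y) = unit_cochain X"
    using singular_simplex_simplex_map[OF _ f]
    by (auto simp: pullback_def unit_cochain_def intro!: restrict_ext)
  then show "cohomology_map X f 0 (cohomology_class 0 Y (unit_cochain Y)) = cohomology_class 0 X (unit_cochain X)"
    by (simp add: cohomology_map_class[OF f] unit_cocycle)
qed

lemma cohomology_map_comp:
  assumes f: "continuous_map X Y f" and g: "continuous_map Y Z g" and a: "a \<in> carrier (cohomology_group p Z)"
  shows "cohomology_map X (\<lambda>x. g (f x)) p a = cohomology_map X f p (cohomology_map Y g p a)"
proof -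
  obtain \<phi> where \<phi>: "\<phi> \<in> cocycles p Z" "a = cohomology_class p Z \<phi>" using a by (elim cohomology_groupE)
  have gf: "continuous_map X Z (\<lambda>x. g (f x))"
    using continuous_map_compose[OF f g] by (simp add: o_def)
  have "pullback p X (\<lambda>x. g (f x)) \<phi> = pullback p X f (pullback p Y g \<phi>)"
    unfolding pullback_def
    using singular_simplex_simplex_map[OF _ f] fun_cong[OF simplex_map_compose[of p g f]]
    by (intro restrict_ext) (simp add: o_def)
  then show ?thesis
    using \<phi>(1) by (simp add: \<phi>(2) cohomology_map_class[OF gf] cohomology_map_class[OF f]
        cohomology_map_class[OF g] pullback_cocycle[OF g])
qed

lemma cohomology_map_ident:
  assumes a: "a \<in> carrier (cohomology_group p X)"
  shows "cohomology_map X (\<lambda>x. x) p a = a"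
proof -
  obtain \<phi> where \<phi>: "\<phi> \<in> cocycles p X" "a = cohomology_class p X \<phi>" using a by (elim cohomology_groupE)
  have "pullback p X (\<lambda>x. x) \<phi> = \<phi>"
    using \<phi>(1) simplex_map_id_gen[of p X _ "\<lambda>x. x"]
    by (intro extensionalityI[where A = "singular_simplex_set p X"]) (auto simp: pullback_def cocycles_alt)
  then show ?thesis
    using \<phi>(1) cohomology_map_class[of X X "\<lambda>x. x" \<phi> p] by (simp add: \<phi>(2))
qed

section \<open>Characters of the torus\<close>

definition monomial :: "('d \<Rightarrow> int) \<Rightarrow> complex ^ 'd \<Rightarrow> complex" where
  "monomial m z = (\<Prod>i\<in>UNIV. (z $ i) powi m i)"

lemma monomial_mult: "monomial m (z * w) = monomial m z * monomial m w"
  by (simp add: monomial_def power_int_mult_distrib prod.distrib)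

lemma torus_mult: "z \<in> torus \<Longrightarrow> w \<in> torus \<Longrightarrow> z * w \<in> torus"
  by (simp add: torus_def)

lemma one_in_torus: "1 \<in> torus"
  by (simp add: torus_def)

lemma monomial_one [simp]: "monomial m 1 = 1"
  by (simp add: monomial_def)

lemma monomials_distinct:
  assumes "m \<noteq> n"
  obtains z where "z \<in> torus" "monomial m z \<noteq> monomial n z"
proof -
  obtain j where j: "m j \<noteq> n j" using assms by auto
  \<comment> \<open>The powers of 2 with different integer exponents have different absolute values,
    so one coordinate equal to 2 separates the monomials.\<close>
  define z :: "complex ^ 'a" where "z = (\<chi> i. if i = j then 2 else 1)"
  have val: "monomial k z = 2 powi k j" for k
  proof -
    have "monomial k z = (\<Prod>i\<in>UNIV. if i = j then 2 powi k j else 1)"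
      unfolding monomial_def z_def by (rule prod.cong) auto
    then show ?thesis by simp
  qed
  have "norm ((2::complex) powi m j) \<noteq> norm ((2::complex) powi n j)"
    using j power_int_strict_increasing[of "m j" "n j" "2::real"]
      power_int_strict_increasing[of "n j" "m j" "2::real"]
    by (cases "m j" "n j" rule: linorder_cases) (auto simp: norm_power_int)
  then have "monomial m z \<noteq> monomial n z" unfolding val by metis
  moreover have "z \<in> torus" by (simp add: z_def torus_def)
  ultimately show ?thesis by (rule that[rotated])
qed

text \<open>Dedekind's argument: substitute \<open>w * z\<close> and subtract
  \<open>monomial n w\<close> times the original relation. The term of \<open>n\<close> disappears,
  and the coefficient of each other \<open>m\<close> is multiplied by a number that is nonzero when
  \<open>w\<close> separates \<open>m\<close> from \<open>n\<close>.\<close>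

lemma monomials_independent:
  assumes "finite S" "\<And>z. z \<in> torus \<Longrightarrow> (\<Sum>m\<in>S. c m * monomial m z) = 0" "m \<in> S"
  shows "c m = 0"
  using assms
proof (induction S arbitrary: c m rule: finite_induct)
  case (insert n S)
  have S0: "c m = 0" if m: "m \<in> S" for m
  proof -
    have "m \<noteq> n" using m insert.hyps by auto
    then obtain w where w: "w \<in> torus" "monomial m w \<noteq> monomial n w" by (rule monomials_distinct)
    have "(\<Sum>m\<in>S. c m * (monomial m w - monomial n w) * monomial m z) = 0" if z: "z \<in> torus" for z
    proof -
      have "(\<Sum>m\<in>S. c m * (monomial m w - monomial n w) * monomial m z) =
          (\<Sum>m\<in>insert n S. c m * (monomial m w - monomial n w) * monomial m z)"
        using insert.hyps by simp
      also have "\<dots> = (\<Sum>m\<in>insert n S. c m * monomial m (w * z)) -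
          monomial n w * (\<Sum>m\<in>insert n S. c m * monomial m z)"
        unfolding sum_distrib_left sum_subtractf[symmetric]
        by (rule sum.cong) (auto simp: monomial_mult algebra_simps)
      also have "\<dots> = 0"
        using insert.prems(1)[OF torus_mult[OF w(1) z]] insert.prems(1)[OF z] by simp
      finally show ?thesis .
    qed
    from insert.IH[OF this m] show ?thesis using w(2) by simp
  qed
  have "c n = 0" using insert.prems(1)[OF one_in_torus] insert.hyps S0 by simp
  with S0 insert.prems(2) show ?case by auto
qed simp

text \<open>Comparing f(w z) with f(w) f(z) gives a linear relation between monomials in z with
  coefficients c(m) (m(w) - f(w)). By independence, any \<open>m\<close> with nonzero coefficient in
  the Laurent polynomial satisfies f(w) = m(w) for all w.\<close>

lemma torus_character_monomial:
  assumes "torus_character f"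
  obtains m where "\<And>z. z \<in> torus \<Longrightarrow> f z = monomial m z"
proof -
  obtain S c where S: "finite S" and f: "\<And>z. z \<in> torus \<Longrightarrow> f z = (\<Sum>m\<in>S. c m * monomial m z)"
    using assms by (auto simp: torus_character_def regular_on_torus_def monomial_def)
  have mult: "\<And>z w. z \<in> torus \<Longrightarrow> w \<in> torus \<Longrightarrow> f (z * w) = f z * f w"
    and ne: "\<And>z. z \<in> torus \<Longrightarrow> f z \<noteq> 0"
    using assms by (auto simp: torus_character_def)
  have "f 1 \<noteq> 0" by (rule ne[OF one_in_torus])
  then obtain m where m: "m \<in> S" "c m \<noteq> 0"
    unfolding f[OF one_in_torus] by (metis (no_types, lifting) mult_zero_left sum.neutral)
  have "f w = monomial m w" if w: "w \<in> torus" for w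
  proof -
    have "(\<Sum>m\<in>S. c m * (monomial m w - f w) * monomial m z) = 0" if z: "z \<in> torus" for z
    proof -
      have "(\<Sum>m\<in>S. c m * (monomial m w - f w) * monomial m z) =
          (\<Sum>m\<in>S. c m * monomial m (w * z)) - f w * (\<Sum>m\<in>S. c m * monomial m z)"
        unfolding sum_distrib_left sum_subtractf[symmetric]
        by (rule sum.cong) (auto simp: monomial_mult algebra_simps)
      also have "\<dots> = f (w * z) - f w * f z"
        by (simp add: f[OF torus_mult[OF w z]] f[OF z])
      finally show ?thesis using mult[OF w z] by simp
    qed
    from monomials_independent[OF S this m(1)] m(2) show ?thesis by simp
  qed
  then show ?thesis by (rule that)
qed

lemma exp_cover_add: "exp_cover (v + w) = exp_cover v * exp_cover w"
  by (simp add: exp_cover_def vec_eq_iff exp_add)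

lemma exp_cover_in_torus [simp]: "exp_cover w \<in> torus"
  by (simp add: exp_cover_def torus_def)

lemma exp_cover_0 [simp]: "exp_cover 0 = 1"
  by (simp add: exp_cover_def vec_eq_iff)

lemma torusE:
  assumes "z \<in> torus"
  obtains w where "z = exp_cover w"
proof
  show "z = exp_cover (\<chi> i. Ln (z $ i))"
    using assms by (simp add: exp_cover_def torus_def vec_eq_iff)
qed

lemma continuous_on_exp_cover: "continuous_on S exp_cover"
  unfolding exp_cover_def by (intro continuous_intros)

lemma continuous_on_vec_mult [continuous_intros]:
  fixes f g :: "'b::topological_space \<Rightarrow> complex ^ 'd"
  shows "continuous_on S f \<Longrightarrow> continuous_on S g \<Longrightarrow> continuous_on S (\<lambda>x. f x * g x)"
  unfolding times_vec_def by (intro continuous_intros)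

lemma monomial_exp_cover: "monomial m (exp_cover w) = exp (pairing (\<chi> i. of_int (m i)) w)"
  by (simp add: monomial_def exp_cover_def pairing_def exp_power_int exp_sum)

section \<open>Layers as cosets of subtori\<close>

text \<open>The coset through \<open>z\<close> of the subgroup exp(\<open>V\<close>) of the torus.
  For a general subspace it need not be closed; for the spaces \<open>dirs\<close> it turns out to
  be a component.\<close>

definition leaf :: "(complex ^ 'd) set \<Rightarrow> complex ^ 'd \<Rightarrow> (complex ^ 'd) set" where
  "leaf V z = (\<lambda>v. z * exp_cover v) ` V"

lemma leaf_self: "vec.subspace V \<Longrightarrow> z \<in> leaf V z"
  unfolding leaf_def by (rule image_eqI[of _ _ 0]) (auto simp: vec.subspace_0)

lemma leaf_mono: "V \<subseteq> V' \<Longrightarrow> leaf V z \<subseteq> leaf V' z"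
  by (auto simp: leaf_def)

lemma leaf_eq:
  assumes V: "vec.subspace V" and z': "z' \<in> leaf V z"
  shows "leaf V z' = leaf V z"
proof -
  obtain v where v: "v \<in> V" "z' = z * exp_cover v" using z' by (auto simp: leaf_def)
  have 1: "z' * exp_cover u = z * exp_cover (v + u)" for u
    by (simp add: v exp_cover_add mult.assoc)
  have 2: "z * exp_cover u = z' * exp_cover (u - v)" for u
    unfolding 1 by simp
  show ?thesis
  proof
    show "leaf V z' \<subseteq> leaf V z"
      unfolding leaf_def by (intro image_subsetI, subst 1, rule imageI, rule vec.subspace_add[OF V v(1)])
    show "leaf V z \<subseteq> leaf V z'"
      unfolding leaf_def by (intro image_subsetI, subst 2, rule imageI, rule vec.subspace_diff[OF V _ v(1)])
  qed
qed

lemma connected_leaf: "vec.subspace V \<Longrightarrow> connected (leaf V z)"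
  unfolding leaf_def
  by (intro connected_continuous_image continuous_intros continuous_on_exp_cover
      convex_connected convex_complex_subspace)

text \<open>Principal logarithms of the coordinatewise quotient. On the torus this is a right
  inverse of v -> z exp(v), and it is continuous near \<open>z\<close>.\<close>

definition log_ratio :: "complex ^ 'd \<Rightarrow> complex ^ 'd \<Rightarrow> complex ^ 'd" where
  "log_ratio z z' = (\<chi> i. Ln (z' $ i / z $ i))"

lemma exp_cover_log_ratio: "z \<in> torus \<Longrightarrow> z' \<in> torus \<Longrightarrow> z * exp_cover (log_ratio z z') = z'"
  by (simp add: log_ratio_def exp_cover_def torus_def vec_eq_iff)

text \<open>The periods of exp are the multiples of 2 pi i. This gap is the source of the constant 2
  pi in the arguments about components.\<close>

lemma exp_eq_1_small:
  fixes s :: complex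
  assumes "exp s = 1" "norm s < 2 * pi"
  shows "s = 0"
proof -
  obtain n :: int where n: "s = complex_of_real (of_int (2 * n) * pi) * \<i>"
    using assms(1) exp_eq[of s 0] by auto
  have "norm s = 2 * pi * \<bar>of_int n\<bar>" by (simp add: n norm_mult abs_mult)
  then have "\<bar>of_int n\<bar> < (1::real)" using assms(2) by simp
  then have "n = 0" by linarith
  then show ?thesis by (simp add: n)
qed

text \<open>The vector \<open>c Y\<close> is the exponent of the character defining
  \<open>Y\<close>, seen on the universal cover. That its entries are real, a trace of their
  integrality, later allows the real and imaginary parts of a lift to be adjusted
  separately.\<close>

locale toric_data =
  fixes \<A> :: "(complex ^ 'd) set set" and c :: "(complex ^ 'd) set \<Rightarrow> complex ^ 'd"
    and a :: "(complex ^ 'd) set \<Rightarrow> complex"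
  assumes finite_arrangement: "finite \<A>"
    and mem_Y: "Y \<in> \<A> \<Longrightarrow> exp_cover w \<in> Y \<longleftrightarrow> exp (pairing (c Y) w) = a Y"
    and c_nonzero: "Y \<in> \<A> \<Longrightarrow> c Y \<noteq> 0"
    and a_nonzero: "Y \<in> \<A> \<Longrightarrow> a Y \<noteq> 0"
    and c_real: "Y \<in> \<A> \<Longrightarrow> c Y $ i \<in> \<real>"
begin

definition "dirs \<S> = common_kernel (c ` \<S>)"

definition "locus \<S> = torus \<inter> \<Inter>\<S>"

lemma subspace_dirs: "vec.subspace (dirs \<S>)"
  unfolding dirs_def by (rule subspace_common_kernel)

lemma mem_dirs: "v \<in> dirs \<S> \<longleftrightarrow> (\<forall>Y\<in>\<S>. pairing (c Y) v = 0)"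
  by (simp add: dirs_def common_kernel_def)

lemma dirs_Un: "dirs (\<S> \<union> \<T>) = dirs \<S> \<inter> dirs \<T>"
  by (auto simp: mem_dirs)

lemma mem_locus: "\<S> \<subseteq> \<A> \<Longrightarrow> exp_cover w \<in> locus \<S> \<longleftrightarrow> (\<forall>Y\<in>\<S>. exp (pairing (c Y) w) = a Y)"
  using mem_Y by (auto simp: locus_def)

lemma locus_mult:
  assumes "\<S> \<subseteq> \<A>" "z \<in> locus \<S>"
  shows "z * exp_cover v \<in> locus \<S> \<longleftrightarrow> (\<forall>Y\<in>\<S>. exp (pairing (c Y) v) = 1)"
proof -
  obtain w where w: "z = exp_cover w" using assms(2) by (auto simp: locus_def elim: torusE)
  have "z * exp_cover v = exp_cover (w + v)" by (simp add: w exp_cover_add)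
  moreover have "\<forall>Y\<in>\<S>. exp (pairing (c Y) w) = a Y" using assms mem_locus w by auto
  ultimately show ?thesis
    using mem_locus[OF assms(1), of "w + v"] a_nonzero assms(1)
    by (auto simp: pairing_add exp_add)
qed

lemma leaf_subset_locus: "\<S> \<subseteq> \<A> \<Longrightarrow> z \<in> locus \<S> \<Longrightarrow> leaf (dirs \<S>) z \<subseteq> locus \<S>"
  by (auto simp: leaf_def locus_mult mem_dirs)

lemma isCont_log_ratio:
  assumes "z \<in> torus"
  shows "isCont (\<lambda>z'. pairing u (log_ratio z z')) z"
  unfolding pairing_def log_ratio_def
  using assms by (auto simp: torus_def intro!: continuous_intros)

lemma isCont_tendsto_nhds: "isCont f z \<Longrightarrow> (f \<longlongrightarrow> f z) (nhds z)"
  unfolding isCont_def by (subst (asm) tendsto_at_iff_tendsto_nhds)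

text \<open>Between two points of the locus each functional changes by a period of exp. Near
  \<open>z\<close> the change is shorter than the shortest nonzero period, so it is zero.\<close>

lemma eventually_log_ratio_dirs:
  assumes \<S>: "\<S> \<subseteq> \<A>" and z: "z \<in> locus \<S>"
  shows "\<forall>\<^sub>F z' in nhds z. z' \<in> locus \<S> \<longrightarrow> log_ratio z z' \<in> dirs \<S>"
proof -
  have zt: "z \<in> torus" using z by (simp add: locus_def)
  have "\<forall>\<^sub>F z' in nhds z. norm (pairing (c Y) (log_ratio z z')) < 2 * pi" for Y
  proof -
    have "((\<lambda>z'. pairing (c Y) (log_ratio z z')) \<longlongrightarrow> pairing (c Y) (log_ratio z z)) (nhds z)"
      by (rule isCont_tendsto_nhds[OF isCont_log_ratio[OF zt]])
    moreover have "log_ratio z z = 0"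
      using zt by (simp add: log_ratio_def torus_def vec_eq_iff)
    ultimately show ?thesis
      using tendstoD[of _ "0::complex" "nhds z" "2 * pi"] by simp
  qed
  then have "\<forall>\<^sub>F z' in nhds z. \<forall>Y\<in>\<S>. norm (pairing (c Y) (log_ratio z z')) < 2 * pi"
    using finite_subset[OF \<S> finite_arrangement] by (simp add: eventually_ball_finite)
  then show ?thesis
  proof (rule eventually_mono, intro impI)
    fix z' assume small: "\<forall>Y\<in>\<S>. norm (pairing (c Y) (log_ratio z z')) < 2 * pi" and z': "z' \<in> locus \<S>"
    have "z * exp_cover (log_ratio z z') \<in> locus \<S>"
      using exp_cover_log_ratio[OF zt, of z'] z' by (simp add: locus_def)
    then show "log_ratio z z' \<in> dirs \<S>"
      using small exp_eq_1_small by (auto simp: locus_mult[OF \<S> z] mem_dirs)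
  qed
qed

lemma openin_leaf:
  assumes \<S>: "\<S> \<subseteq> \<A>" and z: "z \<in> locus \<S>"
  shows "openin (top_of_set (locus \<S>)) (leaf (dirs \<S>) z)"
  unfolding openin_contains_ball
proof (intro conjI ballI leaf_subset_locus assms)
  fix x assume x: "x \<in> leaf (dirs \<S>) z"
  then have xl: "x \<in> locus \<S>" using leaf_subset_locus assms by blast
  obtain e where e: "e > 0" "\<And>y. dist y x < e \<Longrightarrow> y \<in> locus \<S> \<Longrightarrow> log_ratio x y \<in> dirs \<S>"
    using eventually_log_ratio_dirs[OF \<S> xl] unfolding eventually_nhds_metric by blast
  have "ball x e \<inter> locus \<S> \<subseteq> leaf (dirs \<S>) x"
  proof
    fix y assume y: "y \<in> ball x e \<inter> locus \<S>"
    then have "log_ratio x y \<in> dirs \<S>" by (intro e(2)) (auto simp: dist_commute)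
    moreover have "x * exp_cover (log_ratio x y) = y"
      using y xl by (intro exp_cover_log_ratio) (auto simp: locus_def)
    ultimately show "y \<in> leaf (dirs \<S>) x" unfolding leaf_def by (metis image_eqI)
  qed
  then show "\<exists>e>0. ball x e \<inter> locus \<S> \<subseteq> leaf (dirs \<S>) z"
    using e(1) leaf_eq[OF subspace_dirs x] by auto
qed

lemma clopen_connected_component:
  assumes C: "openin (top_of_set K) C" "closedin (top_of_set K) C" "connected C" and x: "x \<in> C"
  shows "connected_component_set K x = C"
proof (rule connected_component_unique[OF x _ C(3)])
  show "C \<subseteq> K" using C(1) openin_imp_subset by blast
  fix D assume D: "x \<in> D" "D \<subseteq> K" "connected D"
  have "openin (top_of_set D) (D \<inter> C)" "closedin (top_of_set D) (D \<inter> C)"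
    using C(1,2) D(2) by (auto simp: openin_open closedin_closed)
  then have "D \<inter> C = {} \<or> D \<inter> C = D" using D(3) unfolding connected_clopen by blast
  then show "D \<subseteq> C" using D(1) x by blast
qed

text \<open>The leaves through points of the locus are open in it and either equal or disjoint. The
  complement of a leaf is thus a union of leaves, so each leaf is clopen, and it is connected as an
  image of a linear space.\<close>

lemma component_locus:
  assumes \<S>: "\<S> \<subseteq> \<A>" and z: "z \<in> locus \<S>"
  shows "connected_component_set (locus \<S>) z = leaf (dirs \<S>) z"
proof (rule clopen_connected_component[OF openin_leaf[OF assms] _ connected_leaf[OF subspace_dirs] leaf_self[OF subspace_dirs]])
  have "locus \<S> - leaf (dirs \<S>) z = \<Union>(leaf (dirs \<S>) ` (locus \<S> - leaf (dirs \<S>) z))"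
  proof
    show "locus \<S> - leaf (dirs \<S>) z \<subseteq> \<Union>(leaf (dirs \<S>) ` (locus \<S> - leaf (dirs \<S>) z))"
      using leaf_self[OF subspace_dirs] by blast
    show "\<Union>(leaf (dirs \<S>) ` (locus \<S> - leaf (dirs \<S>) z)) \<subseteq> locus \<S> - leaf (dirs \<S>) z"
    proof clarify
      fix x y assume y: "y \<in> locus \<S>" "y \<notin> leaf (dirs \<S>) z" and x: "x \<in> leaf (dirs \<S>) y"
      have "x \<notin> leaf (dirs \<S>) z"
        using leaf_eq[OF subspace_dirs x] leaf_eq[OF subspace_dirs, of x \<S> z] leaf_self[OF subspace_dirs, of y \<S>] y(2)
        by auto
      then show "x \<in> locus \<S> - leaf (dirs \<S>) z"
        using x leaf_subset_locus[OF \<S> y(1)] by blast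
    qed
  qed
  moreover have "openin (top_of_set (locus \<S>)) (\<Union>(leaf (dirs \<S>) ` (locus \<S> - leaf (dirs \<S>) z)))"
    by (intro openin_Union) (auto intro: openin_leaf[OF \<S>])
  ultimately show "closedin (top_of_set (locus \<S>)) (leaf (dirs \<S>) z)"
    using leaf_subset_locus[OF assms] by (simp add: closedin_def)
qed

lemma layers_eq: "layers \<A> = {leaf (dirs \<S>) z | \<S> z. \<S> \<subseteq> \<A> \<and> z \<in> locus \<S>}"
proof -
  have "components (torus \<inter> \<Inter>\<S>) = leaf (dirs \<S>) ` locus \<S>" if "\<S> \<subseteq> \<A>" for \<S>
    using component_locus[OF that] unfolding components_def locus_def[symmetric] by auto
  then show ?thesis by (auto simp: layers_def)
qed

lemma layerE:
  assumes "L \<in> layers \<A>"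
  obtains \<S> z where "\<S> \<subseteq> \<A>" "z \<in> locus \<S>" "L = leaf (dirs \<S>) z"
  using assms by (auto simp: layers_eq)

lemma layer_base:
  assumes "\<S> \<subseteq> \<A>" "z \<in> locus \<S>" "x \<in> leaf (dirs \<S>) z"
  shows "x \<in> locus \<S>" "leaf (dirs \<S>) z = leaf (dirs \<S>) x"
  using leaf_subset_locus[OF assms(1,2)] leaf_eq[OF subspace_dirs assms(3)] assms(3) by auto

subsection \<open>Finiteness\<close>

lemma finite_bounded_logarithms: "finite {s :: complex. exp s = b \<and> norm s \<le> r}"
proof (cases "\<exists>s. exp s = b")
  case True
  then obtain s0 where s0: "exp s0 = b" by blast
  let ?N = "\<lceil>(r + norm s0) / (2 * pi)\<rceil>"
  have "{s. exp s = b \<and> norm s \<le> r} \<subseteq> (\<lambda>n. s0 + complex_of_real (of_int (2 * n) * pi) * \<i>) ` {- ?N..?N}"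
  proof clarify
    fix s assume s: "b = exp s" "norm s \<le> r"
    then obtain n :: int where n: "s = s0 + complex_of_real (of_int (2 * n) * pi) * \<i>"
      using exp_eq[of s s0] s0 by auto
    have "2 * pi * \<bar>of_int n\<bar> = norm (s - s0)" by (simp add: n norm_mult abs_mult)
    also have "\<dots> \<le> r + norm s0" using norm_triangle_ineq4[of s s0] s(2) by linarith
    finally have "\<bar>of_int n\<bar> \<le> (r + norm s0) / (2 * pi)" by (simp add: field_simps)
    then have "\<bar>n\<bar> \<le> ?N" by linarith
    then show "s \<in> (\<lambda>n. s0 + complex_of_real (of_int (2 * n) * pi) * \<i>) ` {- ?N..?N}"
      by (intro image_eqI[of _ _ n] n) (simp add: abs_le_iff)
  qed
  then show ?thesis using finite_subset by blast
qed simp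

text \<open>The real part of each functional is the same at all lifts of points of the locus, being
  fixed by |\<open>a Y\<close>|. As the functionals are real, the vector of differences of real
  parts lies in \<open>dirs \<S>\<close>, and moving along it aligns the real parts with those of
  \<open>w0\<close>.\<close>

lemma leaf_meets_box:
  assumes \<S>: "\<S> \<subseteq> \<A>" and w0: "exp_cover w0 \<in> locus \<S>" and z: "z \<in> locus \<S>"
  obtains w where "exp_cover w \<in> leaf (dirs \<S>) z" "\<And>i. Re (w $ i) = Re (w0 $ i)"
    "\<And>i. 0 \<le> Im (w $ i)" "\<And>i. Im (w $ i) \<le> 2 * pi"
proof -
  obtain w1 where w1: "z = exp_cover w1" using z by (auto simp: locus_def elim: torusE)
  define u :: "complex ^ 'd" where "u = (\<chi> i. of_real (Re (w1 $ i - w0 $ i)))"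
  have "u \<in> dirs \<S>" unfolding mem_dirs
  proof
    fix Y assume Y: "Y \<in> \<S>"
    have cr: "c Y $ i = of_real (Re (c Y $ i))" for i
      using c_real Y \<S> by (metis of_real_Re subsetD)
    have "pairing (c Y) u = (\<Sum>i\<in>UNIV. of_real (Re (c Y $ i) * Re (w1 $ i - w0 $ i)))"
      unfolding pairing_def u_def by (rule sum.cong) (simp_all, metis cr)
    also have "\<dots> = of_real (Re (pairing (c Y) (w1 - w0)))"
    proof -
      have *: "Re (c Y $ i * (w1 - w0) $ i) = Re (c Y $ i) * Re (w1 $ i - w0 $ i)" for i
        using arg_cong[OF cr[of i], of Im] by simp
      show ?thesis unfolding pairing_def Re_sum of_real_sum * ..
    qed
    also have "Re (pairing (c Y) (w1 - w0)) = 0"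
    proof -
      have "exp (pairing (c Y) w1) = exp (pairing (c Y) w0)"
        using w0 z Y unfolding w1 mem_locus[OF \<S>] by auto
      then have "exp (pairing (c Y) (w1 - w0)) = 1" by (simp add: pairing_diff exp_diff)
      then have "norm (exp (pairing (c Y) (w1 - w0))) = 1" by simp
      then show ?thesis by (simp add: norm_exp_eq_Re)
    qed
    finally show "pairing (c Y) u = 0" by simp
  qed
  then have "- u \<in> dirs \<S>" using subspace_dirs vec.subspace_neg by blast
  then have l: "z * exp_cover (- u) \<in> leaf (dirs \<S>) z" by (auto simp: leaf_def)
  define n where "n = (\<lambda>i. \<lfloor>Im (w1 $ i) / (2 * pi)\<rfloor>)"
  \<comment> \<open>Subtracting multiples of 2 pi i affects neither the real parts nor the point of
    the torus, and brings the imaginary parts into the box.\<close>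
  define w :: "complex ^ 'd" where "w = (\<chi> i. (w1 - u) $ i - complex_of_real (of_int (2 * n i) * pi) * \<i>)"
  have "exp_cover w = exp_cover (w1 - u)"
    unfolding exp_cover_def vec_eq_iff
  proof
    fix i
    have "exp (w $ i) = exp ((w1 - u) $ i)"
      unfolding exp_eq by (rule exI[of _ "- n i"]) (simp add: w_def)
    then show "(\<chi> i. exp (w $ i)) $ i = (\<chi> i. exp ((w1 - u) $ i)) $ i" by simp
  qed
  also have "\<dots> = z * exp_cover (- u)" using exp_cover_add[of w1 "- u"] by (simp add: w1)
  finally have "exp_cover w \<in> leaf (dirs \<S>) z" using l by simp
  moreover have "Im (w $ i) = Im (w1 $ i) - 2 * pi * of_int (n i)" "Re (w $ i) = Re (w0 $ i)" for i
    by (simp_all add: w_def u_def)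
  moreover have "2 * pi * of_int (n i) \<le> Im (w1 $ i)" "Im (w1 $ i) - 2 * pi * of_int (n i) \<le> 2 * pi" for i
  proof -
    have "of_int (n i) \<le> Im (w1 $ i) / (2 * pi)" "Im (w1 $ i) / (2 * pi) \<le> of_int (n i) + 1"
      unfolding n_def by linarith+
    then show "2 * pi * of_int (n i) \<le> Im (w1 $ i)" "Im (w1 $ i) - 2 * pi * of_int (n i) \<le> 2 * pi"
      by (simp_all add: field_simps)
  qed
  ultimately show ?thesis by (intro that[of w]) simp_all
qed

text \<open>The values of the functionals at a lift determine the leaf. With the lift in the box,
  these values are logarithms of \<open>a Y\<close> of bounded size, and there are only finitely
  many of those.\<close>

lemma finite_leaves:
  assumes \<S>: "\<S> \<subseteq> \<A>"
  shows "finite (leaf (dirs \<S>) ` locus \<S>)"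
proof (cases "locus \<S> = {}")
  case False
  then obtain w0 where w0: "exp_cover w0 \<in> locus \<S>" by (metis IntE ex_in_conv locus_def torusE)
  define D where "D = {w. exp_cover w \<in> locus \<S> \<and>
    (\<forall>i. Re (w $ i) = Re (w0 $ i) \<and> 0 \<le> Im (w $ i) \<and> Im (w $ i) \<le> 2 * pi)}"
  define g where "g = (\<lambda>w. \<lambda>Y\<in>\<S>. pairing (c Y) w)"
  \<comment> \<open>A bound for the functionals on the box, where the real parts are those of
    \<open>w0\<close> and the imaginary parts are at most 2 pi.\<close>
  define r where "r = (\<lambda>Y. \<Sum>i\<in>UNIV. norm (c Y $ i) * (\<bar>Re (w0 $ i)\<bar> + 2 * pi))"
  have "norm (pairing (c Y) w) \<le> r Y" if "w \<in> D" for Y w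
  proof -
    have "norm (w $ i) \<le> \<bar>Re (w0 $ i)\<bar> + 2 * pi" for i
      using that cmod_le[of "w $ i"] by (auto simp: D_def) (smt (verit))
    then show ?thesis unfolding pairing_def r_def
      by (intro sum_norm_le) (auto simp: norm_mult intro!: mult_left_mono)
  qed
  then have "g ` D \<subseteq> (\<Pi>\<^sub>E Y\<in>\<S>. {s. exp s = a Y \<and> norm s \<le> r Y})"
    using mem_locus[OF \<S>] by (auto simp: g_def D_def)
  moreover have "finite (\<Pi>\<^sub>E Y\<in>\<S>. {s. exp s = a Y \<and> norm s \<le> r Y})"
    using finite_subset[OF \<S> finite_arrangement] finite_bounded_logarithms by (intro finite_PiE)
  ultimately have fin: "finite (g ` D)" by (rule finite_subset)
  have inj: "leaf (dirs \<S>) (exp_cover w) = leaf (dirs \<S>) (exp_cover w')" if "g w = g w'" for w w'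
  proof -
    have "w - w' \<in> dirs \<S>"
      unfolding mem_dirs pairing_diff
    proof
      fix Y assume "Y \<in> \<S>"
      then show "pairing (c Y) w - pairing (c Y) w' = 0"
        using fun_cong[OF that, of Y] by (simp add: g_def)
    qed
    moreover have "exp_cover w = exp_cover w' * exp_cover (w - w')" by (simp flip: exp_cover_add)
    ultimately have "exp_cover w \<in> leaf (dirs \<S>) (exp_cover w')" by (auto simp: leaf_def)
    then show ?thesis by (rule leaf_eq[OF subspace_dirs])
  qed
  have "leaf (dirs \<S>) ` locus \<S> \<subseteq> (\<lambda>y. leaf (dirs \<S>) (exp_cover (SOME w. g w = y))) ` g ` D"
  proof clarify
    fix z assume z: "z \<in> locus \<S>"
    obtain w where w: "exp_cover w \<in> leaf (dirs \<S>) z" "\<And>i. Re (w $ i) = Re (w0 $ i)"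
      "\<And>i. 0 \<le> Im (w $ i)" "\<And>i. Im (w $ i) \<le> 2 * pi"
      using leaf_meets_box[OF \<S> w0 z] by blast
    have D: "w \<in> D" using w layer_base(1)[OF \<S> z w(1)] by (auto simp: D_def)
    have "g (SOME w'. g w' = g w) = g w" by (rule someI) (rule refl)
    then have "leaf (dirs \<S>) z = leaf (dirs \<S>) (exp_cover (SOME w'. g w' = g w))"
      using inj layer_base(2)[OF \<S> z w(1)] by metis
    then show "leaf (dirs \<S>) z \<in> (\<lambda>y. leaf (dirs \<S>) (exp_cover (SOME w. g w = y))) ` g ` D"
      using D by blast
  qed
  then show ?thesis using fin finite_subset by blast
qed simp

lemma finite_layers: "finite (layers \<A>)"
proof -
  have "layers \<A> = (\<Union>\<S>\<in>Pow \<A>. leaf (dirs \<S>) ` locus \<S>)" by (auto simp: layers_eq)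
  then show ?thesis using finite_arrangement finite_leaves by auto
qed

subsection \<open>Tangent spaces and ranks\<close>

lemma vec_has_vector_derivative:
  fixes f :: "real \<Rightarrow> complex ^ 'd"
  assumes "\<And>i. ((\<lambda>t. f t $ i) has_vector_derivative f' $ i) F"
  shows "(f has_vector_derivative f') F"
proof -
  have ax: "bounded_linear (axis i :: complex \<Rightarrow> complex ^ 'd)" for i
    by (rule linear_conv_bounded_linear[THEN iffD1], rule linearI) (auto simp: axis_def vec_eq_iff)
  have sum: "(\<Sum>i\<in>UNIV. axis i (v $ i)) = v" for v :: "complex ^ 'd"
    by (simp add: vec_eq_iff axis_def if_distrib sum.delta cong: if_cong)
  have "((\<lambda>t. \<Sum>i\<in>UNIV. axis i (f t $ i)) has_vector_derivative (\<Sum>i\<in>UNIV. axis i (f' $ i))) F"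
    by (intro has_vector_derivative_sum bounded_linear.has_vector_derivative[OF ax] assms)
  then show ?thesis unfolding sum .
qed

text \<open>Divide a curve by its base point and take logarithms: near parameter 0 the result stays
  in \<open>dirs \<S>\<close>, so the functionals vanish along it and so do their derivatives.
  Conversely the curve x exp(t u) realises each direction u.\<close>

lemma tangent_space_leaf:
  assumes \<S>: "\<S> \<subseteq> \<A>" and x: "x \<in> locus \<S>"
  shows "tangent_space (leaf (dirs \<S>) x) x = (\<lambda>u. x * u) ` dirs \<S>"
proof
  have x0: "x $ i \<noteq> 0" for i using x by (simp add: locus_def torus_def)
  show "tangent_space (leaf (dirs \<S>) x) x \<subseteq> (\<lambda>u. x * u) ` dirs \<S>"
  proof
    fix v assume "v \<in> tangent_space (leaf (dirs \<S>) x) x"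
    then obtain \<gamma> :: "real \<Rightarrow> complex ^ 'd" where \<gamma>: "range \<gamma> \<subseteq> leaf (dirs \<S>) x" "\<gamma> 0 = x"
      "(\<gamma> has_vector_derivative v) (at 0)"
      by (auto simp: tangent_space_def)
    define u :: "complex ^ 'd" where "u = (\<chi> i. v $ i / x $ i)"
    have vu: "v = x * u" by (simp add: u_def vec_eq_iff x0)
    have "u \<in> dirs \<S>" unfolding mem_dirs
    proof
      fix Y assume Y: "Y \<in> \<S>"
      let ?h = "\<lambda>t. pairing (c Y) (log_ratio x (\<gamma> t))"
      have comp: "((\<lambda>t. Ln (\<gamma> t $ i / x $ i)) has_vector_derivative u $ i) (at 0)" for i
      proof -
        have 1: "((\<lambda>t. \<gamma> t $ i) has_vector_derivative v $ i) (at 0)"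
          by (rule bounded_linear.has_vector_derivative[OF bounded_linear_vec_nth \<gamma>(3)])
        have "((\<lambda>y. Ln (y / x $ i)) has_field_derivative 1 / x $ i) (at (\<gamma> 0 $ i))"
          using x0[of i] \<gamma>(2) by (auto intro!: derivative_eq_intros)
        from field_vector_diff_chain_at[OF 1 this] show ?thesis by (simp add: u_def o_def)
      qed
      have "(?h has_vector_derivative pairing (c Y) u) (at 0)"
        unfolding pairing_def log_ratio_def using comp
        by (auto intro!: has_vector_derivative_sum has_vector_derivative_mult_right)
      moreover have "(?h has_vector_derivative 0) (at 0)"
      proof -
        have "(\<gamma> \<longlongrightarrow> x) (nhds 0)"
          using isCont_tendsto_nhds[OF has_vector_derivative_continuous[OF \<gamma>(3)]] \<gamma>(2) by simp
        then have "\<forall>\<^sub>F t in nhds 0. \<gamma> t \<in> locus \<S> \<longrightarrow> log_ratio x (\<gamma> t) \<in> dirs \<S>"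
          by (rule eventually_compose_filterlim[OF eventually_log_ratio_dirs[OF \<S> x]])
        then have "\<forall>\<^sub>F t in nhds 0. ?h t = 0"
          by (rule eventually_mono) (use \<gamma>(1) leaf_subset_locus[OF \<S> x] Y in \<open>auto simp: mem_dirs\<close>)
        then obtain e where "e > 0" "\<And>t. dist t 0 < e \<Longrightarrow> ?h t = 0"
          unfolding eventually_nhds_metric by blast
        then show ?thesis
          by (intro has_vector_derivative_transform_within[OF has_vector_derivative_const, of e]) auto
      qed
      ultimately show "pairing (c Y) u = 0" by (rule vector_derivative_unique_at)
    qed
    then show "v \<in> (\<lambda>u. x * u) ` dirs \<S>" using vu by blast
  qed
  show "(\<lambda>u. x * u) ` dirs \<S> \<subseteq> tangent_space (leaf (dirs \<S>) x) x"
  proof clarify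
    fix u assume u: "u \<in> dirs \<S>"
    let ?\<gamma> = "\<lambda>t::real. x * exp_cover (complex_of_real t *s u)"
    have "range ?\<gamma> \<subseteq> leaf (dirs \<S>) x"
      using u subspace_dirs by (auto simp: leaf_def vec.subspace_scale)
    moreover have "?\<gamma> 0 = x" by simp
    moreover have "(?\<gamma> has_vector_derivative x * u) (at 0)"
    proof (rule vec_has_vector_derivative)
      fix i
      have "((\<lambda>s. x $ i * exp (s * u $ i)) has_field_derivative x $ i * u $ i) (at (complex_of_real 0))"
        by (auto intro!: derivative_eq_intros)
      from has_vector_derivative_real_field[OF this]
      show "((\<lambda>t. ?\<gamma> t $ i) has_vector_derivative (x * u) $ i) (at 0)"
        by (simp add: exp_cover_def)
    qed
    ultimately show "x * u \<in> tangent_space (leaf (dirs \<S>) x) x"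
      unfolding tangent_space_def by blast
  qed
qed

lemma dim_le_card: "vec.dim (V :: (complex ^ 'd) set) \<le> CARD('d)"
  using vec.dim_subset[OF subset_UNIV, of V] unfolding vec_dim_card .

text \<open>Multiplication by a torus point is a linear isomorphism, so all tangent spaces have the
  dimension of \<open>dirs \<S>\<close>. The leaf is nonempty, which makes the codimension unique in
  the definition of \<open>rk\<close>.\<close>

lemma rk_leaf:
  assumes \<S>: "\<S> \<subseteq> \<A>" and z: "z \<in> locus \<S>"
  shows "vec.dim (dirs \<S>) + rk (leaf (dirs \<S>) z) = CARD('d)"
proof -
  have dim: "vec.dim (tangent_space (leaf (dirs \<S>) z) x) = vec.dim (dirs \<S>)"
    if x: "x \<in> leaf (dirs \<S>) z" for x
  proof -
    note b = layer_base[OF \<S> z x]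
    have "Vector_Spaces.linear (*s) (*s) (\<lambda>u. x * u)"
      by unfold_locales (auto simp: vec_eq_iff algebra_simps)
    moreover have "inj_on (\<lambda>u. x * u) (vec.span (dirs \<S>))"
      using b(1) by (auto simp: inj_on_def vec_eq_iff locus_def torus_def)
    ultimately show ?thesis
      unfolding b(2) tangent_space_leaf[OF \<S> b(1)] by (rule vec.dim_image_eq)
  qed
  have "rk (leaf (dirs \<S>) z) = CARD('d) - vec.dim (dirs \<S>)"
    unfolding rk_def
  proof (rule the_equality)
    show "\<forall>x\<in>leaf (dirs \<S>) z. vec.dim (tangent_space (leaf (dirs \<S>) z) x) +
        (CARD('d) - vec.dim (dirs \<S>)) = CARD('d)"
      using dim dim_le_card[of "dirs \<S>"] by simp
    fix r assume "\<forall>x\<in>leaf (dirs \<S>) z. vec.dim (tangent_space (leaf (dirs \<S>) z) x) + r = CARD('d)"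
    then show "r = CARD('d) - vec.dim (dirs \<S>)"
      using dim leaf_self[OF subspace_dirs, of z \<S>] by fastforce
  qed
  then show ?thesis using dim_le_card[of "dirs \<S>"] by simp
qed

text \<open>The preimage of \<open>Y\<close> is the union of the level sets of the functional at the
  logarithms of \<open>a Y\<close>. Different logarithms are at least 2 pi apart, so each level set
  is clopen in the preimage; being a translate of the kernel, it is connected and hence a
  component.\<close>

lemma lifted_hyperplane_eq:
  assumes Y: "Y \<in> \<A>"
  shows "lifted_hyperplane Y = common_kernel {c Y}"
proof -
  let ?E = "exp_cover -` Y" and ?H = "common_kernel {c Y}"
  have H: "vec.subspace ?H" by (rule subspace_common_kernel)
  have "\<not> UNIV \<subseteq> ?H"
  proof -
    obtain i where "c Y $ i \<noteq> 0" using c_nonzero[OF Y] by (auto simp: vec_eq_iff)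
    moreover have "pairing (c Y) (axis i 1) = c Y $ i"
      by (simp add: pairing_def axis_def if_distrib sum.delta cong: if_cong)
    ultimately have "axis i 1 \<notin> ?H" by (simp add: common_kernel_def)
    then show ?thesis by blast
  qed
  then obtain \<nu> where "\<nu> \<in> UNIV" and \<nu>: "pairing (c Y) \<nu> = 1" and dim: "vec.dim (UNIV :: (complex ^ 'd) set) = vec.dim ?H + 1"
    by (rule hyperplane_section[OF vec.subspace_UNIV, of "c Y", unfolded Int_UNIV_left])
  have E: "w \<in> ?E \<longleftrightarrow> exp (pairing (c Y) w) = a Y" for w using mem_Y[OF Y] by simp
  note E_vimage = E[unfolded vimage_eq]
  have comp: "connected_component_set ?E w = (\<lambda>h. w + h) ` ?H" if w: "w \<in> ?E" for w
  proof (rule clopen_connected_component)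
    have im: "(\<lambda>h. w + h) ` ?H = {x. pairing (c Y) x = pairing (c Y) w}"
    proof (intro equalityI subsetI)
      fix x assume "x \<in> {x. pairing (c Y) x = pairing (c Y) w}"
      then have "x - w \<in> ?H" by (simp add: common_kernel_def pairing_diff)
      then show "x \<in> (\<lambda>h. w + h) ` ?H" by (intro image_eqI[of _ _ "x - w"]) auto
    qed (auto simp: common_kernel_def pairing_add)
    have "(\<lambda>h. w + h) ` ?H = ?E \<inter> (\<lambda>x. pairing (c Y) x) -` ball (pairing (c Y) w) (2 * pi)"
    proof (intro equalityI subsetI)
      fix x assume x: "x \<in> ?E \<inter> (\<lambda>x. pairing (c Y) x) -` ball (pairing (c Y) w) (2 * pi)"
      then have "exp (pairing (c Y) x - pairing (c Y) w) = 1"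
        using w a_nonzero[OF Y] by (auto simp: E_vimage exp_diff)
      moreover have "norm (pairing (c Y) x - pairing (c Y) w) < 2 * pi"
        using x by (simp add: dist_norm norm_minus_commute)
      ultimately have "pairing (c Y) x - pairing (c Y) w = 0" by (rule exp_eq_1_small)
      then show "x \<in> (\<lambda>h. w + h) ` ?H" by (simp add: im)
    qed (use w in \<open>auto simp: im E_vimage\<close>)
    moreover have "open ((\<lambda>x. pairing (c Y) x) -` ball (pairing (c Y) w) (2 * pi))"
      by (intro open_vimage continuous_intros) auto
    ultimately show "openin (top_of_set ?E) ((\<lambda>h. w + h) ` ?H)" by (metis openin_open_Int)
    have "(\<lambda>h. w + h) ` ?H = ?E \<inter> (\<lambda>x. pairing (c Y) x) -` {pairing (c Y) w}"
      using w by (auto simp: im E_vimage)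
    moreover have "closed ((\<lambda>x. pairing (c Y) x) -` {pairing (c Y) w})"
      by (intro closed_vimage continuous_intros)
    ultimately show "closedin (top_of_set ?E) ((\<lambda>h. w + h) ` ?H)" by (metis closedin_closed_Int)
    show "connected ((\<lambda>h. w + h) ` ?H)"
      by (intro connected_continuous_image continuous_intros convex_connected convex_complex_subspace H)
    show "w \<in> (\<lambda>h. w + h) ` ?H" by (simp add: im)
  qed
  \<comment> \<open>A lift exists because \<open>a Y\<close> has a logarithm. Without one the
    condition on components would be vacuous and could not single out a hyperplane.\<close>
  obtain w0 where w0: "w0 \<in> ?E"
  proof
    show "Ln (a Y) *s \<nu> \<in> ?E" unfolding E using a_nonzero[OF Y] by (simp add: pairing_scale \<nu>)
  qed
  show ?thesis
    unfolding lifted_hyperplane_def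
  proof (rule the_equality)
    show "vec.subspace ?H \<and> vec.dim ?H + 1 = CARD('d) \<and> (\<forall>K\<in>components ?E. \<exists>w. K = (\<lambda>h. w + h) ` ?H)"
      using H dim[unfolded vec_dim_card] comp by (auto simp: components_def)
    fix H' assume H': "vec.subspace H' \<and> vec.dim H' + 1 = CARD('d) \<and> (\<forall>K\<in>components ?E. \<exists>w. K = (\<lambda>h. w + h) ` H')"
    then obtain w where w: "(\<lambda>h. w0 + h) ` ?H = (\<lambda>h. w + h) ` H'"
      using comp[OF w0] w0 by (metis componentsI)
    have "w0 \<in> (\<lambda>h. w0 + h) ` ?H" using vec.subspace_0[OF H] by (intro image_eqI[of _ _ 0]) auto
    then obtain h where h: "h \<in> H'" "w0 = w + h" unfolding w by auto
    show "H' = ?H"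
    proof (intro equalityI subsetI)
      fix v assume v: "v \<in> H'"
      have "w + (h + v) \<in> (\<lambda>h. w + h) ` H'" using H' h v vec.subspace_add by blast
      then obtain k where "k \<in> ?H" "w + (h + v) = w0 + k" unfolding w[symmetric] by auto
      then show "v \<in> ?H" by (simp add: h add.assoc)
    next
      fix v assume "v \<in> ?H"
      then have "w0 + v \<in> (\<lambda>h. w + h) ` H'" unfolding w[symmetric] by auto
      then obtain k where "k \<in> H'" "w + k = w0 + v" by auto
      then have "k \<in> H'" "v = k - h" by (auto simp: h algebra_simps)
      then show "v \<in> H'" using H' h vec.subspace_diff by blast
    qed
  qed
qed

text \<open>Otherwise \<open>v\<close> could be rescaled within \<open>V\<close> to have pairing 1.
  Moving along it stays in the leaf but multiplies the value of the character by e.\<close>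

lemma leaf_subset_member:
  assumes V: "vec.subspace V" and z: "z \<in> torus" and Y: "Y \<in> \<A>" and sub: "leaf V z \<subseteq> Y" and v: "v \<in> V"
  shows "pairing (c Y) v = 0"
proof (rule ccontr)
  assume ne: "pairing (c Y) v \<noteq> 0"
  obtain w where w: "z = exp_cover w" using z by (rule torusE)
  have *: "exp (pairing (c Y) (w + u)) = a Y" if "u \<in> V" for u
    using that sub mem_Y[OF Y, of "w + u"] by (auto simp: leaf_def w exp_cover_add)
  have "exp (pairing (c Y) (w + (1 / pairing (c Y) v) *s v)) = exp (pairing (c Y) (w + 0))"
    using * v V vec.subspace_0 vec.subspace_scale by metis
  then have "exp (1 :: complex) = 1"
    using ne by (simp add: pairing_add pairing_scale exp_add)
  then have "norm (exp (1 :: complex)) = 1" by simp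
  then show False by (simp add: norm_exp_eq_Re)
qed

text \<open>Different subsets of the arrangement may cut out the same layer. Passing to all
  hypersurfaces containing it adds no linear condition, because their functionals already vanish
  along the leaf; so the local arrangement has common kernel \<open>dirs \<S>\<close>.\<close>

lemma dirs_above:
  assumes \<S>: "\<S> \<subseteq> \<A>" and z: "z \<in> locus \<S>"
  shows "dirs {Y \<in> \<A>. leaf (dirs \<S>) z \<subseteq> Y} = dirs \<S>"
proof
  have "\<S> \<subseteq> {Y \<in> \<A>. leaf (dirs \<S>) z \<subseteq> Y}"
    using \<S> leaf_subset_locus[OF \<S> z] by (auto simp: locus_def)
  then show "dirs {Y \<in> \<A>. leaf (dirs \<S>) z \<subseteq> Y} \<subseteq> dirs \<S>"
    unfolding subset_iff mem_dirs by blast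
  show "dirs \<S> \<subseteq> dirs {Y \<in> \<A>. leaf (dirs \<S>) z \<subseteq> Y}"
    using leaf_subset_member[OF subspace_dirs] z by (auto simp: mem_dirs[of _ "Collect _"] locus_def)
qed

text \<open>The codimension of the common kernel of the local arrangement is \<open>rk L\<close>,
  and this is the bound in \<open>acyclic_at_arrangement_complement\<close> with the whole space as
  ambient.\<close>

lemma acyclic_at_local_complement:
  assumes L: "L \<in> layers \<A>" and q: "rk L < q"
  shows "acyclic_at q (top_of_set (local_complement \<A> L))"
proof -
  obtain \<S> z where S: "\<S> \<subseteq> \<A>" "z \<in> locus \<S>" "L = leaf (dirs \<S>) z" using L by (rule layerE)
  let ?\<T> = "{Y \<in> \<A>. L \<subseteq> Y}"
  have "local_complement \<A> L = arrangement_complement UNIV (c ` ?\<T>)"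
    by (auto simp: local_complement_def local_arrangement_def arrangement_complement_def
        lifted_hyperplane_eq common_kernel_def)
  moreover have "common_kernel (c ` ?\<T>) = dirs \<S>"
    using dirs_above[OF S(1,2)] by (simp add: dirs_def S(3))
  moreover have "CARD('d) < q + vec.dim (dirs \<S>)" using rk_leaf[OF S(1,2)] q by (simp add: S(3))
  ultimately show ?thesis
    using acyclic_at_arrangement_complement[of "c ` ?\<T>" UNIV q] finite_arrangement
    by (simp add: vec_dim_card del: vec.dim_UNIV)
qed

subsection \<open>The poset of layers\<close>

lemma torus_eq_leaf: "torus = leaf (dirs {}) 1" and torus_locus: "1 \<in> locus {}"
  by (auto simp: leaf_def mem_dirs locus_def one_in_torus elim: torusE)

lemma torus_layer: "torus \<in> layers \<A>"
  unfolding layers_eq using torus_eq_leaf torus_locus by blast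

lemma rk_torus: "rk (torus :: (complex ^ 'd) set) = 0"
proof -
  have "dirs {} = UNIV" by (auto simp: mem_dirs)
  then show ?thesis
    using rk_leaf[OF empty_subsetI torus_locus] unfolding torus_eq_leaf[symmetric]
    by (simp add: vec_dim_card del: vec.dim_UNIV)
qed

lemma layer_subset_torus: "L \<in> layers \<A> \<Longrightarrow> L \<subseteq> torus"
  by (elim layerE) (use leaf_subset_locus in \<open>auto simp: locus_def\<close>)

lemma layer_baseE:
  assumes "L \<in> layers \<A>" "x \<in> L"
  obtains \<S> where "\<S> \<subseteq> \<A>" "x \<in> locus \<S>" "L = leaf (dirs \<S>) x"
  using assms by (elim layerE) (metis layer_base)

lemma layer_nonempty:
  assumes "L \<in> layers \<A>"
  obtains x where "x \<in> L"
  using assms by (elim layerE) (metis leaf_self subspace_dirs)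

lemma dirs_mono:
  assumes "\<S> \<subseteq> \<A>" "x \<in> locus \<S>" "\<S>' \<subseteq> \<A>" "x \<in> locus \<S>'"
    and "leaf (dirs \<S>) x \<subseteq> leaf (dirs \<S>') x"
  shows "dirs \<S> \<subseteq> dirs \<S>'"
proof
  fix v assume v: "v \<in> dirs \<S>"
  show "v \<in> dirs \<S>'" unfolding mem_dirs
  proof
    fix Y assume Y: "Y \<in> \<S>'"
    have "leaf (dirs \<S>) x \<subseteq> Y"
      using assms(5) leaf_subset_locus[OF assms(3,4)] Y by (auto simp: locus_def)
    then show "pairing (c Y) v = 0"
      using leaf_subset_member[OF subspace_dirs] assms(2,3) Y v by (auto simp: locus_def)
  qed
qed

text \<open>At a common base point the direction spaces are nested, and equal rank means equal
  dimension.\<close>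

lemma layer_eqI:
  assumes L: "L \<in> layers \<A>" and L': "L' \<in> layers \<A>" and sub: "L \<subseteq> L'"
    and rk: "rk L = rk L'"
  shows "L = L'"
proof -
  obtain x where x: "x \<in> L" using L by (rule layer_nonempty)
  obtain \<S> where S: "\<S> \<subseteq> \<A>" "x \<in> locus \<S>" "L = leaf (dirs \<S>) x" using layer_baseE[OF L x] .
  obtain \<S>' where S': "\<S>' \<subseteq> \<A>" "x \<in> locus \<S>'" "L' = leaf (dirs \<S>') x"
    using layer_baseE[OF L'] x sub by blast
  have d: "dirs \<S> \<subseteq> dirs \<S>'" using dirs_mono[OF S(1,2) S'(1,2)] sub S(3) S'(3) by simp
  have "vec.dim (dirs \<S>) + rk L = CARD('d)" "vec.dim (dirs \<S>') + rk L' = CARD('d)"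
    using rk_leaf[OF S(1,2)] rk_leaf[OF S'(1,2)] S(3) S'(3) by auto
  then show ?thesis
    using vec.subspace_dim_equal[OF subspace_dirs subspace_dirs d] rk S(3) S'(3) by simp
qed

text \<open>A base point in \<open>L\<close> turns all layers containing \<open>L\<close> into
  leaves through that point, and their inclusions into inclusions of direction spaces. The meet is
  the leaf of the intersection of the two spaces; its rank is bounded by the dimension formula, as
  their sum has dimension at most d.\<close>

lemma layer_meet:
  assumes L: "L \<in> layers \<A>" and L1: "L1 \<in> layers \<A>" and L2: "L2 \<in> layers \<A>"
    and sub: "L \<subseteq> L1" "L \<subseteq> L2"
  shows "\<exists>L0\<in>layers \<A>. L \<subseteq> L0 \<and> L0 \<subseteq> L1 \<inter> L2 \<and> rk L0 \<le> rk L1 + rk L2 \<and>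
    (\<forall>M\<in>layers \<A>. L \<subseteq> M \<longrightarrow> M \<subseteq> L1 \<inter> L2 \<longrightarrow> M \<subseteq> L0)"
proof -
  obtain x where x: "x \<in> L" using L by (rule layer_nonempty)
  obtain \<S>1 where S1: "\<S>1 \<subseteq> \<A>" "x \<in> locus \<S>1" "L1 = leaf (dirs \<S>1) x"
    using layer_baseE[OF L1] x sub by blast
  obtain \<S>2 where S2: "\<S>2 \<subseteq> \<A>" "x \<in> locus \<S>2" "L2 = leaf (dirs \<S>2) x"
    using layer_baseE[OF L2] x sub by blast
  let ?\<U> = "\<S>1 \<union> \<S>2" and ?L0 = "leaf (dirs (\<S>1 \<union> \<S>2)) x"
  have U: "?\<U> \<subseteq> \<A>" "x \<in> locus ?\<U>" using S1 S2 by (auto simp: locus_def)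
  have below: "M \<subseteq> ?L0" if M: "M \<in> layers \<A>" "L \<subseteq> M" "M \<subseteq> L1 \<inter> L2" for M
  proof -
    obtain \<T> where T: "\<T> \<subseteq> \<A>" "x \<in> locus \<T>" "M = leaf (dirs \<T>) x" using layer_baseE[OF M(1)] x M(2) by blast
    have "dirs \<T> \<subseteq> dirs \<S>1" "dirs \<T> \<subseteq> dirs \<S>2"
      using dirs_mono[OF T(1,2) S1(1,2)] dirs_mono[OF T(1,2) S2(1,2)] M(3) T(3) S1(3) S2(3) by auto
    then show ?thesis unfolding T(3) by (intro leaf_mono) (simp add: dirs_Un)
  qed
  have "vec.dim (dirs \<S>1) + vec.dim (dirs \<S>2) \<le> CARD('d) + vec.dim (dirs ?\<U>)"
    using vec.dim_sums_Int[OF subspace_dirs[of \<S>1] subspace_dirs[of \<S>2]]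
      dim_le_card[of "{x + y |x y. x \<in> dirs \<S>1 \<and> y \<in> dirs \<S>2}"] by (simp add: dirs_Un)
  then have "rk ?L0 \<le> rk L1 + rk L2"
    using rk_leaf[OF U] rk_leaf[OF S1(1,2)] rk_leaf[OF S2(1,2)] S1(3) S2(3) by simp
  moreover have "?L0 \<subseteq> L1 \<inter> L2" unfolding S1(3) S2(3) using leaf_mono by (simp add: dirs_Un leaf_mono)
  moreover have "?L0 \<in> layers \<A>" using U layers_eq by blast
  ultimately show ?thesis using below L sub by (intro bexI[of _ ?L0]) auto
qed

lemma local_complement_mono:
  assumes "L \<subseteq> L'"
  shows "local_complement \<A> L \<subseteq> local_complement \<A> L'"
  using assms by (auto simp: local_complement_def local_arrangement_def)

lemma tensor_pair_cohomology: "tensor_pair (cohomology_ring X) (cohomology_ring Y)"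
  by (intro tensor_pair.intro graded_pieces_cohomology_ring)

text \<open>All maps are induced by inclusions, so the conditions on them are functoriality of
  pullback; the remaining conditions are the facts about layers and the vanishing established
  above.\<close>

lemma layer_system: "layer_system (layers \<A>) rk torus (\<lambda>L. cohomology_ring (top_of_set L))
    (\<lambda>L. cohomology_ring (top_of_set (local_complement \<A> L)))
    (\<lambda>L' L. cohomology_map (top_of_set L) (\<lambda>x. x))
    (\<lambda>L' L. cohomology_map (top_of_set (local_complement \<A> L)) (\<lambda>x. x))"
proof (rule layer_system.intro)
  have cm: "continuous_map (top_of_set A) (top_of_set B) (\<lambda>x. x)" if "A \<subseteq> B" for A B :: "(complex ^ 'd) set"
    using that by auto
  note lc = cm[OF local_complement_mono]
  show "graded_hom (cohomology_ring (top_of_set L')) (cohomology_ring (top_of_set L))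
      (cohomology_map (top_of_set L) (\<lambda>x. x))" if "L \<subseteq> L'" for L L' :: "(complex ^ 'd) set"
    by (rule graded_hom_cohomology_map[OF cm[OF that]])
  show "graded_hom (cohomology_ring (top_of_set (local_complement \<A> L')))
      (cohomology_ring (top_of_set (local_complement \<A> L)))
      (cohomology_map (top_of_set (local_complement \<A> L)) (\<lambda>x. x))" if "L \<subseteq> L'" for L L'
    by (rule graded_hom_cohomology_map[OF lc[OF that]])
  show "cohomology_map (top_of_set L) (\<lambda>x. x) p x =
      cohomology_map (top_of_set L) (\<lambda>x. x) p (cohomology_map (top_of_set L') (\<lambda>x. x) p x)"
    if "L \<subseteq> L'" "L' \<subseteq> L''" "x \<in> carrier (gpart (cohomology_ring (top_of_set L'')) p)"
    for L L' L'' :: "(complex ^ 'd) set" and p x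
    using cohomology_map_comp[OF cm[OF that(1)] cm[OF that(2)], of x p] that(3) by (simp add: cohomology_ring_simps)
  show "cohomology_map (top_of_set (local_complement \<A> L)) (\<lambda>x. x) p x =
      cohomology_map (top_of_set (local_complement \<A> L)) (\<lambda>x. x) p
        (cohomology_map (top_of_set (local_complement \<A> L')) (\<lambda>x. x) p x)"
    if "L \<subseteq> L'" "L' \<subseteq> L''" "x \<in> carrier (gpart (cohomology_ring (top_of_set (local_complement \<A> L''))) p)"
    for L L' L'' p x
    using cohomology_map_comp[OF lc[OF that(1)] lc[OF that(2)], of x p] that(3) by (simp add: cohomology_ring_simps)
  show "carrier (gpart (cohomology_ring (top_of_set (local_complement \<A> L))) q) =
      {\<one>\<^bsub>gpart (cohomology_ring (top_of_set (local_complement \<A> L))) q\<^esub>}"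
    if "L \<in> layers \<A>" "rk L < q" for L q
    using trivial_cohomology_group[OF acyclic_at_local_complement[OF that]] by (simp add: cohomology_ring_simps)
qed (use finite_layers torus_layer rk_torus layer_subset_torus layer_eqI layer_meet tensor_pair_cohomology in
      \<open>auto simp: cohomology_ring_simps cohomology_map_ident\<close>)

theorem algebra_A_iso_algebra_B: "algebra_A \<A> \<simeq> algebra_B \<A>"
  using layer_system.alg_A_iso_alg_B[OF layer_system]
  unfolding layer_system.alg_A_def[OF layer_system] layer_system.alg_B_def[OF layer_system]
    layer_system.is_coherent_def[OF layer_system, abs_def]
  unfolding algebra_A_def algebra_B_def coherent_def[abs_def] local_ring_def local_map_def .

end

text \<open>The exponent vector of the monomial representing a character serves as \<open>c\<close>.
  Were it zero, the character would be constantly 1, against nontriviality.\<close>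

lemma toric_arrangement_data:
  assumes "toric_arrangement \<A>"
  obtains c a where "toric_data \<A> c a"
proof -
  have "\<exists>c a. (\<forall>w. exp_cover w \<in> Y \<longleftrightarrow> exp (pairing c w) = a) \<and> c \<noteq> 0 \<and> a \<noteq> 0 \<and> (\<forall>i. c $ i \<in> \<real>)"
    if Y: "Y \<in> \<A>" for Y
  proof -
    obtain f a where f: "torus_character f" "\<exists>z\<in>torus. f z \<noteq> 1" "a \<noteq> 0" "Y = {z \<in> torus. f z = a}"
      using assms Y unfolding toric_arrangement_def by metis
    obtain m where m: "\<And>z. z \<in> torus \<Longrightarrow> f z = monomial m z"
      using torus_character_monomial[OF f(1)] by blast
    let ?c = "\<chi> i. complex_of_int (m i)"
    have fe: "f (exp_cover w) = exp (pairing ?c w)" for w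
      by (simp add: m monomial_exp_cover)
    have "?c \<noteq> 0"
    proof
      assume 0: "?c = 0"
      obtain z where z: "z \<in> torus" "f z \<noteq> 1" using f(2) by blast
      then obtain w where "z = exp_cover w" by (elim torusE)
      with z fe[of w] show False by (simp add: 0) (simp add: pairing_def)
    qed
    then show ?thesis
      using f(3,4) fe by (intro exI[of _ ?c] exI[of _ a]) auto
  qed
  then obtain c a where "\<forall>Y\<in>\<A>. (\<forall>w. exp_cover w \<in> Y \<longleftrightarrow> exp (pairing (c Y) w) = a Y) \<and>
      c Y \<noteq> 0 \<and> a Y \<noteq> 0 \<and> (\<forall>i. c Y $ i \<in> \<real>)" by metis
  then have "toric_data \<A> c a"
    using assms by unfold_locales (auto simp: toric_arrangement_def)
  then show ?thesis by (rule that)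
qed

theorem theorem2:
  fixes \<A> :: "(complex ^ 'd) set set"
  assumes "toric_arrangement \<A>"
  shows "algebra_A \<A> \<simeq> algebra_B \<A>"
proof -
  obtain c a where "toric_data \<A> c a" using assms by (rule toric_arrangement_data)
  then show ?thesis by (rule toric_data.algebra_A_iso_algebra_B)
qed

end
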